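(* Let $F$ be an alternative division algebra of characteristic different from $2$ and $3$, finite-dimensional over $k=Z(F)$, let $\mathcal A=F\oplus F$ be the structurable $k$-algebra with multiplication $(a,b)(c,d)=(ac,db)$ and involution $(x,y)\mapsto(y,x)$, and set $\mathcal L=K(\mathcal A)$. Consider the graph $\Omega=(V,E)$ with $$V=\{I\mid I\text{ is a proper non-minimal non-trivial inner ideal of }\mathcal L\},\qquad E=\{\{I,J\}\mid I\cap J\neq 0\}.$$ Then $\Omega$ is the incidence graph of a Moufang triangle. Its root groups can be identified with $$U_1=e_-((F,0),0),\quad U_2=e_-(0,\mathcal S),\quad U_3=e_-((0,F),0),$$ and the commutator relations are as in $E_-(\mathcal A)$. Moreover, the point-line geometry $\Gamma$ whose points are the minimal proper non-trivial inner ideals of $\mathcal L$ and whose lines are the non-minimal proper non-trivial inner ideals of $\mathcal L$, with inclusion as incidence, is a thin generalized hexagon, which is the dual double of this Moufang triangle.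
   Context: For a structurable algebra $\mathcal A$ over $k$ (a unital $k$-algebra with involution satisfying a certain identity; $\mathcal A=F\oplus F$ as in the claim is one) put $V_{x,y}(z)=(x\overline y)z+(z\overline y)x-(z\overline x)y$, $\mathcal S=\{s\in\mathcal A:\overline s=-s\}$ (here $\mathcal S=\{(x,-x)\mid x\in F\}$), $\psi(x,y)=x\overline y-y\overline x$; $L_x,R_x$ denote left and right multiplication. $\mathrm{Instrl}(\mathcal A)=\mathrm{span}\{V_{x,y}\mid x,y\in\mathcal A\}\le\mathrm{End}(\mathcal A)$; for $A\in\mathrm{End}(\mathcal A)$, $A^\epsilon=A-L_{A(1)+\overline{A(1)}}$, $A^\delta=A+R_{\overline{A(1)}}$, $A^{\epsilon\delta}=(A^\epsilon)^\delta$. With copies $\mathcal A_\pm$ of $\mathcal A$ and $\mathcal S_\pm$ of $\mathcal S$, $K(\mathcal A)=\mathcal S_-\oplus\mathcal A_-\oplus\mathrm{Instrl}(\mathcal A)\oplus\mathcal A_+\oplus\mathcal S_+$ is a Lie algebra over $k$ with bracket extending that of $\mathrm{Instrl}(\mathcal A)$ and: $[V,a_+]=(Va)_+$, $[V,a_-]=(V^\epsilon a)_-$, $[V,s_+]=(V^\delta s)_+$, $[V,s_-]=(V^{\epsilon\delta}s)_-$, $[s_\pm,a_\pm]=0$, $[s_+,a_-]=(sa)_+$, $[s_-,a_+]=(sa)_-$, $[a_+,b_-]=V_{a,b}$, $[a_\pm,b_\pm]=\psi(a,b)_\pm\in\mathcal S_\pm$, $[s_\pm,t_\pm]=0$, $[s_+,t_-]=L_sL_t$.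 $e_-(a,s)=\exp(\mathrm{ad}(a_-+s_-))$ is an automorphism of $K(\mathcal A)$ for all $a\in\mathcal A$, $s\in\mathcal S$; $E_-(\mathcal A)=\{e_-(a,s)\mid a\in\mathcal A,s\in\mathcal S\}$ is a group with multiplication $fg:=g\circ f$, so that $e_-(a,s)e_-(b,t)=e_-(a+b,s+t+\tfrac12\psi(a,b))$. Write $e_-((F,0),0)=\{e_-((f,0),0)\mid f\in F\}$, $e_-((0,F),0)=\{e_-((0,f),0)\mid f\in F\}$, $e_-(0,\mathcal S)=\{e_-(0,s)\mid s\in\mathcal S\}$. Automorphisms of $K(\mathcal A)$ act on $\Omega$. An inner ideal of a Lie algebra $\mathcal L$ is a subspace $I$ with $[I,[I,\mathcal L]]\le I$; it is trivial if $I=0$, proper if $I\ne\mathcal L$; minimal means minimal among the non-trivial inner ideals. Edges of a graph are pairs of distinct vertices. A partial linear space is a point-line geometry in which two distinct points lie on at most one line. A generalized $n$-gon ($n\ge3$) is a partial linear space containing no ordinary $m$-gons for $m<n$ and such that any two elements (points or lines) lie in a common ordinary $n$-gon ($n=3$: generalized triangle; $n=6$: generalized hexagon). The hexagon is thin in the sense that every point lies on exactly two lines. For a path $(x_0,\dots,x_n)$ in the incidence graph of a generalized $n$-gon, the root group $U(x_0,\dots,x_n)$ is the group of automorphisms of the incidence graph fixing all vertices at distance $\le1$ from one of $x_1,\dots,x_{n-1}$. The generalized $n$-gon is Moufang (for $n=3$: a Moufang triangle) if for all such paths $U(x_0,\dots,x_n)$ acts transitively on the neighbors of $x_0$ distinct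 from $x_1$. When a cycle $(x_0,\dots,x_{2n-1},x_{2n}=x_0)$ of length $2n$ in the incidence graph is fixed, one writes $U_i=U(x_i,\dots,x_{n+i})$ for $1\le i\le n$. The dual double of a point-line geometry $\Delta$ has as points the flags (incident point-line pairs) of $\Delta$ and as lines the points and the lines of $\Delta$. *)

theory Defs
  imports
    Complex_Main
    "HOL-Library.Function_Algebras"
    "HOL-Library.Product_Plus"
    "HOL-Algebra.Bij"
    "HOL-Algebra.Generated_Groups"
begin

section \<open>Non-associative algebras\<close>

record ('k, 'a) nalgebra =
  scal :: "'k \<Rightarrow> 'a \<Rightarrow> 'a"
  mul :: "'a \<Rightarrow> 'a \<Rightarrow> 'a"
  unity :: 'a

record ('k, 'a) ialgebra = "('k, 'a) nalgebra" +
  invo :: "'a \<Rightarrow> 'a"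

locale unital_algebra = vector_space "scal F"
  for F :: "('k::field, 'a::ab_group_add, 'm) nalgebra_scheme" +
  assumes mul_add_left: "mul F (x + y) z = mul F x z + mul F y z"
    and mul_add_right: "mul F x (y + z) = mul F x y + mul F x z"
    and mul_scal_left: "mul F (scal F c x) y = scal F c (mul F x y)"
    and mul_scal_right: "mul F x (scal F c y) = scal F c (mul F x y)"
    and unity_left: "mul F (unity F) x = x"
    and unity_right: "mul F x (unity F) = x"

locale alternative_division_algebra = unital_algebra F
  for F :: "('k::field, 'a::ab_group_add, 'm) nalgebra_scheme" +
  assumes left_alternative: "mul F (mul F x x) y = mul F x (mul F x y)"
    and right_alternative: "mul F (mul F y x) x = mul F y (mul F x x)"
    and unity_nonzero: "unity F \<noteq> 0"
    and invertible: "x \<noteq> 0 \<Longrightarrow> \<exists>y. mul F x y = unity F \<and> mul F y x = unity F"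

text \<open>The centre of a non-associative algebra: the elements that commute and associate
  with all others.\<close>

definition centre :: "('k, 'a, 'm) nalgebra_scheme \<Rightarrow> 'a set" where
  "centre F = {z. \<forall>x y. mul F z x = mul F x z
      \<and> mul F (mul F z x) y = mul F z (mul F x y)
      \<and> mul F (mul F x z) y = mul F x (mul F z y)
      \<and> mul F (mul F x y) z = mul F x (mul F y z)}"

definition double :: "('k, 'a, 'm) nalgebra_scheme \<Rightarrow> ('k, 'a \<times> 'a) ialgebra" where
  "double F = \<lparr> scal = (\<lambda>c (x, y). (scal F c x, scal F c y)),
      mul = (\<lambda>(a, b) (c, d). (mul F a c, mul F d b)),
      unity = (unity F, unity F),
      invo = (\<lambda>(x, y). (y, x)) \<rparr>"

section \<open>The Lie algebra of an algebra with involution\<close>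

definition skew :: "('k, 'a::ab_group_add) ialgebra \<Rightarrow> 'a set" where
  "skew A = {s. invo A s = - s}"

definition psi :: "('k, 'a::ab_group_add) ialgebra \<Rightarrow> 'a \<Rightarrow> 'a \<Rightarrow> 'a" where
  "psi A x y = mul A x (invo A y) - mul A y (invo A x)"

definition V_op :: "('k, 'a::ab_group_add) ialgebra \<Rightarrow> 'a \<Rightarrow> 'a \<Rightarrow> 'a \<Rightarrow> 'a" where
  "V_op A x y z = mul A (mul A x (invo A y)) z + mul A (mul A z (invo A y)) x
      - mul A (mul A z (invo A x)) y"

definition Instrl :: "('k::field, 'a::ab_group_add) ialgebra \<Rightarrow> ('a \<Rightarrow> 'a) set" where
  "Instrl A = module.span (\<lambda>c T x. scal A c (T x)) {V_op A x y | x y. True}"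

definition eps :: "('k, 'a::ab_group_add) ialgebra \<Rightarrow> ('a \<Rightarrow> 'a) \<Rightarrow> 'a \<Rightarrow> 'a" where
  "eps A T = (\<lambda>x. T x - mul A (T (unity A) + invo A (T (unity A))) x)"

definition delta :: "('k, 'a::ab_group_add) ialgebra \<Rightarrow> ('a \<Rightarrow> 'a) \<Rightarrow> 'a \<Rightarrow> 'a" where
  "delta A T = (\<lambda>x. T x + mul A x (invo A (T (unity A))))"

text \<open>A tuple \<open>(s, a, T, b, t)\<close> stands for \<open>s\<close>\<open>\<^sub>-\<close> + \<open>a\<close>\<open>\<^sub>-\<close> + \<open>T\<close> + \<open>b\<close>\<open>\<^sub>+\<close> + \<open>t\<close>\<open>\<^sub>+\<close>.\<close>

type_synonym 'a kan = "'a \<times> 'a \<times> ('a \<Rightarrow> 'a) \<times> 'a \<times> 'a"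

definition K :: "('k::field, 'a::ab_group_add) ialgebra \<Rightarrow> 'a kan set" where
  "K A = skew A \<times> UNIV \<times> Instrl A \<times> UNIV \<times> skew A"

definition scalK :: "('k, 'a) ialgebra \<Rightarrow> 'k \<Rightarrow> 'a kan \<Rightarrow> 'a kan" where
  "scalK A c = (\<lambda>(s, a, T, b, t).
      (scal A c s, scal A c a, (\<lambda>x. scal A c (T x)), scal A c b, scal A c t))"

text \<open>In each homogeneous component the bracket is the sum of all products of homogeneous
  parts of that degree, with the products not listed in the definition of the Lie algebra
  obtained by anticommutativity.\<close>

fun bracket :: "('k, 'a::ab_group_add) ialgebra \<Rightarrow> 'a kan \<Rightarrow> 'a kan \<Rightarrow> 'a kan" where
  "bracket A (s, a, T, b, t) (s', a', T', b', t') =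
    (psi A a a' + delta A (eps A T) s' - delta A (eps A T') s,
     eps A T a' - eps A T' a + mul A s b' - mul A s' b,
     (\<lambda>x. T (T' x) - T' (T x) + V_op A b a' x - V_op A b' a x
        + mul A t (mul A s' x) - mul A t' (mul A s x)),
     T b' - T' b + mul A t a' - mul A t' a,
     psi A b b' + delta A T t' - delta A T' t)"

text \<open>\<open>exp (ad (a\<^sub>- + s\<^sub>-))\<close>: the element \<open>a\<^sub>- + s\<^sub>-\<close> only has components of negative degree in
  the 5-grading, so the fifth power of its adjoint map vanishes, and the exponential series
  stops after the fourth power, whose coefficient is defined in characteristic
  different from 2 and 3.\<close>

definition e_minus :: "('k::field, 'a::ab_group_add) ialgebra \<Rightarrow> 'a \<Rightarrow> 'a \<Rightarrow> 'a kan \<Rightarrow> 'a kan" where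
  "e_minus A a s = (\<lambda>x \<in> K A.
      \<Sum>i\<le>4. scalK A (inverse (of_nat (fact i))) ((bracket A (s, a, 0, 0, 0) ^^ i) x))"

definition E_minus :: "('k::field, 'a::ab_group_add) ialgebra \<Rightarrow> ('a kan \<Rightarrow> 'a kan) set" where
  "E_minus A = {e_minus A a s | a s. s \<in> skew A}"

text \<open>Groups of maps are written with the product \<open>f g := g \<circ> f\<close>. The library's \<open>BijGroup\<close> has the
  opposite multiplication.  As \<open>[a\<^sub>-, b\<^sub>-] = psi a b\<^sub>-\<close>, the Baker-Campbell-Hausdorff formula gives
  \<open>e_minus b t \<circ> e_minus a s = e_minus (a + b) (s + t + 1/2 psi b a)\<close>, so with this product the
  commutator of \<open>e_minus a s\<close> and \<open>e_minus b t\<close> is \<open>e_minus 0 (psi b a)\<close>; the product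
  \<open>f \<circ> g\<close> would give \<open>psi a b\<close>.\<close>

definition E_minus_group :: "('k::field, 'a::ab_group_add) ialgebra \<Rightarrow> ('a kan \<Rightarrow> 'a kan) monoid" where
  "E_minus_group A = \<lparr> carrier = E_minus A,
      mult = (\<lambda>f g. compose (K A) g f),
      one = (\<lambda>x \<in> K A. x) \<rparr>"

definition group_commutator :: "('g, 'm) monoid_scheme \<Rightarrow> 'g \<Rightarrow> 'g \<Rightarrow> 'g" where
  "group_commutator G x y =
    inv\<^bsub>G\<^esub> x \<otimes>\<^bsub>G\<^esub> inv\<^bsub>G\<^esub> y \<otimes>\<^bsub>G\<^esub> x \<otimes>\<^bsub>G\<^esub> y"

section \<open>Inner ideals\<close>

definition inner_ideal :: "('k::field, 'a::ab_group_add) ialgebra \<Rightarrow> 'a kan set \<Rightarrow> bool" where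
  "inner_ideal A I \<longleftrightarrow> I \<subseteq> K A \<and> module.subspace (scalK A) I
      \<and> (\<forall>x \<in> I. \<forall>y \<in> I. \<forall>l \<in> K A. bracket A x (bracket A y l) \<in> I)"

definition nontrivial_inner_ideal :: "('k::field, 'a::ab_group_add) ialgebra \<Rightarrow> 'a kan set \<Rightarrow> bool" where
  "nontrivial_inner_ideal A I \<longleftrightarrow> inner_ideal A I \<and> I \<noteq> {0}"

definition minimal_inner_ideal :: "('k::field, 'a::ab_group_add) ialgebra \<Rightarrow> 'a kan set \<Rightarrow> bool" where
  "minimal_inner_ideal A I \<longleftrightarrow> nontrivial_inner_ideal A I
      \<and> (\<forall>J. nontrivial_inner_ideal A J \<and> J \<subseteq> I \<longrightarrow> J = I)"

definition min_ideals :: "('k::field, 'a::ab_group_add) ialgebra \<Rightarrow> 'a kan set set" where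
  "min_ideals A = {I. nontrivial_inner_ideal A I \<and> I \<noteq> K A \<and> minimal_inner_ideal A I}"

definition nonmin_ideals :: "('k::field, 'a::ab_group_add) ialgebra \<Rightarrow> 'a kan set set" where
  "nonmin_ideals A = {I. nontrivial_inner_ideal A I \<and> I \<noteq> K A \<and> \<not> minimal_inner_ideal A I}"

section \<open>Graphs and point-line geometries\<close>

record 'v ugraph =
  gverts :: "'v set"
  gedges :: "'v set set"

definition graph_iso :: "('v \<Rightarrow> 'w) \<Rightarrow> 'v ugraph \<Rightarrow> 'w ugraph \<Rightarrow> bool" where
  "graph_iso f G H \<longleftrightarrow> bij_betw f (gverts G) (gverts H)
      \<and> (\<forall>x \<in> gverts G. \<forall>y \<in> gverts G. {f x, f y} \<in> gedges H \<longleftrightarrow> {x, y} \<in> gedges G)"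

definition graph_aut_group :: "'v ugraph \<Rightarrow> ('v \<Rightarrow> 'v) monoid" where
  "graph_aut_group G = \<lparr> carrier = {f \<in> extensional (gverts G). graph_iso f G G},
      mult = (\<lambda>f g. compose (gverts G) g f),
      one = (\<lambda>x \<in> gverts G. x) \<rparr>"

definition graph_path :: "'v ugraph \<Rightarrow> 'v list \<Rightarrow> bool" where
  "graph_path G xs \<longleftrightarrow> distinct xs \<and> set xs \<subseteq> gverts G
      \<and> (\<forall>i. Suc i < length xs \<longrightarrow> {xs ! i, xs ! Suc i} \<in> gedges G)"

definition graph_cycle :: "'v ugraph \<Rightarrow> 'v list \<Rightarrow> bool" where
  "graph_cycle G xs \<longleftrightarrow> 3 \<le> length xs \<and> distinct xs \<and> set xs \<subseteq> gverts G
      \<and> (\<forall>i < length xs. {xs ! i, xs ! (Suc i mod length xs)} \<in> gedges G)"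

text \<open>\<open>xs = [x\<^sub>0, \<dots>, x\<^sub>n]\<close>; the automorphisms fix every vertex at distance at most 1 from one of
  the inner vertices \<open>x\<^sub>1, \<dots>, x\<^sub>n\<^sub>-\<^sub>1\<close>.\<close>

definition root_group :: "'v ugraph \<Rightarrow> 'v list \<Rightarrow> ('v \<Rightarrow> 'v) set" where
  "root_group G xs = {g \<in> carrier (graph_aut_group G).
      \<forall>i. 1 \<le> i \<and> Suc i < length xs \<longrightarrow>
        (\<forall>y \<in> gverts G. y = xs ! i \<or> {y, xs ! i} \<in> gedges G \<longrightarrow> g y = y)}"

text \<open>\<open>U\<^sub>i = U(x\<^sub>i, \<dots>, x\<^sub>n\<^sub>+\<^sub>i)\<close> for the cycle \<open>xs = [x\<^sub>0, \<dots>, x\<^sub>2\<^sub>n\<^sub>-\<^sub>1]\<close>, with indices modulo \<open>2n\<close>.\<close>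

definition cycle_root_group :: "'v ugraph \<Rightarrow> nat \<Rightarrow> 'v list \<Rightarrow> nat \<Rightarrow> ('v \<Rightarrow> 'v) set" where
  "cycle_root_group G n xs i = root_group G (map (\<lambda>j. xs ! (j mod (2 * n))) [i..<Suc (n + i)])"

record ('p, 'l) geometry =
  gpoints :: "'p set"
  glines :: "'l set"
  ginc :: "'p \<Rightarrow> 'l \<Rightarrow> bool"

definition incidence_graph :: "('p, 'l) geometry \<Rightarrow> ('p + 'l) ugraph" where
  "incidence_graph D = \<lparr> gverts = gpoints D <+> glines D,
      gedges = {{Inl p, Inr l} | p l. p \<in> gpoints D \<and> l \<in> glines D \<and> ginc D p l} \<rparr>"

definition partial_linear_space :: "('p, 'l) geometry \<Rightarrow> bool" where
  "partial_linear_space D \<longleftrightarrow>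
    (\<forall>p \<in> gpoints D. \<forall>q \<in> gpoints D. \<forall>l \<in> glines D. \<forall>m \<in> glines D.
      p \<noteq> q \<and> ginc D p l \<and> ginc D q l \<and> ginc D p m \<and> ginc D q m \<longrightarrow> l = m)"

definition ordinary_gon :: "('p, 'l) geometry \<Rightarrow> nat \<Rightarrow> 'p list \<Rightarrow> 'l list \<Rightarrow> bool" where
  "ordinary_gon D m ps ls \<longleftrightarrow> 2 \<le> m \<and> length ps = m \<and> length ls = m
      \<and> distinct ps \<and> distinct ls \<and> set ps \<subseteq> gpoints D \<and> set ls \<subseteq> glines D
      \<and> (\<forall>i < m. ginc D (ps ! i) (ls ! i) \<and> ginc D (ps ! (Suc i mod m)) (ls ! i))"

definition generalized_gon :: "nat \<Rightarrow> ('p, 'l) geometry \<Rightarrow> bool" where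
  "generalized_gon n D \<longleftrightarrow> 3 \<le> n \<and> partial_linear_space D
      \<and> (\<forall>m < n. \<not> (\<exists>ps ls. ordinary_gon D m ps ls))
      \<and> (\<forall>x \<in> gpoints D <+> glines D. \<forall>y \<in> gpoints D <+> glines D.
          \<exists>ps ls. ordinary_gon D n ps ls \<and> x \<in> set ps <+> set ls \<and> y \<in> set ps <+> set ls)"

definition thin :: "('p, 'l) geometry \<Rightarrow> bool" where
  "thin D \<longleftrightarrow> (\<forall>p \<in> gpoints D. card {l \<in> glines D. ginc D p l} = 2)"

definition moufang_gon :: "nat \<Rightarrow> ('p, 'l) geometry \<Rightarrow> bool" where
  "moufang_gon n D \<longleftrightarrow> generalized_gon n D
      \<and> (\<forall>xs. graph_path (incidence_graph D) xs \<and> length xs = Suc n \<longrightarrow>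
          (\<forall>y z. {xs ! 0, y} \<in> gedges (incidence_graph D) \<and> y \<noteq> xs ! 1
               \<and> {xs ! 0, z} \<in> gedges (incidence_graph D) \<and> z \<noteq> xs ! 1 \<longrightarrow>
            (\<exists>g \<in> root_group (incidence_graph D) xs. g y = z)))"

definition dual_double :: "('p, 'l) geometry \<Rightarrow> ('p \<times> 'l, 'p + 'l) geometry" where
  "dual_double D = \<lparr>
      gpoints = {(p, l). p \<in> gpoints D \<and> l \<in> glines D \<and> ginc D p l},
      glines = gpoints D <+> glines D,
      ginc = (\<lambda>(p, l) x. x = Inl p \<or> x = Inr l) \<rparr>"

definition geometry_iso ::
  "('p \<Rightarrow> 'q) \<Rightarrow> ('l \<Rightarrow> 'm) \<Rightarrow> ('p, 'l) geometry \<Rightarrow> ('q, 'm) geometry \<Rightarrow> bool" where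
  "geometry_iso f g D D' \<longleftrightarrow> bij_betw f (gpoints D) (gpoints D')
      \<and> bij_betw g (glines D) (glines D')
      \<and> (\<forall>p \<in> gpoints D. \<forall>l \<in> glines D. ginc D' (f p) (g l) \<longleftrightarrow> ginc D p l)"

section \<open>The graph and the geometry of inner ideals\<close>

definition Omega :: "('k::field, 'a::ab_group_add) ialgebra \<Rightarrow> 'a kan set ugraph" where
  "Omega A = \<lparr> gverts = nonmin_ideals A,
      gedges = {{I, J} | I J. I \<in> nonmin_ideals A \<and> J \<in> nonmin_ideals A \<and> I \<noteq> J
                  \<and> I \<inter> J \<noteq> {0}} \<rparr>"

definition Gamma :: "('k::field, 'a::ab_group_add) ialgebra \<Rightarrow> ('a kan set, 'a kan set) geometry" where
  "Gamma A = \<lparr> gpoints = min_ideals A, glines = nonmin_ideals A, ginc = (\<subseteq>) \<rparr>"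

definition act_Omega ::
  "('k::field, 'a::ab_group_add) ialgebra \<Rightarrow> ('a kan \<Rightarrow> 'a kan) \<Rightarrow> 'a kan set \<Rightarrow> 'a kan set" where
  "act_Omega A g = (\<lambda>I \<in> nonmin_ideals A. g ` I)"

end

theory Submission
  imports Defs "HOL-Library.Numeral_Type"
begin

text \<open>The Lie algebra of the double of \<open>F\<close> is graded by the root system \<open>A\<^sub>2\<close>, with six root spaces that
  are copies of \<open>F\<close>; the zero part acts on them by trialities, and the Jacobi identity reduces to the
  Moufang identities. A proper inner ideal that contains a root space is this root space or its sum
  with one of the two neighbouring root spaces. For a height function that is injective on the roots,
  the leading terms of the elements of an inner ideal again form an inner ideal, and this shows that
  a suitable product of exponentials of negative root elements maps any proper non-trivial inner
  ideal to one that contains a root space (a Bruhat decomposition). Hence the non-minimal inner ideals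
  are the images of the six sums of neighbouring root spaces, the position in this cycle of six is an
  invariant that changes by one along an edge, and any two ideals lie in a common apartment. The
  exponentials of root elements act transitively as root groups, and there are no other elations
  because an elation of a projective plane is determined by the image of one point.\<close>

section \<open>Lie algebras graded by the root system \<open>A\<^sub>2\<close>\<close>

text \<open>An arbitrary inner ideal need not be the sum of its intersections with the root spaces,
  so the classification of the ideals that contain a root space says nothing about it at first. Its
  ideal of leading terms is homogeneous, and negative exponentials leave leading terms unchanged; so
  this ideal is known before a conjugating element is built, and it bounds the components that can
  survive in any conjugate. For the same reason the position in the cycle does not depend on the
  conjugating element. The base root \<open>b\<close> stays variable: a second reduction based at
  the position of a first ideal keeps that ideal in place while it straightens another one, which
  gives the common apartments. Characteristics 2 and 3 are excluded by the factors 2 and 4 of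
  \<open>sl_2\<close>-theory, by a relation \<open>3 p = 0\<close>, and by the denominators of the
  exponential series. An element of degree zero is stored as six maps of \<open>F\<close>, one for
  each root, tied together by Leibniz rules; two such families agree as soon as a few of the maps
  agree, which keeps the identities to be verified at the level of the Moufang identities.\<close>

lemma add_6 [simp]:
  fixes i :: 6
  shows "i + 1 + 1 = i + 2" "i + 1 + 2 = i + 3" "i + 1 + 3 = i + 4" "i + 1 + 4 = i + 5" "i + 1 + 5 = i"
    "i + 2 + 1 = i + 3" "i + 2 + 2 = i + 4" "i + 2 + 3 = i + 5" "i + 2 + 4 = i" "i + 2 + 5 = i + 1"
    "i + 3 + 1 = i + 4" "i + 3 + 2 = i + 5" "i + 3 + 3 = i" "i + 3 + 4 = i + 1" "i + 3 + 5 = i + 2"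
    "i + 4 + 1 = i + 5" "i + 4 + 2 = i" "i + 4 + 3 = i + 1" "i + 4 + 4 = i + 2" "i + 4 + 5 = i + 3"
    "i + 5 + 1 = i" "i + 5 + 2 = i + 1" "i + 5 + 3 = i + 2" "i + 5 + 4 = i + 3" "i + 5 + 5 = i + 4"
  by simp_all

text \<open>Together with \<open>add_6\<close> this keeps indices in the normal form
  \<open>i + c\<close> with \<open>c\<close> at most 5, so that sums and differences of roots with a
  variable base root are evaluated by rewriting.\<close>

lemma minus_6 [simp]:
  fixes i j :: 6
  shows "i - 1 = i + 5" "i - 2 = i + 4" "i - 3 = i + 3" "i - 4 = i + 2" "i - 5 = i + 1"
    "i - (i + 1) = 5" "i - (i + 2) = 4" "i - (i + 3) = 3" "i - (i + 4) = 2" "i - (i + 5) = 1"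
  by (simp_all add: algebra_simps)

lemma UNIV_6: "(UNIV :: 6 set) = {i, i + 1, i + 2, i + 3, i + 4, i + 5}"
  by (rule sym, rule card_subset_eq) simp_all

lemma cases_6:
  fixes i j :: 6
  obtains "j = i" | "j = i + 1" | "j = i + 2" | "j = i + 3" | "j = i + 4" | "j = i + 5"
  using UNIV_6[of i] UNIV_I[of j] by blast

lemma sum_6:
  fixes f :: "6 \<Rightarrow> 'a::comm_monoid_add"
  shows "(\<Sum>j\<in>UNIV. f j) = f i + f (i + 1) + f (i + 2) + f (i + 3) + f (i + 4) + f (i + 5)"
  unfolding UNIV_6[of i] by (simp add: add.assoc[where 'a='a])

text \<open>The roots of \<open>A\<^sub>2\<close> are numbered cyclically by \<open>\<int>/6\<close>, so that the roots \<open>i\<close> and \<open>i + 2\<close> add up to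
  the root \<open>i + 1\<close>, and \<open>i + 3\<close> is the negative of \<open>i\<close>. The Cartan integer of the roots \<open>i\<close> and \<open>j\<close> is
  \<open>cart (j - i)\<close>.\<close>

definition cart :: "6 \<Rightarrow> 'k::field" where
  "cart j = (if j = 0 then 2 else if j = 1 \<or> j = 5 then 1 else if j = 3 then - 2 else - 1)"

lemma cart_simps [simp]: "cart 0 = 2" "cart 1 = 1" "cart 2 = - 1" "cart 3 = - 2" "cart 4 = - 1" "cart 5 = 1"
  by (simp_all add: cart_def)

text \<open>\<open>pr i\<close> is the projection to the root space \<open>i\<close>, \<open>pz\<close> the projection to the zero part. The assumption
  \<open>division\<close> says that every non-zero root element is the first member of an \<open>sl\<^sub>2\<close>-triple whose middle
  member is the coroot.\<close>

locale a2_graded_lie_algebra = vector_space sc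
  for sc :: "'k::field \<Rightarrow> 'l::ab_group_add \<Rightarrow> 'l" +
  fixes K :: "'l set" and br :: "'l \<Rightarrow> 'l \<Rightarrow> 'l" and pr :: "6 \<Rightarrow> 'l \<Rightarrow> 'l" and pz :: "'l \<Rightarrow> 'l"
  assumes K: "subspace K"
    and br_closed [simp]: "x \<in> K \<Longrightarrow> y \<in> K \<Longrightarrow> br x y \<in> K"
    and br_add_left: "x \<in> K \<Longrightarrow> y \<in> K \<Longrightarrow> z \<in> K \<Longrightarrow> br (x + y) z = br x z + br y z"
    and br_add_right: "x \<in> K \<Longrightarrow> y \<in> K \<Longrightarrow> z \<in> K \<Longrightarrow> br x (y + z) = br x y + br x z"
    and br_scale_left: "x \<in> K \<Longrightarrow> y \<in> K \<Longrightarrow> br (sc c x) y = sc c (br x y)"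
    and br_self: "x \<in> K \<Longrightarrow> br x x = 0"
    and jacobi: "x \<in> K \<Longrightarrow> y \<in> K \<Longrightarrow> z \<in> K \<Longrightarrow> br x (br y z) = br (br x y) z + br y (br x z)"
    and pr_add: "pr i (x + y) = pr i x + pr i y" and pr_scale: "pr i (sc c x) = sc c (pr i x)"
    and pz_add: "pz (x + y) = pz x + pz y" and pz_scale: "pz (sc c x) = sc c (pz x)"
    and pr_closed [simp]: "x \<in> K \<Longrightarrow> pr i x \<in> K" and pz_closed [simp]: "x \<in> K \<Longrightarrow> pz x \<in> K"
    and pr_pr [simp]: "pr i (pr j x) = (if i = j then pr j x else 0)"
    and pr_pz [simp]: "pr i (pz x) = 0" and pz_pr [simp]: "pz (pr i x) = 0" and pz_pz [simp]: "pz (pz x) = pz x"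
    and decomp: "x \<in> K \<Longrightarrow> x = pz x + (\<Sum>i\<in>UNIV. pr i x)"
    and pr_br: "x \<in> K \<Longrightarrow> y \<in> K \<Longrightarrow> pr i (br x y) = br (pz x) (pr i y) + br (pr i x) (pz y)
        + br (pr (i + 5) x) (pr (i + 1) y) + br (pr (i + 1) x) (pr (i + 5) y)"
    and pz_br: "x \<in> K \<Longrightarrow> y \<in> K \<Longrightarrow>
        pz (br x y) = br (pz x) (pz y) + (\<Sum>j\<in>UNIV. br (pr j x) (pr (j + 3) y))"
    and faithful: "x \<in> K \<Longrightarrow> pz x = x \<Longrightarrow> (\<And>i y. y \<in> K \<Longrightarrow> br x (pr i y) = 0) \<Longrightarrow> x = 0"
    and division: "x \<in> K \<Longrightarrow> pr i x = x \<Longrightarrow> x \<noteq> 0 \<Longrightarrow>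
        \<exists>y \<in> K. pr (i + 3) y = y \<and> (\<forall>j. \<forall>z \<in> K. br (br x y) (pr j z) = sc (cart (j - i)) (pr j z))"
    and root_space_nonzero: "\<exists>x \<in> K. pr i x \<noteq> 0"
    and zero_space_generated: "subspace W \<Longrightarrow>
        (\<And>i x y. x \<in> K \<Longrightarrow> y \<in> K \<Longrightarrow> br (pr i x) (pr (i + 3) y) \<in> W) \<Longrightarrow> x \<in> K \<Longrightarrow> pz x \<in> W"
    and two_nonzero [simp]: "(2 :: 'k) \<noteq> 0" and three_nonzero [simp]: "(3 :: 'k) \<noteq> 0"
begin

section \<open>Calculus of brackets and components\<close>

lemma K_0 [simp]: "0 \<in> K" and K_add [simp]: "x \<in> K \<Longrightarrow> y \<in> K \<Longrightarrow> x + y \<in> K"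
  and K_scale [simp]: "x \<in> K \<Longrightarrow> sc c x \<in> K" and K_neg [simp]: "x \<in> K \<Longrightarrow> - x \<in> K"
  and K_diff [simp]: "x \<in> K \<Longrightarrow> y \<in> K \<Longrightarrow> x - y \<in> K"
  using K by (auto intro: subspace_0 subspace_add subspace_scale subspace_neg subspace_diff)

lemma K_sum: "(\<And>i. i \<in> S \<Longrightarrow> f i \<in> K) \<Longrightarrow> sum f S \<in> K"
  using K by (rule subspace_sum)

lemma br_anti: assumes "x \<in> K" "y \<in> K" shows "br y x = - br x y"
proof -
  have "br (x + y) (x + y) = 0" using assms by (intro br_self) simp
  then have "br x x + br y x + (br x y + br y y) = 0" using assms by (simp add: br_add_left br_add_right)
  then have "br x y + br y x = 0" using assms by (simp add: br_self add.commute)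
  then show ?thesis by (simp add: eq_neg_iff_add_eq_0 add.commute)
qed

lemma br_scale_right: assumes "x \<in> K" "y \<in> K" shows "br x (sc c y) = sc c (br x y)"
  using br_anti[of x "sc c y"] br_anti[of x y] br_scale_left[of y x c] br_anti[of "sc c y" x] assms by simp

lemma br_0_left [simp]: "x \<in> K \<Longrightarrow> br 0 x = 0" and br_0_right [simp]: "x \<in> K \<Longrightarrow> br x 0 = 0"
  using br_scale_left[of 0 x 0] br_scale_right[of x 0 0] by simp_all

lemma br_neg_left: "x \<in> K \<Longrightarrow> y \<in> K \<Longrightarrow> br (- x) y = - br x y"
  and br_neg_right: "x \<in> K \<Longrightarrow> y \<in> K \<Longrightarrow> br x (- y) = - br x y"
  using br_scale_left[of x y "-1"] br_scale_right[of x y "-1"] by simp_all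

lemma br_diff_left: "x \<in> K \<Longrightarrow> y \<in> K \<Longrightarrow> z \<in> K \<Longrightarrow> br (x - y) z = br x z - br y z"
  and br_diff_right: "x \<in> K \<Longrightarrow> y \<in> K \<Longrightarrow> z \<in> K \<Longrightarrow> br z (x - y) = br z x - br z y"
  using br_add_left[of x "- y" z] br_add_right[of z x "- y"] by (simp_all add: br_neg_left br_neg_right)

lemmas br_linear = br_add_left br_add_right br_scale_left br_scale_right
  br_neg_left br_neg_right br_diff_left br_diff_right

lemma br_sum_right: "(\<And>i. i \<in> S \<Longrightarrow> f i \<in> K) \<Longrightarrow> y \<in> K \<Longrightarrow> br y (sum f S) = (\<Sum>i\<in>S. br y (f i))"
  by (induction S rule: infinite_finite_induct) (auto simp: br_add_right K_sum)

lemma pr_0 [simp]: "pr i 0 = 0" and pz_0 [simp]: "pz 0 = 0"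
  using pr_scale[of i 0 0] pz_scale[of 0 0] by simp_all

lemma pr_neg: "pr i (- x) = - pr i x" and pz_neg: "pz (- x) = - pz x"
  using pr_scale[of i "-1" x] pz_scale[of "-1" x] by simp_all

lemma pr_diff: "pr i (x - y) = pr i x - pr i y" and pz_diff: "pz (x - y) = pz x - pz y"
  using pr_add[of i x "- y"] pz_add[of x "- y"] by (simp_all add: pr_neg pz_neg)

lemma pr_sum: "pr i (sum f S) = (\<Sum>s\<in>S. pr i (f s))"
  by (induction S rule: infinite_finite_induct) (auto simp: pr_add)

lemma pz_sum: "pz (sum f S) = (\<Sum>s\<in>S. pz (f s))"
  by (induction S rule: infinite_finite_induct) (auto simp: pz_add)

lemmas pr_linear = pr_add pr_scale pr_neg pr_diff pz_add pz_scale pz_neg pz_diff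

lemma decomp_at: "x \<in> K \<Longrightarrow>
    x = pz x + pr i x + pr (i + 1) x + pr (i + 2) x + pr (i + 3) x + pr (i + 4) x + pr (i + 5) x"
  using decomp[of x] by (simp add: sum_6[of _ i] add.assoc[where 'a='l])

lemma pz_br_at: "x \<in> K \<Longrightarrow> y \<in> K \<Longrightarrow> pz (br x y) = br (pz x) (pz y)
    + br (pr i x) (pr (i + 3) y) + br (pr (i + 1) x) (pr (i + 4) y) + br (pr (i + 2) x) (pr (i + 5) y)
    + br (pr (i + 3) x) (pr i y) + br (pr (i + 4) x) (pr (i + 1) y) + br (pr (i + 5) x) (pr (i + 2) y)"
  by (simp add: pz_br sum_6[of _ i] add.assoc[where 'a='l])

lemma zero_if: assumes "x \<in> K" "pz x = 0" "\<And>j. pr j x = 0" shows "x = 0"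
  using decomp[OF assms(1)] assms by simp

lemma eq_if: assumes "x \<in> K" "y \<in> K" "pz x = pz y" "\<And>j. pr j x = pr j y" shows "x = y"
  using zero_if[of "x - y"] assms by (simp add: pr_linear)

definition R :: "6 \<Rightarrow> 'l set" where "R i = {x \<in> K. pr i x = x}"
definition Z :: "'l set" where "Z = {x \<in> K. pz x = x}"

lemma R_K: "x \<in> R i \<Longrightarrow> x \<in> K" and Z_K: "x \<in> Z \<Longrightarrow> x \<in> K"
  by (simp_all add: R_def Z_def)

lemma R_D: assumes "x \<in> R i" shows "x \<in> K" "pz x = 0" "pr j x = (if j = i then x else 0)"
  using assms pr_pr[of j i x] pz_pr[of i x] by (auto simp: R_def)

lemma Z_D: assumes "x \<in> Z" shows "x \<in> K" "pz x = x" "pr j x = 0"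
  using assms pr_pz[of j x] by (auto simp: Z_def)

lemma pr_R [simp]: "x \<in> K \<Longrightarrow> pr i x \<in> R i" and pz_Z [simp]: "x \<in> K \<Longrightarrow> pz x \<in> Z"
  by (simp_all add: R_def Z_def)

lemma subspace_R: "subspace (R i)" and subspace_Z: "subspace Z"
  by (auto simp: subspace_def R_def Z_def pr_linear)

lemmas R_closed = subspace_0[OF subspace_R] subspace_add[OF subspace_R] subspace_neg[OF subspace_R]
  subspace_diff[OF subspace_R] subspace_scale[OF subspace_R]
lemmas Z_closed = subspace_0[OF subspace_Z] subspace_add[OF subspace_Z] subspace_neg[OF subspace_Z]
  subspace_diff[OF subspace_Z] subspace_scale[OF subspace_Z]

lemma R_I: assumes "x \<in> K" "pz x = 0" "\<And>j. j \<noteq> i \<Longrightarrow> pr j x = 0" shows "x \<in> R i"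
proof -
  have "pr i x = x" by (rule eq_if) (use assms in auto)
  then show ?thesis using assms by (simp add: R_def)
qed

lemma Z_I: assumes "x \<in> K" "\<And>j. pr j x = 0" shows "x \<in> Z"
proof -
  have "pz x = x" by (rule eq_if) (use assms in auto)
  then show ?thesis using assms by (simp add: Z_def)
qed

lemma br_Z_Z: assumes "x \<in> Z" "y \<in> Z" shows "br x y \<in> Z"
  by (rule Z_I) (simp_all add: pr_br Z_D[OF assms(1)] Z_D[OF assms(2)])

lemma br_Z_R: assumes "x \<in> Z" "y \<in> R i" shows "br x y \<in> R i"
  by (rule R_I) (simp_all add: pr_br pz_br Z_D[OF assms(1)] R_D[OF assms(2)])

lemma br_R_Z: assumes "x \<in> R i" "y \<in> Z" shows "br x y \<in> R i"
  by (rule R_I) (simp_all add: pr_br pz_br R_D[OF assms(1)] Z_D[OF assms(2)])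

lemma br_R_2: assumes "x \<in> R i" "y \<in> R (i + 2)" shows "br x y \<in> R (i + 1)"
proof (rule R_I)
  fix j assume "j \<noteq> i + 1" then show "pr j (br x y) = 0"
    by (cases j i rule: cases_6) (simp_all add: pr_br R_D[OF assms(1)] R_D[OF assms(2)])
qed (simp_all add: pz_br_at[of _ _ i] R_D[OF assms(1)] R_D[OF assms(2)])

lemma br_R_4: assumes "x \<in> R i" "y \<in> R (i + 4)" shows "br x y \<in> R (i + 5)"
  using br_R_2[of y "i + 4" x] br_anti[of y x] assms by (simp add: R_closed R_K)

lemma br_R_3: assumes "x \<in> R i" "y \<in> R (i + 3)" shows "br x y \<in> Z"
proof (rule Z_I)
  fix j show "pr j (br x y) = 0"
    by (cases j i rule: cases_6) (simp_all add: pr_br R_D[OF assms(1)] R_D[OF assms(2)])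
qed (simp add: R_D[OF assms(1)] R_D[OF assms(2)])

lemma br_R_0: assumes "x \<in> R i" "y \<in> R i" shows "br x y = 0"
proof (rule zero_if)
  fix j show "pr j (br x y) = 0"
    by (cases j i rule: cases_6) (simp_all add: pr_br R_D[OF assms(1)] R_D[OF assms(2)])
qed (simp_all add: pz_br_at[of _ _ i] R_D[OF assms(1)] R_D[OF assms(2)])

lemma br_R_1: assumes "x \<in> R i" "y \<in> R (i + 1)" shows "br x y = 0"
proof (rule zero_if)
  fix j show "pr j (br x y) = 0"
    by (cases j i rule: cases_6) (simp_all add: pr_br R_D[OF assms(1)] R_D[OF assms(2)])
qed (simp_all add: pz_br_at[of _ _ i] R_D[OF assms(1)] R_D[OF assms(2)])

lemma br_R_5: assumes "x \<in> R i" "y \<in> R (i + 5)" shows "br x y = 0"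
  using br_R_1[of y "i + 5" x] br_anti[of y x] assms by (simp add: R_K)

text \<open>The coroot element of the root \<open>i\<close>.\<close>

definition H :: "6 \<Rightarrow> 'l" where
  "H i = (SOME h. h \<in> Z \<and> (\<forall>j. \<forall>z \<in> K. br h (pr j z) = sc (cart (j - i)) (pr j z)))"

lemma Z_eq_if: assumes "x \<in> Z" "y \<in> Z" "\<And>j z. z \<in> R j \<Longrightarrow> br x z = br y z" shows "x = y"
proof -
  have "x - y = 0"
    by (rule faithful) (use assms(1,2) in \<open>simp_all add: Z_D pr_linear br_diff_left assms(3)[OF pr_R]\<close>)
  then show ?thesis by simp
qed

lemma H: "H i \<in> Z" "z \<in> R j \<Longrightarrow> br (H i) z = sc (cart (j - i)) z"
proof -
  obtain x where x: "x \<in> K" "pr i x \<noteq> 0" using root_space_nonzero by blast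
  obtain y where y: "y \<in> K" "pr (i + 3) y = y"
      "\<forall>j. \<forall>z \<in> K. br (br (pr i x) y) (pr j z) = sc (cart (j - i)) (pr j z)"
    using division[of "pr i x" i] x by auto
  have "y \<in> R (i + 3)" using y by (simp add: R_def)
  then have "br (pr i x) y \<in> Z" by (intro br_R_3[of _ i]) (simp_all add: x)
  then have "\<exists>h. h \<in> Z \<and> (\<forall>j. \<forall>z \<in> K. br h (pr j z) = sc (cart (j - i)) (pr j z))" using y by blast
  from someI_ex[OF this] have *: "H i \<in> Z" "\<forall>j. \<forall>z \<in> K. br (H i) (pr j z) = sc (cart (j - i)) (pr j z)"
    by (auto simp: H_def)
  then show "H i \<in> Z" by simp
  assume "z \<in> R j" then have "pr j z = z" "z \<in> K" by (simp_all add: R_def)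
  then show "br (H i) z = sc (cart (j - i)) z" using *(2) by metis
qed

text \<open>\<open>H i\<close> acts on each root space as a scalar and \<open>T\<close> preserves
  the root spaces, so the two actions commute; \<open>faithful\<close> turns this into an equation
  in \<open>Z\<close>.\<close>

lemma H_Z: assumes "T \<in> Z" shows "br (H i) T = 0"
proof (rule Z_eq_if)
  fix j z assume z: "z \<in> R j"
  have "br (H i) (br T z) = br (br (H i) T) z + br T (br (H i) z)"
    using z by (intro jacobi) (auto intro: R_K Z_K H assms)
  moreover have "br T z \<in> R j" using assms z by (rule br_Z_R)
  ultimately show "br (br (H i) T) z = br 0 z" using z assms
    by (simp add: H br_scale_right R_K Z_K)
qed (use assms in \<open>auto intro: br_Z_Z H Z_closed\<close>)

text \<open>The middle member supplied by \<open>division\<close> acts on every root space by the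
  same Cartan integers as \<open>H i\<close>, so by faithfulness it equals \<open>H i\<close>,
  whatever \<open>x\<close> is.\<close>

lemma coroot: assumes "x \<in> R i" "x \<noteq> 0" obtains y where "y \<in> R (i + 3)" "br x y = H i" "y \<noteq> 0"
proof -
  obtain y where y: "y \<in> K" "pr (i + 3) y = y"
      "\<forall>j. \<forall>z \<in> K. br (br x y) (pr j z) = sc (cart (j - i)) (pr j z)"
    using division[of x i] assms by (auto simp: R_def)
  have y': "y \<in> R (i + 3)" using y by (simp add: R_def)
  have "br x y = H i"
  proof (rule Z_eq_if)
    show "br x y \<in> Z" using assms(1) y' by (rule br_R_3)
    show "br (br x y) z = br (H i) z" if "z \<in> R j" for j z
    proof -
      have "pr j z = z" "z \<in> K" using that by (simp_all add: R_def)
      then show ?thesis using y(3) H(2)[OF that] by metis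
    qed
  qed (rule H)
  moreover have "y \<noteq> 0"
  proof
    assume "y = 0"
    then have "H i = 0" using calculation assms by (simp add: R_K)
    then have "br (H i) x = 0" using assms by (simp add: R_K)
    then show False using H(2)[OF assms(1), of i] assms by simp
  qed
  ultimately show ?thesis using that y' by blast
qed

lemma H_neg: "H (i + 3) = - H i"
proof (rule Z_eq_if)
  fix j z assume "z \<in> R j"
  moreover have "cart (j - (i + 3)) = - (cart (j - i) :: 'k)"
    by (cases j i rule: cases_6) (simp_all add: cart_def)
  ultimately show "br (H (i + 3)) z = br (- H i) z" by (simp add: H br_neg_left R_K Z_K)
qed (auto intro: H Z_closed)

section \<open>The \<open>sl_2\<close>-triple of a root element\<close>

lemma R_nonzero: obtains x where "x \<in> R i" "x \<noteq> 0"
  using root_space_nonzero[of i] pr_R by blast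

text \<open>\<open>z\<close> is a lowest weight vector of weight -1 for the triple of
  \<open>x\<close>: the opposite element \<open>x'\<close> kills it, as \<open>i + 3\<close> and
  \<open>i + 2\<close> are neighbours. If \<open>x\<close> killed it too, so would the coroot, which
  acts as -1.\<close>

lemma br_2_inj: assumes "x \<in> R i" "x \<noteq> 0" "z \<in> R (i + 2)" "br x z = 0" shows "z = 0"
proof -
  obtain x' where x': "x' \<in> R (i + 3)" "br x x' = H i" using coroot[OF assms(1,2)] .
  have "br x (br x' z) = br (br x x') z + br x' (br x z)"
    by (intro jacobi R_K[OF assms(1)] R_K[OF x'(1)] R_K[OF assms(3)])
  moreover have "br x' z = 0" using br_R_5[of x' "i + 3" z] x' assms by simp
  ultimately show ?thesis using assms x' H(2)[OF assms(3), of i] by (simp add: R_K)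
qed

lemma br_4_inj: assumes "x \<in> R i" "x \<noteq> 0" "z \<in> R (i + 4)" "br x z = 0" shows "z = 0"
proof -
  obtain x' where x': "x' \<in> R (i + 3)" "br x x' = H i" using coroot[OF assms(1,2)] .
  have "br x (br x' z) = br (br x x') z + br x' (br x z)"
    by (intro jacobi R_K[OF assms(1)] R_K[OF x'(1)] R_K[OF assms(3)])
  moreover have "br x' z = 0" using br_R_1[of x' "i + 3" z] x' assms by simp
  ultimately show ?thesis using assms x' H(2)[OF assms(3), of i] by (simp add: R_K)
qed

text \<open>The preimage is \<open>[x', w]\<close>: \<open>w\<close> is a highest weight vector of
  weight 1, so \<open>[x, [x', w]] = w\<close>.\<close>

lemma br_2_surj: assumes "x \<in> R i" "x \<noteq> 0" "w \<in> R (i + 1)" obtains z where "z \<in> R (i + 2)" "br x z = w"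
proof -
  obtain x' where x': "x' \<in> R (i + 3)" "br x x' = H i" using coroot[OF assms(1,2)] .
  have "br x (br x' w) = br (br x x') w + br x' (br x w)"
    by (intro jacobi R_K[OF assms(1)] R_K[OF x'(1)] R_K[OF assms(3)])
  moreover have "br x w = 0" using br_R_1[OF assms(1,3)] .
  moreover have "br x' w \<in> R (i + 2)" using br_R_4[of x' "i + 3" w] x' assms by simp
  ultimately show ?thesis using that x' assms H(2)[OF assms(3), of i] by (simp add: R_K)
qed

lemma br_4_surj: assumes "x \<in> R i" "x \<noteq> 0" "w \<in> R (i + 5)" obtains z where "z \<in> R (i + 4)" "br x z = w"
proof -
  obtain x' where x': "x' \<in> R (i + 3)" "br x x' = H i" using coroot[OF assms(1,2)] .
  have "br x (br x' w) = br (br x x') w + br x' (br x w)"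
    by (intro jacobi R_K[OF assms(1)] R_K[OF x'(1)] R_K[OF assms(3)])
  moreover have "br x w = 0" using br_R_5[OF assms(1,3)] .
  moreover have "br x' w \<in> R (i + 4)" using br_R_2[of x' "i + 3" w] x' assms by simp
  ultimately show ?thesis using that x' assms H(2)[OF assms(3), of i] by (simp add: R_K)
qed

text \<open>In \<open>sl\<^sub>2\<close>-notation \<open>e = x\<close>, \<open>f = x'\<close>, this is \<open>e\<^sup>2 f\<^sup>2 w = 4 w\<close> on a highest weight vector \<open>w\<close> of
  weight 2.\<close>

lemma sl2_weight_2:
  assumes "x \<in> R i" "x' \<in> R (i + 3)" "br x x' = H i" "w \<in> R i"
  shows "br x (br x (br x' (br x' w))) = sc 4 w"
proof -
  note K = R_K[OF assms(1)] R_K[OF assms(2)] R_K[OF assms(4)] Z_K[OF H(1)]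
  have fw: "br x' w \<in> Z" using br_R_3[of x' "i + 3" w] assms by simp
  have e1: "br x (br x' w) = sc 2 w"
    using jacobi[OF K(1,2,3)] br_R_0[OF assms(1,4)] H(2)[OF assms(4), of i] K assms by simp
  have "br x (br x' (br x' w)) = br (br x x') (br x' w) + br x' (br x (br x' w))"
    by (intro jacobi K Z_K[OF fw])
  also have "\<dots> = sc 2 (br x' w)" using H_Z[OF fw] K by (simp add: assms(3) e1 br_scale_right)
  finally have "br x (br x (br x' (br x' w))) = sc 2 (br x (br x' w))"
    using K by (simp add: br_scale_right)
  then show ?thesis by (simp add: e1)
qed

lemma ad2_surj: assumes "x \<in> R i" "x \<noteq> 0" "w \<in> R i" obtains z where "z \<in> R (i + 3)" "br x (br x z) = w"
proof -
  obtain x' where x': "x' \<in> R (i + 3)" "br x x' = H i" using coroot[OF assms(1,2)] .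
  \<comment> \<open>The factor 4 of \<open>sl2_weight_2\<close> is divided out.\<close>
  let ?v = "sc (1/4) (br x' (br x' w))"
  have 4: "(4::'k) \<noteq> 0" using two_nonzero by (metis mult_2 mult_eq_0_iff numeral_Bit0)
  have fw: "br x' w \<in> Z" using br_R_3[of x' "i + 3" w] assms x' by simp
  have "?v \<in> R (i + 3)" using br_R_Z[OF x'(1) fw] by (rule subspace_scale[OF subspace_R])
  moreover have "br x (br x ?v) = w"
    using sl2_weight_2[OF assms(1) x' assms(3)] R_K[OF assms(1)] R_K[OF x'(1)] R_K[OF assms(3)] 4
    by (simp add: br_scale_right)
  ultimately show ?thesis using that by blast
qed

text \<open>\<open>sl2_weight_2\<close> for the triple with \<open>x\<close> and \<open>x'\<close>
  interchanged, whose coroot is \<open>H (i + 3)\<close>, recovers \<open>4 z\<close> from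
  \<open>[x, [x, z]]\<close>.\<close>

lemma ad2_inj: assumes "x \<in> R i" "x \<noteq> 0" "z \<in> R (i + 3)" "br x (br x z) = 0" shows "z = 0"
proof -
  obtain x' where x': "x' \<in> R (i + 3)" "br x x' = H i" using coroot[OF assms(1,2)] .
  have 4: "(4::'k) \<noteq> 0" using two_nonzero by (metis mult_2 mult_eq_0_iff numeral_Bit0)
  have K: "x \<in> K" "x' \<in> K" "z \<in> K" using assms x' by (simp_all add: R_K)
  have "br x' x = H (i + 3)" using br_anti[of x x'] K x' H_neg by simp
  then have "br x' (br x' (br x (br x z))) = sc 4 z"
    using sl2_weight_2[of x' "i + 3" x z] assms x' by simp
  then show ?thesis using assms K 4 by simp
qed

text \<open>\<open>T\<close> commutes with the coroot \<open>[y, y']\<close> and kills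
  \<open>y'\<close>, so the Leibniz rule gives \<open>[[T, y], y'] = 0\<close>, and
  \<open>ad2_inj\<close> for \<open>y'\<close> applies to \<open>[T, y]\<close>.\<close>

lemma Z_kills_opposite:
  assumes T: "T \<in> Z" and kill: "\<And>x. x \<in> R i \<Longrightarrow> br T x = 0" and y: "y \<in> R (i + 3)"
  shows "br T y = 0"
proof (cases "y = 0")
  case False
  obtain y' where y': "y' \<in> R i" "br y y' = H (i + 3)" "y' \<noteq> 0"
    using coroot[OF y False] by (auto simp: add_6)
  have K: "T \<in> K" "y \<in> K" "y' \<in> K" using T y y' by (simp_all add: R_K Z_K)
  have Ty: "br T y \<in> R (i + 3)" using br_Z_R[OF T y] .
  have "br T (H (i + 3)) = 0" using H_Z[OF T] br_anti[of "H (i + 3)" T] K by (simp add: H Z_K)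
  moreover have "br T (br y y') = br (br T y) y' + br y (br T y')" by (intro jacobi K)
  ultimately have "br (br T y) y' = 0" using kill y' K by simp
  then have "br y' (br T y) = 0" using br_anti[of "br T y" y'] K by simp
  then have "br y' (br y' (br T y)) = 0" using K by simp
  then show ?thesis using ad2_inj[OF y'(1,3) Ty] by simp
qed (use T in \<open>simp add: Z_K\<close>)

text \<open>\<open>T\<close> also kills the two opposite root spaces, and the remaining two are
  brackets: \<open>R (i + 2)\<close> comes from \<open>R (i + 1)\<close> and
  \<open>R (i + 3)\<close>, and \<open>R (i + 5)\<close> from \<open>R i\<close> and
  \<open>R (i + 4)\<close>.\<close>

lemma Z_zero_if: assumes T: "T \<in> Z" and kill: "\<And>x. x \<in> R i \<Longrightarrow> br T x = 0" "\<And>x. x \<in> R (i + 1) \<Longrightarrow> br T x = 0"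
  shows "T = 0"
proof (rule Z_eq_if)
  fix j z assume z: "z \<in> R j"
  have 3: "x \<in> R (i + 3) \<Longrightarrow> br T x = 0" and 4: "x \<in> R (i + 4) \<Longrightarrow> br T x = 0" for x
    using Z_kills_opposite[OF T kill(1)] Z_kills_opposite[OF T kill(2)] by simp_all
  have jac: "br T (br u v) = 0" if "u \<in> K" "v \<in> K" "br T u = 0" "br T v = 0" for u v
    using jacobi[of T u v] T that by (simp add: Z_K)
  consider "j = i" | "j = i + 1" | "j = i + 2" | "j = i + 3" | "j = i + 4" | "j = i + 5"
    by (cases j i rule: cases_6)
  then have "br T z = 0"
  proof cases
    case 3
    obtain u where u: "u \<in> R (i + 1)" "u \<noteq> 0" by (rule R_nonzero)
    obtain v where v: "v \<in> R (i + 3)" "br u v = z"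
      using br_2_surj[of u "i + 1" z] u z 3 by auto
    show ?thesis using jac[of u v] u v kill \<open>\<And>x. x \<in> R (i + 3) \<Longrightarrow> br T x = 0\<close> by (simp add: R_K)
  next
    case 6
    obtain u where u: "u \<in> R i" "u \<noteq> 0" by (rule R_nonzero)
    obtain v where v: "v \<in> R (i + 4)" "br u v = z"
      using br_4_surj[of u i z] u z 6 by auto
    show ?thesis using jac[of u v] u v kill 4 by (simp add: R_K)
  qed (use z kill 3 4 in auto)
  then show "br T z = br 0 z" using z by (simp add: R_K)
qed (use T in \<open>simp_all add: Z_closed\<close>)

end

section \<open>Inner ideals containing a root space\<close>

context a2_graded_lie_algebra begin

definition inner :: "'l set \<Rightarrow> bool" where
  "inner I \<longleftrightarrow> I \<subseteq> K \<and> subspace I \<and> (\<forall>x \<in> I. \<forall>y \<in> I. \<forall>l \<in> K. br x (br y l) \<in> I)"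

text \<open>\<open>X i\<close> is the sum of the root spaces \<open>i\<close> and \<open>i + 1\<close>.\<close>

definition X :: "6 \<Rightarrow> 'l set" where
  "X i = {x \<in> K. pz x = 0 \<and> (\<forall>j. j \<noteq> i \<longrightarrow> j \<noteq> i + 1 \<longrightarrow> pr j x = 0)}"

lemma inner_K: "inner I \<Longrightarrow> x \<in> I \<Longrightarrow> x \<in> K"
  and inner_br: "inner I \<Longrightarrow> x \<in> I \<Longrightarrow> y \<in> I \<Longrightarrow> l \<in> K \<Longrightarrow> br x (br y l) \<in> I"
  and inner_subspace: "inner I \<Longrightarrow> subspace I"
  by (auto simp: inner_def)

lemma X_D: assumes "x \<in> X i"
  shows "x \<in> K" "pz x = 0" "pr (i + 2) x = 0" "pr (i + 3) x = 0" "pr (i + 4) x = 0" "pr (i + 5) x = 0"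
  using assms by (auto simp: X_def)

lemma X_I: assumes "x \<in> K" "pz x = 0" "pr (i + 2) x = 0" "pr (i + 3) x = 0" "pr (i + 4) x = 0" "pr (i + 5) x = 0"
  shows "x \<in> X i"
  unfolding X_def
proof (intro CollectI conjI allI impI)
  fix j assume "j \<noteq> i" "j \<noteq> i + 1" then show "pr j x = 0"
    by (cases j i rule: cases_6) (use assms in auto)
qed (use assms in auto)

lemma X_decomp: assumes "x \<in> X i" shows "x = pr i x + pr (i + 1) x"
  using decomp_at[of x i] X_D[OF assms] by simp

lemma R_subset_X: "R i \<subseteq> X i" "R (i + 1) \<subseteq> X i"
  by (auto intro!: X_I simp: R_D)

lemma subspace_X: "subspace (X i)"
  by (auto simp: subspace_def X_def pr_linear)

text \<open>By \<open>ad2_surj\<close> the map \<open>[x, [x, _]]\<close> already covers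
  \<open>R i\<close>; this is how the division property enters the theory of inner ideals.\<close>

lemma inner_R_subset:
  assumes I: "inner I" and x: "x \<in> I" "x \<in> R i" "x \<noteq> 0"
  shows "R i \<subseteq> I"
proof
  fix w assume "w \<in> R i"
  then obtain z where "z \<in> R (i + 3)" "br x (br x z) = w" using ad2_surj x by blast
  then show "w \<in> I" using inner_br[OF I x(1) x(1)] R_K by metis
qed

section \<open>Components that can occur beside a full root space\<close>

lemma cart_nonzero [simp]: "cart j \<noteq> (0 :: 'k)"
  by (auto simp: cart_def)

text \<open>No two roots of \<open>A_2\<close> are orthogonal, so all Cartan integers are non-zero
  scalars. Once \<open>H i\<close> lies in \<open>I\<close>, applying \<open>ad (H i)\<close> twice
  puts each root space into \<open>I\<close>, and the zero part follows because it is spanned by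
  brackets of opposite root spaces.\<close>

lemma inner_eq_K:
  assumes I: "inner I" and R: "R i \<subseteq> I" "R (i + 2) \<subseteq> I"
  shows "I = K"
proof -
  \<comment> \<open>\<open>R (j + 3)\<close> is \<open>[q, R (j + 4)]\<close> for a non-zero
    \<open>q\<close> in \<open>R (j + 2)\<close>, so \<open>[p, z]\<close> has the shape
    \<open>[p, [q, l]]\<close>.\<close>
  have gen: "br p z \<in> I" if "R j \<subseteq> I" "R (j + 2) \<subseteq> I" "p \<in> R j" "z \<in> R (j + 3)" for j p z
  proof -
    obtain q where q: "q \<in> R (j + 2)" "q \<noteq> 0" by (rule R_nonzero)
    have "z \<in> R (j + 2 + 1)" using that by simp
    then obtain l where "l \<in> R (j + 2 + 2)" "br q l = z" using br_2_surj[OF q] by blast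
    then show ?thesis using inner_br[OF I, of p q l] that q R_K by auto
  qed
  obtain p where p: "p \<in> R i" "p \<noteq> 0" by (rule R_nonzero)
  then obtain p' where "p' \<in> R (i + 3)" "br p p' = H i" using coroot by blast
  then have HI: "H i \<in> I" using gen[OF R p(1)] by metis
  have all: "R j \<subseteq> I" for j
  proof
    fix l assume l: "l \<in> R j"
    let ?c = "cart (j - i) :: 'k"
    have "br (H i) (br (H i) l) \<in> I" using inner_br[OF I HI HI] l R_K by blast
    moreover have "br (H i) (br (H i) l) = sc (?c * ?c) l"
      using H(1)[of i] l by (simp add: H R_K br_scale_right Z_K)
    ultimately have "sc (inverse (?c * ?c)) (sc (?c * ?c) l) \<in> I"
      using subspace_scale[OF inner_subspace[OF I]] by metis
    moreover have "inverse (?c * ?c) * (?c * ?c) = 1" by (rule left_inverse) simp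
    ultimately show "l \<in> I" by (metis scale_scale scale_one)
  qed
  have Z: "pz x \<in> I" if "x \<in> K" for x
    by (rule zero_space_generated[OF inner_subspace[OF I] _ that]) (rule gen[OF all all pr_R pr_R])
  have "x \<in> I" if "x \<in> K" for x
  proof -
    have "pr j x \<in> I" for j using all[of j] that by auto
    then have "pz x + (\<Sum>j\<in>UNIV. pr j x) \<in> I"
      using Z[OF that] inner_subspace[OF I] by (intro subspace_add subspace_sum) auto
    then show ?thesis using decomp[OF that] by simp
  qed
  then show ?thesis using inner_K[OF I] by blast
qed

text \<open>For \<open>t\<close> in \<open>R i\<close> and \<open>l\<close> in a neighbouring root
  space, \<open>[t, [y, l]]\<close> has, apart from its part in \<open>R i\<close>, only a component
  at the root of \<open>l\<close>, and this one is produced by \<open>pr (i + 3) y\<close>. So both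
  neighbours of \<open>R i\<close> lie in \<open>I\<close>, and their roots form an angle of 120
  degrees, as \<open>inner_eq_K\<close> requires.\<close>

lemma inner_opposite_component:
  assumes I: "inner I" and R: "R i \<subseteq> I" and y: "y \<in> I" "pr (i + 3) y \<noteq> 0"
  shows "I = K"
proof -
  obtain t where t: "t \<in> R i" "t \<noteq> 0" by (rule R_nonzero)
  note tD = R_D[OF t(1)]
  have yK: "y \<in> K" using inner_K[OF I y(1)] .
  have s: "pr (i + 3) y \<in> R (i + 3)" using yK by simp
  have 1: "R (i + 1) \<subseteq> I"
  proof -
    obtain l where l: "l \<in> R (i + 1)" "l \<noteq> 0" by (rule R_nonzero)
    note lD = R_D[OF l(1)]
    define v where "v = br t (br y l)"
    have v: "v \<in> I" unfolding v_def using I y R t lD by (blast intro: inner_br)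
    have vK: "v \<in> K" using inner_K[OF I v] .
    have comps: "pz v = 0" "pr (i + 2) v = 0" "pr (i + 3) v = 0" "pr (i + 4) v = 0" "pr (i + 5) v = 0"
        "pr (i + 1) v = br t (br (pr (i + 3) y) l)"
      unfolding v_def using yK by (simp_all add: pr_br pz_br_at[of _ _ i] tD lD)
    have "br (pr (i + 3) y) l \<noteq> 0" using br_4_inj[OF s y(2), of l] l by auto
    moreover have "br (pr (i + 3) y) l \<in> R (i + 2)" using br_R_4[OF s, of l] l by simp
    ultimately have nz: "pr (i + 1) v \<noteq> 0" using br_2_inj[OF t] comps by auto
    have "v - pr i v \<in> I" using R v vK inner_subspace[OF I] by (intro subspace_diff) auto
    moreover have "v - pr i v = pr (i + 1) v" using decomp_at[OF vK, of i] comps by (simp add: algebra_simps)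
    ultimately have "pr (i + 1) v \<in> I" by simp
    then show ?thesis using inner_R_subset[OF I _ _ nz] vK by simp
  qed
  have 5: "R (i + 5) \<subseteq> I"
  proof -
    obtain l where l: "l \<in> R (i + 5)" "l \<noteq> 0" by (rule R_nonzero)
    note lD = R_D[OF l(1)]
    define v where "v = br t (br y l)"
    have v: "v \<in> I" unfolding v_def using I y R t lD by (blast intro: inner_br)
    have vK: "v \<in> K" using inner_K[OF I v] .
    have comps: "pz v = 0" "pr (i + 2) v = 0" "pr (i + 3) v = 0" "pr (i + 4) v = 0" "pr (i + 1) v = 0"
        "pr (i + 5) v = br t (br (pr (i + 3) y) l)"
      unfolding v_def using yK by (simp_all add: pr_br pz_br_at[of _ _ i] tD lD)
    have "br (pr (i + 3) y) l \<noteq> 0" using br_2_inj[OF s y(2), of l] l by auto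
    moreover have "br (pr (i + 3) y) l \<in> R (i + 4)" using br_R_2[OF s, of l] l by simp
    ultimately have nz: "pr (i + 5) v \<noteq> 0" using br_4_inj[OF t] comps by auto
    have "v - pr i v \<in> I" using R v vK inner_subspace[OF I] by (intro subspace_diff) auto
    moreover have "v - pr i v = pr (i + 5) v" using decomp_at[OF vK, of i] comps by (simp add: algebra_simps)
    ultimately have "pr (i + 5) v \<in> I" by simp
    then show ?thesis using inner_R_subset[OF I _ _ nz] vK by simp
  qed
  show ?thesis using inner_eq_K[OF I 5] 1 by simp
qed

text \<open>\<open>H i\<close> acts on \<open>R (i + 3)\<close> as -2, so \<open>[v, [v, l]]\<close>
  has the component \<open>4 l\<close> there, which \<open>inner_opposite_component\<close> forbids
  in a proper ideal. Contradictions below are reached by producing such a \<open>v\<close>.\<close>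

lemma inner_coroot_component:
  assumes I: "inner I" and R: "R i \<subseteq> I"
    and v: "v \<in> I" "pz v = H i" "pr (i + 2) v = 0" "pr (i + 4) v = 0"
  shows "I = K"
proof (rule ccontr)
  assume *: "I \<noteq> K"
  then have 3: "pr (i + 3) v = 0" using inner_opposite_component[OF I R v(1)] by blast
  obtain l where l: "l \<in> R (i + 3)" "l \<noteq> 0" by (rule R_nonzero)
  note lD = R_D[OF l(1)]
  have vK: "v \<in> K" using inner_K[OF I v(1)] .
  have "pr (i + 3) (br v (br v l)) = sc 4 l"
    using vK v 3 H(2)[OF l(1), of i] Z_K[OF H(1)[of i]] by (simp add: pr_br pz_br_at[of _ _ i] lD br_neg_right br_scale_right)
  moreover have "(4::'k) \<noteq> 0" using two_nonzero by (metis mult_2 mult_eq_0_iff numeral_Bit0)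
  ultimately have "pr (i + 3) (br v (br v l)) \<noteq> 0" using l by simp
  moreover have "br v (br v l) \<in> I" using inner_br[OF I v(1) v(1)] lD by simp
  ultimately show False using inner_opposite_component[OF I R] * by blast
qed

lemma inner_side_components:
  assumes I: "inner I" and R: "R i \<subseteq> I" and y: "y \<in> I" and ne: "I \<noteq> K"
  shows "pr (i + 2) y = 0" "pr (i + 4) y = 0"
proof -
  have yK: "y \<in> K" using inner_K[OF I y(1)] .
  have y3: "pr (i + 3) y = 0" using inner_opposite_component[OF I R y(1)] ne by blast
  obtain t where t: "t \<in> R i" "t \<noteq> 0" by (rule R_nonzero)
  note tD = R_D[OF t(1)]
  obtain u where u: "u \<in> R (i + 3)" "br t u = H i" using coroot[OF t] by blast
  show "pr (i + 2) y = 0"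
  proof (rule ccontr)
    assume nz: "pr (i + 2) y \<noteq> 0"
    \<comment> \<open>\<open>l\<close> is chosen so that the side component of \<open>y\<close>
      turns it into \<open>u\<close>; then \<open>[t, [y, l]]\<close> has zero part
      \<open>[t, u] = H i\<close>.\<close>
    obtain l where l: "l \<in> R (i + 4)" "br (pr (i + 2) y) l = u"
      using br_2_surj[OF _ nz, of "i + 2" u] u yK by auto
    note lD = R_D[OF l(1)]
    define v where "v = br t (br y l)"
    have "v \<in> I" unfolding v_def using I y R t lD by (blast intro: inner_br)
    moreover have "pz v = H i" "pr (i + 2) v = 0" "pr (i + 4) v = 0"
      unfolding v_def using yK y3 by (simp_all add: pr_br pz_br_at[of _ _ i] tD lD l u R_K[OF u(1)])
    ultimately show False using inner_coroot_component[OF I R] ne by blast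
  qed
  show "pr (i + 4) y = 0"
  proof (rule ccontr)
    assume nz: "pr (i + 4) y \<noteq> 0"
    obtain l where l: "l \<in> R (i + 2)" "br (pr (i + 4) y) l = u"
      using br_4_surj[OF _ nz, of "i + 4" u] u yK by auto
    note lD = R_D[OF l(1)]
    define v where "v = br t (br y l)"
    have "v \<in> I" unfolding v_def using I y R t lD by (blast intro: inner_br)
    moreover have "pz v = H i" "pr (i + 2) v = 0" "pr (i + 4) v = 0"
      unfolding v_def using yK y3 by (simp_all add: pr_br pz_br_at[of _ _ i] tD lD l u R_K[OF u(1)])
    ultimately show False using inner_coroot_component[OF I R] ne by blast
  qed
qed

text \<open>If the zero part moved some \<open>u\<close> in \<open>R (i + 3)\<close>, a suitable
  \<open>[t, [y, u]]\<close> would have zero part \<open>H i\<close>. So it kills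
  \<open>R (i + 3)\<close>; if it is non-zero, \<open>Z_zero_if\<close> makes it act non-trivially
  on \<open>R (i + 2)\<close> and on \<open>R (i + 4)\<close>, which forces both neighbours of
  \<open>R i\<close> into \<open>I\<close>.\<close>

lemma inner_zero_component:
  assumes I: "inner I" and R: "R i \<subseteq> I" and y: "y \<in> I" and ne: "I \<noteq> K"
  shows "pz y = 0"
proof (rule ccontr)
  assume nz: "pz y \<noteq> 0"
  have yK: "y \<in> K" using inner_K[OF I y(1)] .
  have y0: "pr (i + 3) y = 0" "pr (i + 2) y = 0" "pr (i + 4) y = 0"
    using inner_opposite_component[OF I R y(1)] inner_side_components[OF I R y] ne by blast+
  have T: "pz y \<in> Z" using yK by simp
  have kill3: "br (pz y) u = 0" if u: "u \<in> R (i + 3)" for u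
  proof (rule ccontr)
    assume nz: "br (pz y) u \<noteq> 0"
    have s: "br (pz y) u \<in> R (i + 3)" using br_Z_R[OF T u] .
    obtain t where t: "t \<in> R i" "br (br (pz y) u) t = H (i + 3)"
      using coroot[OF s nz] by auto
    have tu: "br t (br (pz y) u) = H i"
      using br_anti[of "br (pz y) u" t] t s H_neg by (simp add: R_K)
    note tD = R_D[OF t(1)] note uD = R_D[OF u]
    define v where "v = br t (br y u)"
    have "v \<in> I" unfolding v_def using I y R t uD by (blast intro: inner_br)
    moreover have "pz v = H i" "pr (i + 2) v = 0" "pr (i + 4) v = 0"
      unfolding v_def using yK y0 by (simp_all add: pr_br pz_br_at[of _ _ i] tD uD tu)
    ultimately show False using inner_coroot_component[OF I R] ne by blast
  qed
  have kill0: "br (pz y) u = 0" if "u \<in> R i" for u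
    using Z_kills_opposite[OF T kill3] that by simp
  obtain t where t: "t \<in> R i" "t \<noteq> 0" by (rule R_nonzero)
  note tD = R_D[OF t(1)]
  have 1: "R (i + 1) \<subseteq> I"
  proof -
    have "\<exists>l \<in> R (i + 2). br (pz y) l \<noteq> 0"
      using Z_zero_if[OF T, of "i + 2"] kill3 nz by auto
    then obtain l where l: "l \<in> R (i + 2)" "br (pz y) l \<noteq> 0" by blast
    note lD = R_D[OF l(1)]
    define v where "v = br t (br y l)"
    have v: "v \<in> I" unfolding v_def using I y R t lD by (blast intro: inner_br)
    have vK: "v \<in> K" using inner_K[OF I v] .
    have comps: "pz v = 0" "pr (i + 2) v = 0" "pr (i + 3) v = 0" "pr (i + 4) v = 0" "pr (i + 5) v = 0"
        "pr (i + 1) v = br t (br (pz y) l)"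
      unfolding v_def using yK y0 by (simp_all add: pr_br pz_br_at[of _ _ i] tD lD)
    have nz: "pr (i + 1) v \<noteq> 0" using br_2_inj[OF t br_Z_R[OF T l(1)]] l comps by auto
    have "v - pr i v \<in> I" using R v vK inner_subspace[OF I] by (intro subspace_diff) auto
    moreover have "v - pr i v = pr (i + 1) v" using decomp_at[OF vK, of i] comps by (simp add: algebra_simps)
    ultimately have "pr (i + 1) v \<in> I" by simp
    then show ?thesis using inner_R_subset[OF I _ _ nz] vK by simp
  qed
  have 5: "R (i + 5) \<subseteq> I"
  proof -
    have "\<exists>l \<in> R (i + 4). br (pz y) l \<noteq> 0"
      using Z_zero_if[OF T, of "i + 3"] kill3 nz by auto
    then obtain l where l: "l \<in> R (i + 4)" "br (pz y) l \<noteq> 0" by blast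
    note lD = R_D[OF l(1)]
    define v where "v = br t (br y l)"
    have v: "v \<in> I" unfolding v_def using I y R t lD by (blast intro: inner_br)
    have vK: "v \<in> K" using inner_K[OF I v] .
    have comps: "pz v = 0" "pr (i + 2) v = 0" "pr (i + 3) v = 0" "pr (i + 4) v = 0" "pr (i + 1) v = 0"
        "pr (i + 5) v = br t (br (pz y) l)"
      unfolding v_def using yK y0 by (simp_all add: pr_br pz_br_at[of _ _ i] tD lD)
    have nz: "pr (i + 5) v \<noteq> 0" using br_4_inj[OF t br_Z_R[OF T l(1)]] l comps by auto
    have "v - pr i v \<in> I" using R v vK inner_subspace[OF I] by (intro subspace_diff) auto
    moreover have "v - pr i v = pr (i + 5) v" using decomp_at[OF vK, of i] comps by (simp add: algebra_simps)
    ultimately have "pr (i + 5) v \<in> I" by simp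
    then show ?thesis using inner_R_subset[OF I _ _ nz] vK by simp
  qed
  show False using inner_eq_K[OF I 5] 1 ne by simp
qed

text \<open>Let \<open>t = [q, p]\<close>. The zero part of \<open>[y, [y, u]]\<close> is
  \<open>2 H (i + 1) + [t, u]\<close>, and it vanishes by \<open>inner_zero_component\<close>. Its
  action on \<open>p\<close> is \<open>4 p + Y\<close>, while a second evaluation of
  \<open>Y\<close> through \<open>w = [u, p]\<close> gives \<open>Y = - p\<close>; what remains is
  \<open>3 p = 0\<close>.\<close>

lemma inner_one_side:
  assumes I: "inner I" and R: "R i \<subseteq> I" and y: "y \<in> I" and ne: "I \<noteq> K"
  shows "pr (i + 1) y = 0 \<or> pr (i + 5) y = 0"
proof (rule ccontr)
  assume *: "\<not> ?thesis"
  define p where "p = pr (i + 1) y"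
  define q where "q = pr (i + 5) y"
  have yK: "y \<in> K" using inner_K[OF I y(1)] .
  have p: "p \<in> R (i + 1)" "p \<noteq> 0" and q: "q \<in> R (i + 5)" "q \<noteq> 0" using * yK by (simp_all add: p_def q_def)
  obtain p' where p': "p' \<in> R (i + 4)" "br p p' = H (i + 1)" using coroot[OF p] by auto
  obtain u where u: "u \<in> R (i + 3)" "br q u = p'" using br_4_surj[OF q, of p'] p' by auto
  have K [simp]: "p \<in> K" "q \<in> K" "p' \<in> K" "u \<in> K" "H (i + 1) \<in> K"
    using p q p' u by (simp_all add: R_K Z_K H)
  have y0: "pr (i + 3) y = 0" "pr (i + 2) y = 0" "pr (i + 4) y = 0" "pz y = 0"
    using inner_opposite_component[OF I R y(1)] inner_side_components[OF I R y] inner_zero_component[OF I R y] ne by blast+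
  define t where "t = br q p"
  have t: "t \<in> R i" unfolding t_def using br_R_2[OF q(1), of p] p by simp
  then have tK [simp]: "t \<in> K" by (rule R_K)
  have "pz (br y (br y u)) = br p (br q u) + br q (br p u)"
    using yK by (simp add: pr_br pz_br_at[of _ _ i] R_D[OF u(1)] y0 flip: p_def q_def)
  moreover have "pz (br y (br y u)) = 0"
    using inner_zero_component[OF I R inner_br[OF I y y] ne] by simp
  moreover have "br q (br p u) = br t u + br p (br q u)" unfolding t_def by (intro jacobi) simp_all
  ultimately have S: "sc 2 (H (i + 1)) + br t u = 0"
    using scale_left_distrib[of 1 1 "H (i + 1)"] by (simp add: u p' add.commute add.left_commute)
  define w where "w = br u p"
  have wR: "w \<in> R (i + 2)" unfolding w_def using br_R_4[OF u(1), of p] p by simp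
  then have wK [simp]: "w \<in> K" by (rule R_K)
  define Y where "Y = br (br t u) p"
  have "br t (br u p) = br (br t u) p + br u (br t p)" by (intro jacobi) simp_all
  moreover have "br t p = 0" using br_R_1[OF t p(1)] .
  ultimately have Y1: "Y = br t w" by (simp add: Y_def w_def)
  have pw: "br p w = 0" using br_R_1[OF p(1), of w] wR by simp
  have "br q (br p w) = br t w + br p (br q w)" unfolding t_def by (intro jacobi) simp_all
  then have Y2: "Y = - br p (br q w)" using Y1 pw by (simp add: eq_neg_iff_add_eq_0)
  have "br q (br u p) = br (br q u) p + br u t" unfolding t_def by (intro jacobi) simp_all
  then have qw: "br q w = - H (i + 1) - br t u"
    using br_anti[of p p'] br_anti[of t u] by (simp add: w_def u p')
  have Hp: "br (H (i + 1)) p = sc 2 p" using H(2)[OF p(1), of "i + 1"] by simp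
  have "Y = br p (H (i + 1)) + br p (br t u)"
    unfolding Y2 qw by (simp add: br_diff_right br_neg_right)
  also have "\<dots> = - sc 2 p - Y"
    using br_anti[of "H (i + 1)" p] br_anti[of "br t u" p] by (simp add: Hp Y_def)
  finally have "sc 2 (Y + p) = 0"
    by (simp add: scale_right_distrib scale_left_distrib[of 1 1, simplified] algebra_simps)
  then have "Y = - p" by (simp add: eq_neg_iff_add_eq_0)
  moreover have "br (sc 2 (H (i + 1)) + br t u) p = 0" unfolding S by simp
  ultimately have "sc 2 (sc 2 p) - p = 0" by (simp add: br_linear Hp Y_def)
  moreover have "sc 2 (sc 2 p) - p = sc 3 p"
    using scale_left_diff_distrib[of 4 1 p] by simp
  ultimately show False using p by simp
qed

theorem inner_classification:
  assumes I: "inner I" and R: "R i \<subseteq> I" and ne: "I \<noteq> K"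
  shows "I = R i \<or> I = X i \<or> I = X (i + 5)"
proof -
  note S = inner_subspace[OF I]
  have c: "y \<in> K" "pr (i + 3) y = 0" "pr (i + 2) y = 0" "pr (i + 4) y = 0" "pz y = 0" if "y \<in> I" for y
    using inner_opposite_component[OF I R that] inner_side_components[OF I R that] inner_zero_component[OF I R that] ne inner_K[OF I that]
    by blast+
  have dec: "y = pr i y + pr (i + 1) y + pr (i + 5) y" if "y \<in> I" for y
    using decomp_at[OF c(1)[OF that], of i] c[OF that] by simp
  consider "\<forall>y \<in> I. pr (i + 1) y = 0 \<and> pr (i + 5) y = 0"
    | y where "y \<in> I" "pr (i + 1) y \<noteq> 0" | y where "y \<in> I" "pr (i + 5) y \<noteq> 0" by blast
  then show ?thesis
  proof cases
    case 1
    then have "y \<in> R i" if "y \<in> I" for y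
      using dec[OF that] pr_R[OF c(1)[OF that], of i] that by simp
    then show ?thesis using R by blast
  next
    case 2
    \<comment> \<open>\<open>inner_one_side\<close> is a dichotomy for each single element; applied
      to \<open>y + z\<close> it makes the choice of the side uniform over \<open>I\<close>.\<close>
    have 5: "pr (i + 5) z = 0" if z: "z \<in> I" for z
    proof (rule ccontr)
      assume "pr (i + 5) z \<noteq> 0"
      moreover have "pr (i + 5) y = 0" "pr (i + 1) z = 0"
        using inner_one_side[OF I R _ ne] 2 z calculation by blast+
      ultimately show False
        using inner_one_side[OF I R subspace_add[OF S 2(1) z] ne] 2 by (simp add: pr_linear)
    qed
    have "pr (i + 1) y = y - pr i y" using dec[OF 2(1)] 5[OF 2(1)] by (simp add: algebra_simps)
    then have "pr (i + 1) y \<in> I"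
      using subspace_diff[OF S 2(1), of "pr i y"] R pr_R[OF c(1)[OF 2(1)], of i] by auto
    then have R1: "R (i + 1) \<subseteq> I" using inner_R_subset[OF I _ _ 2(2)] c(1)[OF 2(1)] by simp
    have "I \<subseteq> X i" using c 5 by (auto intro!: X_I)
    moreover have "X i \<subseteq> I"
    proof
      fix x assume x: "x \<in> X i"
      then have "pr i x + pr (i + 1) x \<in> I" using R R1 pr_R X_D(1) by (intro subspace_add[OF S]) blast+
      then show "x \<in> I" using X_decomp[OF x] by simp
    qed
    ultimately show ?thesis by blast
  next
    case 3
    have 1: "pr (i + 1) z = 0" if z: "z \<in> I" for z
    proof (rule ccontr)
      assume "pr (i + 1) z \<noteq> 0"
      moreover have "pr (i + 1) y = 0" "pr (i + 5) z = 0"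
        using inner_one_side[OF I R _ ne] 3 z calculation by blast+
      ultimately show False
        using inner_one_side[OF I R subspace_add[OF S 3(1) z] ne] 3 by (simp add: pr_linear)
    qed
    have "pr (i + 5) y = y - pr i y" using dec[OF 3(1)] 1[OF 3(1)] by (simp add: algebra_simps)
    then have "pr (i + 5) y \<in> I"
      using subspace_diff[OF S 3(1), of "pr i y"] R pr_R[OF c(1)[OF 3(1)], of i] by auto
    then have R1: "R (i + 5) \<subseteq> I" using inner_R_subset[OF I _ _ 3(2)] c(1)[OF 3(1)] by simp
    have "I \<subseteq> X (i + 5)" using c 1 by (auto intro!: X_I)
    moreover have "X (i + 5) \<subseteq> I"
    proof
      fix x assume x: "x \<in> X (i + 5)"
      have "pr (i + 5) x \<in> I" "pr i x \<in> I" using R R1 pr_R X_D(1)[OF x] by blast+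
      then have "pr (i + 5) x + pr i x \<in> I" by (intro subspace_add[OF S])
      then show "x \<in> I" using X_decomp[OF x] by simp
    qed
    ultimately show ?thesis by blast
  qed
qed

lemma R_neq_K: "R i \<noteq> K"
proof
  assume "R i = K"
  obtain x where x: "x \<in> R (i + 1)" "x \<noteq> 0" by (rule R_nonzero)
  then have "x \<in> R i" using \<open>R i = K\<close> R_K by blast
  then show False using R_D(3)[OF x(1), of "i + 1"] R_D(3)[of x i "i + 1"] x by simp
qed

lemma X_neq_K: "X i \<noteq> K"
proof
  assume "X i = K"
  obtain x where x: "x \<in> R (i + 2)" "x \<noteq> 0" by (rule R_nonzero)
  then have "x \<in> X i" using \<open>X i = K\<close> R_K by blast
  then show False using R_D(3)[OF x(1), of "i + 2"] X_D(3)[of x i] x by simp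
qed

lemma inner_R: "inner (R i)"
  unfolding inner_def
proof (intro conjI ballI subspace_R)
  fix x y l assume x: "x \<in> R i" and y: "y \<in> R i" and l: "l \<in> K"
  show "br x (br y l) \<in> R i"
  proof (rule R_I)
    fix j assume "j \<noteq> i" then show "pr j (br x (br y l)) = 0"
      by (cases j i rule: cases_6) (simp_all add: pr_br pz_br_at[of _ _ i] R_D[OF x] R_D[OF y] l)
  qed (simp_all add: pr_br pz_br_at[of _ _ i] R_D[OF x] R_D[OF y] l)
qed (auto simp: R_K)

lemma inner_X: "inner (X i)"
  unfolding inner_def
proof (intro conjI ballI subspace_X)
  fix x y l assume x: "x \<in> X i" and y: "y \<in> X i" and l: "l \<in> K"
  show "br x (br y l) \<in> X i"
    by (rule X_I) (simp_all add: pr_br pz_br_at[of _ _ i] X_D[OF x] X_D[OF y] l)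
qed (auto simp: X_D)

end

section \<open>Exponentials, heights and leading terms\<close>

context a2_graded_lie_algebra begin

section \<open>Root exponentials as automorphisms\<close>

lemma ad_cube: assumes "y \<in> R i" "x \<in> K" shows "br y (br y (br y x)) = 0"
proof (rule zero_if)
  fix j show "pr j (br y (br y (br y x))) = 0"
    by (cases j i rule: cases_6) (simp_all add: pr_br pz_br_at[of _ _ i] R_D[OF assms(1)] assms(2))
qed (simp_all add: pr_br pz_br_at[of _ _ i] R_D[OF assms(1)] assms(2))

text \<open>The exponential series of \<open>ad y\<close> for a root element \<open>y\<close>; it
  stops after the square by \<open>ad_cube\<close>.\<close>

definition exp_root :: "'l \<Rightarrow> 'l \<Rightarrow> 'l" where
  "exp_root y x = x + br y x + sc (1/2) (br y (br y x))"

text \<open>Values outside \<open>K\<close> are left arbitrary, so automorphisms are compared on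
  \<open>K\<close> only.\<close>

definition aut :: "('l \<Rightarrow> 'l) \<Rightarrow> bool" where
  "aut g \<longleftrightarrow> bij_betw g K K \<and> (\<forall>x \<in> K. \<forall>y \<in> K. g (x + y) = g x + g y)
      \<and> (\<forall>c. \<forall>x \<in> K. g (sc c x) = sc c (g x)) \<and> (\<forall>x \<in> K. \<forall>y \<in> K. g (br x y) = br (g x) (g y))"

lemma autD: assumes "aut g"
  shows "bij_betw g K K" "x \<in> K \<Longrightarrow> y \<in> K \<Longrightarrow> g (x + y) = g x + g y" "x \<in> K \<Longrightarrow> g (sc c x) = sc c (g x)"
    "x \<in> K \<Longrightarrow> y \<in> K \<Longrightarrow> g (br x y) = br (g x) (g y)" "x \<in> K \<Longrightarrow> g x \<in> K" "inj_on g K" "g ` K = K"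
  using assms by (auto simp: aut_def bij_betw_def)

lemma aut_0: "aut g \<Longrightarrow> g 0 = 0"
  using autD(3)[of g 0 0] by simp

lemma exp_root_K [simp]: "x \<in> K \<Longrightarrow> y \<in> K \<Longrightarrow> exp_root y x \<in> K"
  by (simp add: exp_root_def)

lemma exp_root_neg: assumes "y \<in> R i" "x \<in> K" shows "exp_root (- y) (exp_root y x) = x"
proof -
  have [simp]: "y \<in> K" using assms R_K by simp
  have half: "sc (1/2) v + sc (1/2) v = v" for v
    by (simp flip: scale_left_distrib)
  show ?thesis using assms(2)
    by (simp add: exp_root_def br_linear ad_cube[OF assms] scale_right_distrib algebra_simps half)
qed

text \<open>The bracket of two exponentials contains the terms \<open>[a2, b1]\<close>,
  \<open>[a1, b2]\<close> and \<open>[a2, b2]\<close>, which have no counterpart in the exponential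
  of \<open>[a, b]\<close>. They cancel because the cube of \<open>ad y\<close> vanishes on
  \<open>[a, b]\<close>: the Leibniz rule turns this into
  \<open>3 ([a2, b1] + [a1, b2]) = 0\<close>, and one more \<open>ad y\<close> gives
  \<open>2 [a2, b2] = 0\<close>.\<close>

lemma aut_exp_root: assumes y: "y \<in> R i" shows "aut (exp_root y)"
  unfolding aut_def
proof (intro conjI ballI allI)
  have [simp]: "y \<in> K" using y R_K by simp
  have "- y \<in> R i" using y by (rule R_closed)
  then have "exp_root y (exp_root (- y) x) = x" if "x \<in> K" for x using exp_root_neg[of "- y" i x] that by simp
  then show "bij_betw (exp_root y) K K"
    by (intro bij_betw_byWitness[where f' = "exp_root (- y)"]) (auto simp: exp_root_neg[OF y])
  show "exp_root y (x + x') = exp_root y x + exp_root y x'" if "x \<in> K" "x' \<in> K" for x x'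
    using that by (simp add: exp_root_def br_linear scale_right_distrib)
  show "exp_root y (sc c x) = sc c (exp_root y x)" if "x \<in> K" for c x
    using that by (simp add: exp_root_def br_linear scale_right_distrib mult.commute)
  fix a b assume [simp]: "a \<in> K" "b \<in> K"
  note cube = ad_cube[OF y]
  have two: "v = 0" if "v + v = 0" for v :: 'l
    using that scale_left_distrib[of 1 1 v] by simp
  have three: "v = 0" if "v + v + v = 0" for v :: 'l
    using that scale_left_distrib[of 2 1 v] scale_left_distrib[of 1 1 v] by simp
  define a1 where "a1 = br y a" define a2 where "a2 = br y a1"
  define b1 where "b1 = br y b" define b2 where "b2 = br y b1"
  have [simp]: "a1 \<in> K" "a2 \<in> K" "b1 \<in> K" "b2 \<in> K" by (simp_all add: a1_def a2_def b1_def b2_def)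
  have [simp]: "br y a2 = 0" "br y b2 = 0" by (simp_all add: a1_def a2_def b1_def b2_def cube)
  have D: "br y (br a b) = br a1 b + br a b1" "br y (br a1 b) = br a2 b + br a1 b1"
    "br y (br a b1) = br a1 b1 + br a b2" "br y (br a2 b) = br a2 b1"
    "br y (br a1 b1) = br a2 b1 + br a1 b2" "br y (br a b2) = br a1 b2"
    "br y (br a2 b1) = br a2 b2" "br y (br a1 b2) = br a2 b2"
    using jacobi[of y a b] jacobi[of y a1 b] jacobi[of y a b1] jacobi[of y a2 b] jacobi[of y a1 b1]
      jacobi[of y a b2] jacobi[of y a2 b1] jacobi[of y a1 b2]
    by (simp_all flip: a1_def a2_def b1_def b2_def)
  have d2: "br y (br y (br a b)) = br a2 b + br a1 b1 + (br a1 b1 + br a b2)"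
    by (simp add: D br_add_right)
  have "br a2 b1 + (br a2 b1 + br a1 b2) + ((br a2 b1 + br a1 b2) + br a1 b2) = br y (br y (br y (br a b)))"
    by (simp add: d2 D br_add_right)
  then have "(br a2 b1 + br a1 b2) + (br a2 b1 + br a1 b2) + (br a2 b1 + br a1 b2) = 0"
    by (simp add: cube algebra_simps)
  then have d3: "br a2 b1 + br a1 b2 = 0" by (rule three)
  then have "br y (br a2 b1 + br a1 b2) = 0" by simp
  then have "br a2 b2 + br a2 b2 = 0" by (simp add: D br_add_right)
  then have d4: "br a2 b2 = 0" by (rule two)
  have d5: "br a1 b2 = - br a2 b1"
    using d3 by (simp add: eq_neg_iff_add_eq_0 add.commute)
  have half: "sc (1/2) v + sc (1/2) v = v" for v
    by (simp flip: scale_left_distrib)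
  have half': "sc (1/2) v + (sc (1/2) v + w) = v + w" for v w
    by (simp add: half flip: add.assoc)
  have E: "exp_root y a = a + a1 + sc (1/2) a2" "exp_root y b = b + b1 + sc (1/2) b2"
    by (simp_all add: exp_root_def a1_def a2_def b1_def b2_def)
  have E3: "exp_root y (br a b) = br a b + br a1 b + br a b1 + sc (1/2) (br a2 b) + br a1 b1 + sc (1/2) (br a b2)"
    unfolding exp_root_def d2 unfolding D(1) by (simp add: scale_right_distrib half' add.assoc)
  show "exp_root y (br a b) = br (exp_root y a) (exp_root y b)"
    unfolding E E3 by (simp add: br_linear d4 d5 algebra_simps)
qed

lemma aut_id: "aut (\<lambda>x. x)"
  by (simp add: aut_def bij_betw_def)

lemma aut_comp: "aut g \<Longrightarrow> aut f \<Longrightarrow> aut (g \<circ> f)"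
  unfolding aut_def
  by (auto intro: bij_betw_trans simp: bij_betw_apply[of f K K])

lemma aut_inv: assumes g: "aut g" shows "aut (inv_into K g)"
  unfolding aut_def
proof (intro conjI ballI allI)
  note [simp] = autD[OF g]
  show "bij_betw (inv_into K g) K K" using autD(1)[OF g] by (rule bij_betw_inv_into)
  have K: "inv_into K g x \<in> K" if "x \<in> K" for x using that autD(7)[OF g] by (metis inv_into_into)
  have e: "g (inv_into K g x) = x" if "x \<in> K" for x using that by (simp add: f_inv_into_f)
  have i: "inv_into K g u = v" if "v \<in> K" "u = g v" for u v using that by simp
  fix x y c assume "x \<in> K" "y \<in> K"
  then show "inv_into K g (x + y) = inv_into K g x + inv_into K g y"
    "inv_into K g (br x y) = br (inv_into K g x) (inv_into K g y)"
    by (auto intro!: i simp: K e)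
next
  note [simp] = autD[OF g]
  have K: "inv_into K g x \<in> K" if "x \<in> K" for x using that autD(7)[OF g] by (metis inv_into_into)
  have e: "g (inv_into K g x) = x" if "x \<in> K" for x using that by (simp add: f_inv_into_f)
  have i: "inv_into K g u = v" if "v \<in> K" "u = g v" for u v using that by simp
  fix x c assume "x \<in> K"
  then show "inv_into K g (sc c x) = sc c (inv_into K g x)" by (auto intro!: i simp: K e)
qed

lemma aut_inv_image: "aut g \<Longrightarrow> I \<subseteq> K \<Longrightarrow> inv_into K g ` (g ` I) = I"
  by (simp add: autD inv_into_image_cancel)

lemma aut_image_inv: "aut g \<Longrightarrow> I \<subseteq> K \<Longrightarrow> g ` (inv_into K g ` I) = I"
  by (simp add: autD image_inv_into_cancel)

lemma aut_inner: assumes g: "aut g" and I: "inner I" shows "inner (g ` I)"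
  unfolding inner_def
proof (intro conjI ballI)
  note IK = inner_K[OF I]
  show "g ` I \<subseteq> K" using IK autD(5)[OF g] by auto
  show "subspace (g ` I)" unfolding subspace_def
  proof (intro conjI ballI allI)
    show "0 \<in> g ` I" using aut_0[OF g] subspace_0[OF inner_subspace[OF I]] by (metis image_eqI)
    fix x assume "x \<in> g ` I"
    then obtain x' where x: "x = g x'" "x' \<in> I" by auto
    show "sc c x \<in> g ` I" for c
      using x autD(3)[OF g IK, of x' c] subspace_scale[OF inner_subspace[OF I], of x' c] by (metis image_eqI)
    fix y assume "y \<in> g ` I"
    then obtain y' where y: "y = g y'" "y' \<in> I" by auto
    show "x + y \<in> g ` I"
      using x y autD(2)[OF g IK IK, of x' y'] subspace_add[OF inner_subspace[OF I], of x' y'] by (metis image_eqI)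
  qed
  fix x y l assume "x \<in> g ` I" "y \<in> g ` I" "l \<in> K"
  then obtain x' y' l' where *: "x = g x'" "x' \<in> I" "y = g y'" "y' \<in> I" "l = g l'" "l' \<in> K"
    using autD(7)[OF g] by blast
  then have "br x (br y l) = g (br x' (br y' l'))" using autD(4)[OF g] IK by simp
  then show "br x (br y l) \<in> g ` I" using * inner_br[OF I] by blast
qed

text \<open>A height function that is injective on the roots and for which \<open>b\<close>, \<open>b + 1\<close> and \<open>b + 5\<close> are
  the negative roots; \<open>P b n\<close> is the projection to height \<open>n\<close>.\<close>

definition P :: "6 \<Rightarrow> int \<Rightarrow> 'l \<Rightarrow> 'l" where
  "P b n x = (if n = 0 then pz x else if n = - 3 then pr b x else if n = - 1 then pr (b + 1) x
     else if n = 2 then pr (b + 2) x else if n = 3 then pr (b + 3) x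
     else if n = 1 then pr (b + 4) x else if n = - 2 then pr (b + 5) x else 0)"

section \<open>The height grading and leading terms\<close>

lemma cases_height: 
  obtains "n = - 3" | "n = - 2" | "n = - 1" | "n = 0" | "n = 1" | "n = 2" | "n = 3" | "(n::int) < - 3 \<or> 3 < n"
  by force

lemma sum_height: "(\<Sum>m\<in>{- 3..3::int}. f m) = f (- 3) + f (- 2) + f (- 1) + f 0 + f 1 + f 2 + f 3"
  for f :: "int \<Rightarrow> 'l"
proof -
  have "{- 3..3::int} = {- 3, - 2, - 1, 0, 1, 2, 3}" by auto
  then show ?thesis by (simp add: add.assoc[where 'a='l])
qed

lemma P_simps [simp]: "P b (- 3) x = pr b x" "P b (- 2) x = pr (b + 5) x" "P b (- 1) x = pr (b + 1) x"
   "P b 0 x = pz x" "P b 1 x = pr (b + 4) x" "P b 2 x = pr (b + 2) x" "P b 3 x = pr (b + 3) x"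
   "n < - 3 \<or> 3 < n \<Longrightarrow> P b n x = 0"
  by (auto simp: P_def)

lemma P_linear: "P b n (x + y) = P b n x + P b n y" "P b n (sc c x) = sc c (P b n x)"
    "P b n (- x) = - P b n x" "P b n (x - y) = P b n x - P b n y"
  by (auto simp: P_def pr_linear)

lemma P_sum: "P b n (sum f S) = (\<Sum>s\<in>S. P b n (f s))"
  by (auto simp: P_def pr_sum pz_sum)

lemma P_K [simp]: "x \<in> K \<Longrightarrow> P b n x \<in> K"
  by (auto simp: P_def)

lemma P_0 [simp]: "P b n 0 = 0"
  by (auto simp: P_def)

lemma P_P [simp]: "P b m (P b n x) = (if m = n then P b n x else 0)"
  by (auto simp: P_def)

lemma P_decomp: assumes "x \<in> K" shows "(\<Sum>n\<in>{- 3..3}. P b n x) = x"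
  by (subst (2) decomp_at[OF assms, of b]) (simp add: sum_height algebra_simps)

lemma br_pr_0: assumes "x \<in> K" "y \<in> K" "j - i = 0 \<or> j - i = 1 \<or> j - i = 5" shows "br (pr i x) (pr j y) = 0"
proof -
  have "j = i \<or> j = i + 1 \<or> j = i + 5" using assms(3) by (metis diff_add_cancel add.commute add_0)
  then show ?thesis
    using br_R_0[of "pr i x" i "pr j y"] br_R_1[of "pr i x" i "pr j y"] br_R_5[of "pr i x" i "pr j y"] assms
    by auto
qed

lemma br_P_0:
  assumes "x \<in> K" "y \<in> K" "m + n < - 3 \<or> 3 < m + n"
  shows "br (P b m x) (P b n y) = 0"
  by (cases n rule: cases_height; cases m rule: cases_height)
     (use assms in \<open>simp_all add: br_pr_0\<close>)

text \<open>The height of \<open>i + 1\<close> is the sum of the heights of \<open>i\<close> and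
  \<open>i + 2\<close> (for instance \<open>-1 = -3 + 2\<close>), so the root grading becomes a
  grading by integers. Summands with \<open>n - m\<close> out of range vanish because
  \<open>P\<close> is zero there.\<close>

lemma P_br:
  assumes "x \<in> K" "y \<in> K"
  shows "P b n (br x y) = (\<Sum>m\<in>{- 3..3}. br (P b m x) (P b (n - m) y))"
proof (cases "n < - 3 \<or> 3 < n")
  case True
  then have "br (P b m x) (P b (n - m) y) = 0" for m using br_P_0[OF assms, of m "n - m" b] by simp
  then show ?thesis using True by simp
next
  case False
  then show ?thesis
    by (cases n rule: cases_height)
       (use assms in \<open>simp_all add: sum_height pr_br pz_br_at[of _ _ b] br_pr_0
         add.assoc[where 'a='l] add.commute[where 'a='l] add.left_commute[where 'a='l]\<close>)
qed

definition filt :: "6 \<Rightarrow> int \<Rightarrow> 'l set" where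
  "filt b n = {x \<in> K. \<forall>m > n. P b m x = 0}"

lemma filt_K: "x \<in> filt b n \<Longrightarrow> x \<in> K" and filt_P: "x \<in> filt b n \<Longrightarrow> n < m \<Longrightarrow> P b m x = 0"
  by (auto simp: filt_def)

lemma subspace_filt: "subspace (filt b n)"
  by (auto simp: subspace_def filt_def P_linear)

lemma filt_mono: "x \<in> filt b n \<Longrightarrow> n \<le> m \<Longrightarrow> x \<in> filt b m"
  by (auto simp: filt_def)

lemma P_filt: "x \<in> K \<Longrightarrow> P b n x \<in> filt b n"
  by (auto simp: filt_def)

lemma filt_br:
  assumes "x \<in> filt b m" "y \<in> filt b n"
  shows "br x y \<in> filt b (m + n)" "P b (m + n) (br x y) = br (P b m x) (P b n y)"
proof -
  have K: "x \<in> K" "y \<in> K" using assms filt_K by auto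
  show "br x y \<in> filt b (m + n)" unfolding filt_def
  proof (intro CollectI conjI allI impI)
    fix l assume l: "m + n < l"
    have "br (P b k x) (P b (l - k) y) = 0" for k
      using filt_P[OF assms(1), of k] filt_P[OF assms(2), of "l - k"] K l by (cases "k \<le> m") auto
    then show "P b l (br x y) = 0" by (simp add: P_br K)
  qed (use K in simp)
  have "br (P b k x) (P b (m + n - k) y) = (if k = m then br (P b m x) (P b n y) else 0)" for k
    using filt_P[OF assms(1), of k] filt_P[OF assms(2), of "m + n - k"] K
    by (cases "k < m"; cases "k = m") auto
  moreover have "P b m x = 0" if "m \<notin> {- 3..3}" using that by (auto simp: not_le)
  ultimately show "P b (m + n) (br x y) = br (P b m x) (P b n y)"
    using K by (auto simp: P_br)
qed

lemma leading_term: assumes "x \<in> K" "x \<noteq> 0" obtains n where "x \<in> filt b n" "P b n x \<noteq> 0" "n \<in> {- 3..3}"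
proof -
  let ?S = "{n \<in> {- 3..3}. P b n x \<noteq> 0}"
  have "?S \<noteq> {}"
  proof
    assume "?S = {}"
    then have "(\<Sum>n\<in>{- 3..3}. P b n x) = 0" by (intro sum.neutral) auto
    then show False using P_decomp[OF assms(1), of b] assms by simp
  qed
  moreover have fin: "finite ?S" by (rule finite_subset[of _ "{- 3..3}"]) auto
  ultimately have M: "Max ?S \<in> ?S" by (rule Max_in[rotated])
  have "P b m x = 0" if "m > Max ?S" for m
  proof (rule ccontr)
    assume nz: "P b m x \<noteq> 0"
    then have "m \<in> ?S" using P_simps(8)[of m b x] by (cases "m < - 3 \<or> 3 < m") auto
    then show False using Max_ge[OF fin] that by fastforce
  qed
  with M obtain n where "n \<in> ?S" "\<forall>m > n. P b m x = 0" by blast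
  then show ?thesis using that[of n] assms by (auto simp: filt_def)
qed

text \<open>The associated graded space of \<open>I\<close>, realised as a homogeneous subspace of
  \<open>K\<close>: every component of \<open>x\<close> has to be a leading term on its own, where
  \<open>y = 0\<close> serves for the vanishing components.\<close>

definition leading :: "6 \<Rightarrow> 'l set \<Rightarrow> 'l set" where
  "leading b I = {x \<in> K. \<forall>n. \<exists>y \<in> I. y \<in> filt b n \<and> P b n y = P b n x}"

lemma leading_I: "x \<in> I \<Longrightarrow> x \<in> filt b n \<Longrightarrow> subspace I \<Longrightarrow> P b n x \<in> leading b I"
  unfolding leading_def
  by (auto simp: filt_K intro: bexI[of _ x] bexI[of _ 0] subspace_0 subspace_0[OF subspace_filt])

lemma leading_P: "x \<in> leading b I \<Longrightarrow> subspace I \<Longrightarrow> P b n x \<in> leading b I"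
  unfolding leading_def
  by (auto intro: bexI[of _ 0] subspace_0 subspace_0[OF subspace_filt])

text \<open>The component of height \<open>n\<close> of \<open>[x, [x', l]]\<close> is a sum of
  brackets of components, and each summand is the top component of \<open>[y i, [y' j, l']]\<close>
  with \<open>y i\<close> and \<open>y' j\<close> in \<open>I\<close> and \<open>l'\<close> a
  component of \<open>l\<close>. The sum \<open>w\<close> of these elements is the witness.\<close>

lemma inner_leading: assumes I: "inner I" shows "inner (leading b I)"
  unfolding inner_def
proof (intro conjI ballI)
  note S = inner_subspace[OF I]
  show "leading b I \<subseteq> K" by (auto simp: leading_def)
  show "subspace (leading b I)" unfolding subspace_def
  proof (intro conjI ballI allI)
    show "0 \<in> leading b I"
      by (auto simp: leading_def intro: bexI[of _ 0] subspace_0[OF S] subspace_0[OF subspace_filt])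
    fix x assume x: "x \<in> leading b I"
    show "sc c x \<in> leading b I" for c
      unfolding leading_def
    proof (intro CollectI conjI allI)
      fix n obtain y where "y \<in> I" "y \<in> filt b n" "P b n y = P b n x" using x unfolding leading_def by blast
      then show "\<exists>y\<in>I. y \<in> filt b n \<and> P b n y = P b n (sc c x)"
        by (intro bexI[of _ "sc c y"]) (auto simp: P_linear subspace_scale[OF subspace_filt] subspace_scale[OF S])
    qed (use x in \<open>auto simp: leading_def\<close>)
    fix x' assume x': "x' \<in> leading b I"
    show "x + x' \<in> leading b I"
      unfolding leading_def
    proof (intro CollectI conjI allI)
      fix n obtain y where "y \<in> I" "y \<in> filt b n" "P b n y = P b n x" using x unfolding leading_def by blast
      moreover obtain y' where "y' \<in> I" "y' \<in> filt b n" "P b n y' = P b n x'" using x' unfolding leading_def by blast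
      ultimately show "\<exists>y\<in>I. y \<in> filt b n \<and> P b n y = P b n (x + x')"
        by (intro bexI[of _ "y + y'"]) (auto simp: P_linear subspace_add[OF subspace_filt] subspace_add[OF S])
    qed (use x x' in \<open>auto simp: leading_def\<close>)
  qed
  fix x x' l assume x: "x \<in> leading b I" and x': "x' \<in> leading b I" and l: "l \<in> K"
  have K: "x \<in> K" "x' \<in> K" using x x' by (auto simp: leading_def)
  show "br x (br x' l) \<in> leading b I"
    unfolding leading_def
  proof (intro CollectI conjI allI)
    fix n
    have "\<forall>m. \<exists>y\<in>I. y \<in> filt b m \<and> P b m y = P b m x" using x unfolding leading_def by blast
    then obtain y where y: "\<And>m. y m \<in> I" "\<And>m. y m \<in> filt b m" "\<And>m. P b m (y m) = P b m x" by metis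
    have "\<forall>m. \<exists>y\<in>I. y \<in> filt b m \<and> P b m y = P b m x'" using x' unfolding leading_def by blast
    then obtain y' where y': "\<And>m. y' m \<in> I" "\<And>m. y' m \<in> filt b m" "\<And>m. P b m (y' m) = P b m x'" by metis
    define t where "t = (\<lambda>i j. br (y i) (br (y' j) (P b (n - i - j) l)))"
    define w where "w = (\<Sum>i\<in>{- 3..3}. \<Sum>j\<in>{- 3..3}. t i j)"
    have tI: "t i j \<in> I" for i j unfolding t_def using y y' l by (intro inner_br[OF I]) auto
    have 1: "br (y' j) (P b (n - i - j) l) \<in> filt b (n - i)"
      "P b (n - i) (br (y' j) (P b (n - i - j) l)) = br (P b j x') (P b (n - i - j) l)" for i j
      using filt_br[OF y'(2) P_filt[OF l], of j "n - i - j"] y'(3) by simp_all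
    have 2: "t i j \<in> filt b n" "P b n (t i j) = br (P b i x) (br (P b j x') (P b (n - i - j) l))" for i j
      using filt_br[OF y(2)[of i] 1(1)[of j i]] 1(2) y(3) unfolding t_def by simp_all
    have "w \<in> I" unfolding w_def using tI by (intro subspace_sum[OF S])
    moreover have "w \<in> filt b n" unfolding w_def using 2 by (intro subspace_sum[OF subspace_filt])
    moreover have "P b n w = P b n (br x (br x' l))"
      using K l by (simp add: w_def P_sum 2 P_br br_sum_right)
    ultimately show "\<exists>y\<in>I. y \<in> filt b n \<and> P b n y = P b n (br x (br x' l))" by blast
  qed (use K l in simp)
qed

text \<open>If every component were a leading term, each element could be corrected by members of
  \<open>I\<close> height by height until nothing remains. The shift by 4 makes the base case the
  zero space, since heights start at -3.\<close>

lemma leading_neq_K: assumes I: "inner I" "I \<noteq> K" shows "leading b I \<noteq> K"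
proof
  assume leading: "leading b I = K"
  have "filt b (int n - 4) \<subseteq> I" for n
  proof (induction n)
    case 0
    have "x = 0" if "x \<in> filt b (- 4)" for x
      using leading_term[OF filt_K[OF that], of b] filt_P[OF that] by force
    then show ?case using subspace_0[OF inner_subspace[OF I(1)]] by auto
  next
    case (Suc n)
    show ?case
    proof
      fix x assume x: "x \<in> filt b (int (Suc n) - 4)"
      then have "x \<in> leading b I" using leading filt_K by simp
      then obtain y where y: "y \<in> I" "y \<in> filt b (int (Suc n) - 4)"
          "P b (int (Suc n) - 4) y = P b (int (Suc n) - 4) x"
        unfolding leading_def by blast
      have "x - y \<in> filt b (int n - 4)" unfolding filt_def
      proof (intro CollectI conjI allI impI)
        fix m assume "int n - 4 < m"
        then show "P b m (x - y) = 0"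
          using filt_P[OF x, of m] filt_P[OF y(2), of m] y(3) by (cases "m = int (Suc n) - 4") (auto simp: P_linear)
      qed (use filt_K x y in auto)
      then have "x - y + y \<in> I" using Suc y by (intro subspace_add[OF inner_subspace[OF I(1)]]) auto
      then show "x \<in> I" by simp
    qed
  qed
  from this[of 7] have "filt b 3 \<subseteq> I" by simp
  moreover have "K \<subseteq> filt b 3" by (auto simp: filt_def)
  ultimately show False using I inner_K[OF I(1)] by auto
qed

text \<open>The maximal unipotent group of the negative roots, as words in root exponentials. The
  root \<open>b\<close> is the lowest one, the sum of the simple negative roots \<open>b + 1\<close>
  and \<open>b + 5\<close>.\<close>

inductive_set U :: "6 \<Rightarrow> ('l \<Rightarrow> 'l) set" for b where
  U_id: "(\<lambda>x. x) \<in> U b"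
| U_exp_root: "g \<in> U b \<Longrightarrow> y \<in> R b \<or> y \<in> R (b + 1) \<or> y \<in> R (b + 5) \<Longrightarrow> exp_root y \<circ> g \<in> U b"

lemma U_comp: "g \<in> U b \<Longrightarrow> f \<in> U b \<Longrightarrow> g \<circ> f \<in> U b"
proof (induction rule: U.induct)
  case (U_exp_root g y)
  then show ?case using U.U_exp_root[of "g \<circ> f" b y] by (simp add: comp_def)
qed (simp add: comp_def)

lemma U_aut: "g \<in> U b \<Longrightarrow> aut g"
  by (induction rule: U.induct) (auto simp del: o_apply comp_apply intro!: aut_id aut_comp intro: aut_exp_root)

text \<open>A negative root element lowers the height, so its exponential changes only what lies
  below the leading term.\<close>

lemma U_filt: "g \<in> U b \<Longrightarrow> x \<in> filt b n \<Longrightarrow> g x \<in> filt b n \<and> P b n (g x) = P b n x"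
proof (induction rule: U.induct)
  case (U_exp_root g y)
  have yK: "y \<in> K" using U_exp_root R_K by blast
  have gx: "g x \<in> filt b n" "P b n (g x) = P b n x" using U_exp_root by auto
  have "P b m y = 0" if "m > - 1" for m
    using that U_exp_root(2) by (cases m rule: cases_height) (auto simp: R_D)
  then have "y \<in> filt b (- 1)" using yK by (auto simp: filt_def)
  then have *: "br y z \<in> filt b (- 1 + m)" if "z \<in> filt b m" for z m using filt_br that by blast
  have 1: "br y (g x) \<in> filt b (n - 1)" using *[OF gx(1)] by simp
  have 2: "br y (br y (g x)) \<in> filt b (n - 1)" using *[OF 1] by (auto intro: filt_mono)
  have "P b n (br y (g x)) = 0" "P b n (br y (br y (g x))) = 0" using filt_P[OF 1] filt_P[OF 2] by auto
  moreover have "br y (g x) \<in> filt b n" "br y (br y (g x)) \<in> filt b n" using 1 2 filt_mono by auto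
  ultimately show ?case using gx unfolding exp_root_def comp_def
    by (auto simp: P_linear intro!: subspace_add[OF subspace_filt] subspace_scale[OF subspace_filt])
qed auto

text \<open>What is known about \<open>leading b I\<close> thereby restricts all conjugates of
  \<open>I\<close> under \<open>U b\<close>, before a particular one is chosen.\<close>

lemma U_leading: assumes "g \<in> U b" "I \<subseteq> K" "subspace I" "y \<in> g ` I" "y \<noteq> 0"
  obtains n where "y \<in> filt b n" "P b n y \<noteq> 0" "P b n y \<in> leading b I"
proof -
  obtain x where x: "x \<in> I" "y = g x" using assms by blast
  have "x \<noteq> 0" using x assms(5) aut_0[OF U_aut[OF assms(1)]] by auto
  then obtain n where n: "x \<in> filt b n" "P b n x \<noteq> 0" using leading_term[of x b] x assms(2) by blast
  then show ?thesis using that[of n] U_filt[OF assms(1) n(1)] leading_I[OF x(1) n(1) assms(3)] x by auto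
qed


section \<open>Reduction to an ideal that contains a root space\<close>

lemma pr_P: "pr r y = 0 \<Longrightarrow> pr r (P b n y) = 0"
  by (auto simp: P_def)

definition ht :: "6 \<Rightarrow> int" where
  "ht k = (if k = 0 then - 3 else if k = 1 then - 1 else if k = 2 then 2 else if k = 3 then 3
     else if k = 4 then 1 else - 2)"

lemma P_ht: "P b (ht (r - b)) x = pr r x"
  by (cases r b rule: cases_6) (simp_all add: ht_def)

text \<open>If \<open>x\<close> has its top height at the root \<open>r\<close>, a component at
  \<open>r + 1\<close> is lower, so the difference of these roots, which is the root
  \<open>r + 2\<close>, is negative. In the same way \<open>r + 4\<close> and \<open>r + 3\<close>
  are the roots that lead from \<open>r\<close> to \<open>r + 5\<close> and to zero.\<close>

lemma filt_ht_lower: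
  assumes "x \<in> filt b (ht (r - b))"
  shows "pr (r + 1) x \<noteq> 0 \<Longrightarrow> r + 2 = b \<or> r + 2 = b + 1 \<or> r + 2 = b + 5"
    and "pr (r + 5) x \<noteq> 0 \<Longrightarrow> r + 4 = b \<or> r + 4 = b + 1 \<or> r + 4 = b + 5"
    and "pz x \<noteq> 0 \<Longrightarrow> r + 3 = b \<or> r + 3 = b + 1 \<or> r + 3 = b + 5"
  using filt_P[OF assms, of "- 3"] filt_P[OF assms, of "- 2"] filt_P[OF assms, of "- 1"] filt_P[OF assms, of 0]
    filt_P[OF assms, of 1] filt_P[OF assms, of 2] filt_P[OF assms, of 3]
  by (cases r b rule: cases_6; simp add: ht_def)+

text \<open>If the inner ideal of leading terms were contained in the zero part, it would contain \<open>T\<close> with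
  \<open>T\<^sup>2 = 0\<close> on all root spaces. For \<open>w = [T, y] \<noteq> 0\<close> and \<open>[T, z] = 0\<close> the exponential of \<open>y\<close> maps \<open>T\<close> to
  \<open>T - w\<close>, and \<open>[T - w, [T - w, z]] = [w, [w, z]]\<close> is a non-zero root element.\<close>

lemma leading_root:
  assumes I: "inner I" "I \<noteq> {0}" "I \<noteq> K"
  obtains r where "R r \<subseteq> leading b I"
proof -
  define J where "J = leading b I"
  have J: "inner J" unfolding J_def by (rule inner_leading[OF I(1)])
  have S: "subspace I" "subspace J" using I(1) J inner_subspace by auto
  obtain x where x: "x \<in> I" "x \<noteq> 0" using I(2) subspace_0[OF S(1)] by blast
  obtain n where n: "x \<in> filt b n" "P b n x \<noteq> 0" using leading_term[of x b] x inner_K[OF I(1)] by blast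
  then have nzJ: "P b n x \<in> J" unfolding J_def using x S leading_I by blast
  have "\<exists>r. \<exists>z \<in> J. pr r z \<noteq> 0"
  proof (rule ccontr)
    assume "\<not> ?thesis"
    then have JZ: "z \<in> Z" if "z \<in> J" for z using that inner_K[OF J] by (intro Z_I) auto
    define T where "T = P b n x"
    have T: "T \<in> J" "T \<in> Z" "T \<noteq> 0" using nzJ JZ n by (auto simp: T_def)
    then have TK [simp]: "T \<in> K" using Z_K by blast
    have TT: "br T (br T z) = 0" if "z \<in> R r" for z r
    proof -
      have "br T (br T z) \<in> J" using inner_br[OF J T(1) T(1)] that R_K by blast
      then have "br T (br T z) \<in> Z" using JZ by blast
      moreover have "br T (br T z) \<in> R r" using that T(2) by (intro br_Z_R)
      ultimately show ?thesis using R_D(2)[of "br T (br T z)" r] Z_D(2)[of "br T (br T z)"] by simp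
    qed
    obtain r y where y: "y \<in> R r" "br T y \<noteq> 0"
      using Z_eq_if[of T 0] T by (auto simp: Z_closed R_K)
    define w where "w = br T y"
    have w: "w \<in> R r" "w \<noteq> 0" "br T w = 0" unfolding w_def using y TT br_Z_R[OF T(2)] by auto
    \<comment> \<open>\<open>T\<close> squares to zero on root spaces, so \<open>[T, z]\<close> can
      replace a \<open>z\<close> that is not killed.\<close>
    obtain z where z: "z \<in> R (r + 3)" "z \<noteq> 0" "br T z = 0"
    proof -
      obtain z where z: "z \<in> R (r + 3)" "z \<noteq> 0" by (rule R_nonzero)
      show thesis
      proof (cases "br T z = 0")
        case False
        then show ?thesis using that[of "br T z"] z TT br_Z_R[OF T(2)] by auto
      qed (use that z in blast)
    qed
    have K [simp]: "y \<in> K" "w \<in> K" "z \<in> K" using y w z R_K by auto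
    have "br y T = - w" using br_anti[of T y] by (simp add: w_def)
    then have E: "exp_root y T = T - w" using br_R_0[OF y(1) w(1)] by (simp add: exp_root_def br_neg_right)
    have g: "aut (exp_root y)" using aut_exp_root[OF y(1)] .
    have in1: "T - w \<in> exp_root y ` J" using T(1) E by (metis image_eqI)
    have "br T (br w z) = br (br T w) z + br w (br T z)" by (intro jacobi) simp_all
    then have "br (T - w) (br (T - w) z) = br w (br w z)"
      by (simp add: br_linear w(3) z(3))
    moreover have "br (T - w) (br (T - w) z) \<in> exp_root y ` J"
      using inner_br[OF aut_inner[OF g J] in1 in1] by simp
    \<comment> \<open>The exponential maps \<open>j\<close> to \<open>j + [y, j]\<close>, whose zero
      part is \<open>j\<close>. As \<open>[w, [w, z]]\<close> lies in \<open>R r\<close>, its zero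
      part is zero, so \<open>j\<close> vanishes and with it the product.\<close>
    ultimately obtain j where j: "j \<in> J" "br w (br w z) = exp_root y j" by auto
    have "j \<in> Z" using JZ j by simp
    then have yj: "br y j \<in> R r" "j \<in> K" using br_R_Z[OF y(1)] Z_K by auto
    then have "br y (br y j) = 0" using br_R_0[OF y(1)] by simp
    then have "pz (exp_root y j) = j" using yj R_D(2)[of "br y j" r] Z_D(2)[OF \<open>j \<in> Z\<close>] by (simp add: exp_root_def pr_linear)
    moreover have wz: "br w (br w z) \<in> R r" using br_R_3[OF w(1) z(1)] by (intro br_R_Z w)
    ultimately have "j = 0" using j R_D(2)[OF wz] by simp
    then have "br w (br w z) = 0" using j by (simp add: exp_root_def)
    then show False using ad2_inj[OF w(1,2) z(1)] z by simp
  qed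
  then obtain r z where z: "z \<in> J" "pr r z \<noteq> 0" by blast
  have "pr r z \<in> J" using leading_P[of z b I "ht (r - b)"] z S by (simp add: J_def P_ht)
  then have "R r \<subseteq> J" using inner_R_subset[OF J] z inner_K[OF J] by simp
  then show thesis using that by (simp add: J_def)
qed

text \<open>\<open>y\<close> is chosen with \<open>[pr r x, y]\<close> equal to the unwanted
  component, so that \<open>exp_root y\<close> subtracts it; by \<open>filt_ht_lower\<close> the
  root of \<open>y\<close> is negative.\<close>

lemma normalise_component:
  assumes x: "x \<in> filt b (ht (r - b))" "pr r x \<noteq> 0"
  shows "\<exists>e \<in> U b. pr r (e x) = pr r x \<and> pr (r + 1) (e x) = 0 \<and> pr (r + 5) (e x) = pr (r + 5) x"
    and "\<exists>e \<in> U b. pr r (e x) = pr r x \<and> pr (r + 1) (e x) = pr (r + 1) x \<and> pr (r + 5) (e x) = 0"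
proof -
  have K [simp]: "x \<in> K" using x filt_K by blast
  show "\<exists>e \<in> U b. pr r (e x) = pr r x \<and> pr (r + 1) (e x) = 0 \<and> pr (r + 5) (e x) = pr (r + 5) x"
  proof (cases "pr (r + 1) x = 0")
    case True
    then show ?thesis using U_id by force
  next
    case False
    obtain y where y: "y \<in> R (r + 2)" "br (pr r x) y = pr (r + 1) x"
      using br_2_surj[of "pr r x" r "pr (r + 1) x"] x by auto
    have yK: "y \<in> K" using y R_K by blast
    have "br y (pr r x) = - pr (r + 1) x" using br_anti[of "pr r x" y] yK y by simp
    then have "pr r (exp_root y x) = pr r x \<and> pr (r + 1) (exp_root y x) = 0 \<and> pr (r + 5) (exp_root y x) = pr (r + 5) x"
      using yK by (simp add: exp_root_def pr_linear pr_br pz_br_at[of _ _ r] R_D[OF y(1)])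
    moreover have "y \<in> R b \<or> y \<in> R (b + 1) \<or> y \<in> R (b + 5)"
      using filt_ht_lower(1)[OF x(1) False] y(1) by metis
    then have "exp_root y \<circ> (\<lambda>x. x) \<in> U b" by (rule U_exp_root[OF U_id])
    ultimately show ?thesis by (intro bexI[of _ "exp_root y \<circ> (\<lambda>x. x)"]) simp_all
  qed
  show "\<exists>e \<in> U b. pr r (e x) = pr r x \<and> pr (r + 1) (e x) = pr (r + 1) x \<and> pr (r + 5) (e x) = 0"
  proof (cases "pr (r + 5) x = 0")
    case True
    then show ?thesis using U_id by force
  next
    case False
    obtain y where y: "y \<in> R (r + 4)" "br (pr r x) y = pr (r + 5) x"
      using br_4_surj[of "pr r x" r "pr (r + 5) x"] x by auto
    have yK: "y \<in> K" using y R_K by blast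
    have "br y (pr r x) = - pr (r + 5) x" using br_anti[of "pr r x" y] yK y by simp
    then have "pr r (exp_root y x) = pr r x \<and> pr (r + 1) (exp_root y x) = pr (r + 1) x \<and> pr (r + 5) (exp_root y x) = 0"
      using yK by (simp add: exp_root_def pr_linear pr_br pz_br_at[of _ _ r] R_D[OF y(1)])
    moreover have "y \<in> R b \<or> y \<in> R (b + 1) \<or> y \<in> R (b + 5)"
      using filt_ht_lower(2)[OF x(1) False] y(1) by metis
    then have "exp_root y \<circ> (\<lambda>x. x) \<in> U b" by (rule U_exp_root[OF U_id])
    ultimately show ?thesis by (intro bexI[of _ "exp_root y \<circ> (\<lambda>x. x)"]) simp_all
  qed
qed

text \<open>The element \<open>[x, [x, t']] + 2 x\<close> has no components at \<open>r\<close> and its two neighbours, so it vanishes.\<close>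

lemma rank_one_components:
  assumes I: "inner I" and x: "x \<in> I" "pr (r + 1) x = 0" "pr (r + 5) x = 0"
    and t': "t' \<in> R (r + 3)" "br (pr r x) t' = H r"
    and star: "\<forall>y \<in> I. pr r y = 0 \<and> pr (r + 1) y = 0 \<and> pr (r + 5) y = 0 \<longrightarrow> y = 0"
  shows "pr (r + 2) x = 0" "pr (r + 4) x = 0"
    "sc 2 (pz x) + br (pr r x) (br (pz x) t') = 0"
    "sc 4 (pr (r + 3) x) + br (pz x) (br (pz x) t') = 0"
proof -
  have K [simp]: "x \<in> K" "t' \<in> K" "H r \<in> K" using x inner_K[OF I] t' R_K H Z_K by auto
  \<comment> \<open>\<open>[pr r x, [pr r x, t']] = - 2 pr r x\<close>, since \<open>H r\<close>
    acts on \<open>R r\<close> as 2; adding \<open>2 x\<close> cancels the component at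
    \<open>r\<close>.\<close>
  define y where "y = br x (br x t') + sc 2 x"
  have yI: "y \<in> I" unfolding y_def using inner_br[OF I x(1) x(1), of t'] inner_subspace[OF I] x(1)
    by (intro subspace_add subspace_scale) simp_all
  have RH: "br v (H r) = - sc (cart (j - r)) v" if "v \<in> R j" for v j
    using br_anti[of "H r" v] H(2)[OF that] that by (simp add: R_K)
  have h: "br (pr r x) (H r) = - sc 2 (pr r x)" "br (pr (r + 2) x) (H r) = pr (r + 2) x"
    "br (pr (r + 4) x) (H r) = pr (r + 4) x" "br (pr (r + 3) x) (H r) = sc 2 (pr (r + 3) x)"
    using RH[of "pr r x" r] RH[of "pr (r + 2) x" "r + 2"] RH[of "pr (r + 3) x" "r + 3"] RH[of "pr (r + 4) x" "r + 4"]
    by simp_all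
  have HZ: "br (pz x) (H r) = 0" using br_anti[of "H r" "pz x"] H_Z[of "pz x" r] by simp
  note t'D = R_D[OF t'(1)]
  have T: "br (pz x) t' \<in> R (r + 3)" using t' by (intro br_Z_R) simp_all
  have comp: "pr r y = 0" "pr (r + 1) y = 0" "pr (r + 5) y = 0"
    "pr (r + 2) y = pr (r + 2) x + sc 2 (pr (r + 2) x)" "pr (r + 4) y = pr (r + 4) x + sc 2 (pr (r + 4) x)"
    "pz y = br (pr r x) (br (pz x) t') + sc 2 (pz x)"
    "pr (r + 3) y = br (pz x) (br (pz x) t') + sc 2 (pr (r + 3) x) + sc 2 (pr (r + 3) x)"
    by (simp_all add: y_def pr_linear pr_br pz_br_at[of _ _ r] t'D x(2,3) h t'(2) HZ)
  have "y = 0" using star yI comp(1-3) by blast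
  then have 0: "pr j y = 0" "pz y = 0" for j by simp_all
  have s3: "v + sc 2 v = sc 3 v" for v using scale_left_distrib[of 1 2 v] by simp
  show "pr (r + 2) x = 0" "pr (r + 4) x = 0"
    using 0(1)[of "r + 2"] 0(1)[of "r + 4"] comp by (simp_all add: s3)
  show "sc 2 (pz x) + br (pr r x) (br (pz x) t') = 0" using 0(2) comp by (simp add: add.commute)
  have "sc 4 v = sc 2 v + sc 2 v" for v using scale_left_distrib[of 2 2 v] by simp
  then show "sc 4 (pr (r + 3) x) + br (pz x) (br (pz x) t') = 0"
    using 0(1)[of "r + 3"] comp(7) by (simp add: algebra_simps)
qed

lemma four_nonzero [simp]: "(4 :: 'k) \<noteq> 0"
  using two_nonzero by (metis mult_2 mult_eq_0_iff numeral_Bit0)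

text \<open>With vanishing zero part the relations of \<open>rank_one_components\<close> remove all
  components except \<open>pr r x\<close>, so \<open>x\<close> itself is a root element.\<close>

lemma rank_one_homogeneous:
  assumes I: "inner I" and x: "x \<in> I" "pr (r + 1) x = 0" "pr (r + 5) x = 0" "pr r x \<noteq> 0" "pz x = 0"
    and star: "\<forall>y \<in> I. pr r y = 0 \<and> pr (r + 1) y = 0 \<and> pr (r + 5) y = 0 \<longrightarrow> y = 0"
  shows "R r \<subseteq> I"
proof -
  have K: "x \<in> K" using x inner_K[OF I] by simp
  obtain t' where t': "t' \<in> R (r + 3)" "br (pr r x) t' = H r" using coroot[of "pr r x" r] K x by auto
  have "pr (r + 2) x = 0" "pr (r + 4) x = 0" "sc 4 (pr (r + 3) x) = 0"
    using rank_one_components[OF I x(1-3) t' star] x(5) R_K[OF t'(1)] by simp_all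
  then have "x = pr r x" using decomp_at[OF K, of r] x by simp
  then show ?thesis using inner_R_subset[OF I x(1)] K x by (metis pr_R)
qed

text \<open>The leading ideal contains a root space, hence is one of three known ideals supported on
  \<open>r\<close>, \<open>r + 1\<close> and \<open>r + 5\<close>. So in any conjugate of
  \<open>I\<close> an element without components at these roots is zero (\<open>star\<close>).
  Starting from a member of \<open>I\<close> with leading term in \<open>R r\<close>, negative
  exponentials clear the components at \<open>r + 1\<close>, at \<open>r + 5\<close> and in the zero
  part, and the remaining ones then vanish.\<close>

theorem inner_normal_form:
  assumes I: "inner I" "I \<noteq> {0}" "I \<noteq> K"
  shows "\<exists>e \<in> U b. \<exists>r. R r \<subseteq> e ` I"
proof -
  define J where "J = leading b I"
  obtain r where r: "R r \<subseteq> J" using leading_root[OF I] unfolding J_def by blast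
  have J: "inner J" unfolding J_def by (rule inner_leading[OF I(1)])
  have "J = R r \<or> J = X r \<or> J = X (r + 5)"
    using inner_classification[OF J r] leading_neq_K[OF I(1,3)] by (simp add: J_def)
  then have Jc: "z = 0" if "z \<in> J" "pr r z = 0" "pr (r + 1) z = 0" "pr (r + 5) z = 0" for z
    using that decomp_at[of z r] X_D[of z r] X_D[of z "r + 5"] R_D[of z r] by (elim disjE) auto
  have star0: "y = 0" if e: "e \<in> U b" "y \<in> e ` I" "pr r y = 0" "pr (r + 1) y = 0" "pr (r + 5) y = 0" for e y
  proof (rule ccontr)
    assume "y \<noteq> 0"
    then obtain n where "P b n y \<noteq> 0" "P b n y \<in> J"
      using U_leading[OF e(1) _ inner_subspace[OF I(1)] e(2)] inner_K[OF I(1)] unfolding J_def by blast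
    then show False using Jc[of "P b n y"] pr_P e by simp
  qed
  then have star: "\<forall>y \<in> e ` I. pr r y = 0 \<and> pr (r + 1) y = 0 \<and> pr (r + 5) y = 0 \<longrightarrow> y = 0" if "e \<in> U b" for e
    using that by blast
  obtain t where t: "t \<in> R r" "t \<noteq> 0" by (rule R_nonzero)
  then have "t \<in> leading b I" using r by (auto simp: J_def)
  then obtain x where x: "x \<in> I" "x \<in> filt b (ht (r - b))" "P b (ht (r - b)) x = P b (ht (r - b)) t"
    unfolding leading_def by blast
  then have xt: "pr r x = t" using R_D(3)[OF t(1)] by (simp add: P_ht)
  obtain e1 where e1: "e1 \<in> U b" "pr r (e1 x) = t" "pr (r + 1) (e1 x) = 0"
    using normalise_component(1)[OF x(2)] xt t by auto
  have x1: "e1 x \<in> filt b (ht (r - b))" using U_filt[OF e1(1) x(2)] by simp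
  obtain e2 where e2: "e2 \<in> U b" "pr r (e2 (e1 x)) = t" "pr (r + 1) (e2 (e1 x)) = 0" "pr (r + 5) (e2 (e1 x)) = 0"
    using normalise_component(2)[OF x1] e1 t by auto
  define e where "e = e2 \<circ> e1"
  define z where "z = e x"
  have e: "e \<in> U b" unfolding e_def using U_comp e1 e2 by blast
  have z: "pr r z = t" "pr (r + 1) z = 0" "pr (r + 5) z = 0" "z \<in> e ` I" using e2 x by (auto simp: z_def e_def)
  have zF: "z \<in> filt b (ht (r - b))" using U_filt[OF e x(2)] by (simp add: z_def)
  then have zK [simp]: "z \<in> K" by (rule filt_K)
  have eI: "inner (e' ` I)" if "e' \<in> U b" for e' using aut_inner[OF U_aut[OF that] I(1)] .
  show ?thesis
  proof (cases "pz z = 0")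
    case True
    then have "R r \<subseteq> e ` I" using rank_one_homogeneous[OF eI[OF e] z(4,2,3) _ True star[OF e]] z(1) t(2) by simp
    then show ?thesis using e by blast
  next
    case False
    obtain t' where t': "t' \<in> R (r + 3)" "br t t' = H r" using coroot[OF t] by blast
    \<comment> \<open>The factor is dictated by \<open>2 pz z + [t, [pz z, t']] = 0\<close>: it
      gives \<open>[t, u] = pz z\<close>, so the exponential of \<open>u\<close> removes the zero
      part.\<close>
    define u where "u = sc (- 1/2) (br (pz z) t')"
    have Tt': "br (pz z) t' \<in> R (r + 3)" using t' by (intro br_Z_R) simp_all
    then have u: "u \<in> R (r + 3)" unfolding u_def by (rule R_closed)
    have K [simp]: "t \<in> K" "t' \<in> K" "u \<in> K" using t t' u R_K by auto
    have "sc 2 (pz z) + br t (br (pz z) t') = 0"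
      using rank_one_components(3)[OF eI[OF e] z(4,2,3) t'(1) _ star[OF e]] z(1) t'(2) by simp
    then have "br t (br (pz z) t') = - sc 2 (pz z)" by (simp add: eq_neg_iff_add_eq_0 add.commute)
    then have "br t u = pz z" by (simp add: u_def br_linear)
    then have ut: "br u t = - pz z" using br_anti[of t u] by simp
    define e' where "e' = exp_root u \<circ> e"
    have "u \<in> R b \<or> u \<in> R (b + 1) \<or> u \<in> R (b + 5)"
      using filt_ht_lower(3)[OF zF False] u by metis
    then have e': "e' \<in> U b" unfolding e'_def by (rule U_exp_root[OF e])
    have "pr r (exp_root u z) = t" "pr (r + 1) (exp_root u z) = 0" "pr (r + 5) (exp_root u z) = 0" "pz (exp_root u z) = 0"
      by (simp_all add: exp_root_def pr_linear pr_br pz_br_at[of _ _ r] R_D[OF u(1)] z(1-3) ut)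
    moreover have "exp_root u z \<in> e' ` I" using x by (auto simp: e'_def z_def)
    ultimately have "R r \<subseteq> e' ` I" using rank_one_homogeneous[OF eI[OF e'] _ _ _ _ _ star[OF e']] t(2) by blast
    then show ?thesis using e' by blast
  qed
qed

lemma U_fixes_R: "g \<in> U b \<Longrightarrow> x \<in> R b \<Longrightarrow> g x = x"
proof (induction rule: U.induct)
  case (U_exp_root g y)
  then have "br y x = 0"
    using br_R_0[of y b x] br_R_5[of y "b + 1" x] br_R_1[of y "b + 5" x] by auto
  moreover have "y \<in> K" using U_exp_root R_K by blast
  ultimately show ?case using U_exp_root by (simp add: exp_root_def)
qed simp

text \<open>Root elements of the conjugate are their own leading terms, so the leading ideal
  contains the root spaces \<open>r\<close> and \<open>r + 1\<close>. This makes \<open>r\<close> an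
  invariant of \<open>I\<close> that does not depend on \<open>e\<close>.\<close>

lemma leading_X: 
  assumes e: "e \<in> U b" and I: "inner I" "I \<noteq> K" and X: "e ` I = X r" 
  shows "leading b I = X r"
proof -
  have sub: "R s \<subseteq> leading b I" if "R s \<subseteq> X r" for s
  proof
    fix z assume z: "z \<in> R s"
    show "z \<in> leading b I"
    proof (cases "z = 0")
      case True
      then show ?thesis using subspace_0[OF inner_subspace[OF inner_leading[OF I(1)]]] by simp
    next
      case False
      have "z \<in> e ` I" using z that X by blast
      then obtain n where n: "P b n z \<noteq> 0" "P b n z \<in> leading b I"
        using U_leading[OF e _ inner_subspace[OF I(1)] _ False] inner_K[OF I(1)] by blast
      then have "P b n z = z" using z by (auto simp: P_def R_D[OF z] split: if_splits)
      then show ?thesis using n by simp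
    qed
  qed
  have 1: "R r \<subseteq> leading b I" "R (r + 1) \<subseteq> leading b I" using sub R_subset_X by auto
  obtain y where y: "y \<in> R (r + 1)" "y \<noteq> 0" by (rule R_nonzero)
  then have "y \<in> leading b I" using 1 by blast
  then have "leading b I \<noteq> R r \<and> leading b I \<noteq> X (r + 5)"
    using R_D(3)[OF y(1), of "r + 1"] R_D(3)[of y r "r + 1"] X_D(3)[of y "r + 5"] y by auto
  then show ?thesis
    using inner_classification[OF inner_leading[OF I(1)] 1(1) leading_neq_K[OF I]] by blast
qed

lemma X_inj: assumes "X r = X s" shows "r = s"
proof (rule ccontr)
  assume "r \<noteq> s"
  obtain x y where x: "x \<in> R r" "x \<noteq> 0" and y: "y \<in> R (r + 1)" "y \<noteq> 0" using R_nonzero by metis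
  then have xs: "x \<in> X s" and ys: "y \<in> X s" using R_subset_X[of r] assms by auto
  have "r = s \<or> r = s + 1" using xs x R_D(3)[OF x(1), of r] by (auto simp: X_def)
  moreover have "r + 1 = s \<or> r + 1 = s + 1" using ys y R_D(3)[OF y(1), of "r + 1"] by (auto simp: X_def)
  ultimately show False using \<open>r \<noteq> s\<close> by auto
qed

end

section \<open>The graph of non-minimal inner ideals\<close>

context a2_graded_lie_algebra begin

section \<open>Minimal and non-minimal ideals under automorphisms\<close>

definition nontrivial :: "'l set \<Rightarrow> bool" where "nontrivial I \<longleftrightarrow> inner I \<and> I \<noteq> {0}"

definition minimal :: "'l set \<Rightarrow> bool" where
  "minimal I \<longleftrightarrow> nontrivial I \<and> (\<forall>J. nontrivial J \<and> J \<subseteq> I \<longrightarrow> J = I)"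

definition minimals :: "'l set set" where "minimals = {I. nontrivial I \<and> I \<noteq> K \<and> minimal I}"
definition nonminimals :: "'l set set" where "nonminimals = {I. nontrivial I \<and> I \<noteq> K \<and> \<not> minimal I}"

lemma nonminimals_D: "I \<in> nonminimals \<Longrightarrow> inner I" "I \<in> nonminimals \<Longrightarrow> I \<noteq> {0}" "I \<in> nonminimals \<Longrightarrow> I \<noteq> K" "I \<in> nonminimals \<Longrightarrow> I \<subseteq> K"
  and minimals_D: "I \<in> minimals \<Longrightarrow> inner I" "I \<in> minimals \<Longrightarrow> I \<noteq> {0}" "I \<in> minimals \<Longrightarrow> I \<noteq> K" "I \<in> minimals \<Longrightarrow> I \<subseteq> K"
  by (auto simp: nonminimals_def minimals_def nontrivial_def inner_def)

lemma aut_image_eq_iff: "aut g \<Longrightarrow> I \<subseteq> K \<Longrightarrow> J \<subseteq> K \<Longrightarrow> g ` I = g ` J \<longleftrightarrow> I = J"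
  using inj_on_image_eq_iff[OF autD(6)] by blast

lemma aut_image_K: "aut g \<Longrightarrow> I \<subseteq> K \<Longrightarrow> g ` I = K \<longleftrightarrow> I = K"
  using aut_image_eq_iff[of g I K] autD(7) by auto

lemma aut_nontrivial: "aut g \<Longrightarrow> nontrivial I \<Longrightarrow> nontrivial (g ` I)"
  unfolding nontrivial_def
  using aut_inner aut_image_eq_iff[of g I "{0}"] aut_0[of g] by (auto simp: inner_def)

lemma aut_minimal: assumes g: "aut g" and I: "minimal I" shows "minimal (g ` I)"
  unfolding minimal_def
proof (intro conjI allI impI)
  have IK: "I \<subseteq> K" using I by (auto simp: minimal_def nontrivial_def inner_def)
  show "nontrivial (g ` I)" using I aut_nontrivial[OF g] by (simp add: minimal_def)
  fix J assume J: "nontrivial J \<and> J \<subseteq> g ` I"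
  then have JK: "J \<subseteq> K" by (auto simp: nontrivial_def inner_def)
  have "inv_into K g ` J \<subseteq> I" using J aut_inv_image[OF g IK] image_mono[of J "g ` I" "inv_into K g"] by simp
  moreover have "nontrivial (inv_into K g ` J)" using J aut_nontrivial[OF aut_inv[OF g]] by blast
  ultimately have "inv_into K g ` J = I" using I by (simp add: minimal_def)
  then show "J = g ` I" using aut_image_inv[OF g JK] by simp
qed

lemma aut_minimal_iff: assumes g: "aut g" and I: "I \<subseteq> K" shows "minimal (g ` I) \<longleftrightarrow> minimal I"
  using aut_minimal[OF g, of I] aut_minimal[OF aut_inv[OF g], of "g ` I"] aut_inv_image[OF g I] by auto

lemma aut_minimals: "aut g \<Longrightarrow> I \<in> minimals \<Longrightarrow> g ` I \<in> minimals" and aut_nonminimals: "aut g \<Longrightarrow> I \<in> nonminimals \<Longrightarrow> g ` I \<in> nonminimals"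
  using aut_nontrivial[of g I] aut_image_K[of g I] aut_minimal_iff[of g I]
  by (auto simp: minimals_def nonminimals_def nontrivial_def inner_def)

lemma R_minimals: "R r \<in> minimals"
proof -
  obtain x where x: "x \<in> R r" "x \<noteq> 0" by (rule R_nonzero)
  then have n: "nontrivial (R r)" using inner_R by (auto simp: nontrivial_def)
  moreover have "J = R r" if J: "nontrivial J" "J \<subseteq> R r" for J
  proof -
    obtain y where "y \<in> J" "y \<noteq> 0" using J inner_subspace subspace_0 by (fastforce simp: nontrivial_def)
    then show ?thesis using inner_R_subset[of J y r] J by (auto simp: nontrivial_def)
  qed
  ultimately show ?thesis using R_neq_K by (auto simp: minimals_def minimal_def)
qed

lemma X_nonminimals: "X r \<in> nonminimals"
proof -
  obtain x where x: "x \<in> R (r + 1)" "x \<noteq> 0" by (rule R_nonzero)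
  then have "x \<in> X r" using R_subset_X by blast
  then have n: "nontrivial (X r)" using inner_X x by (auto simp: nontrivial_def)
  have "x \<notin> R r" using x R_D(3)[of x r "r + 1"] R_D(3)[of x "r + 1" "r + 1"] by auto
  then have "R r \<noteq> X r" using \<open>x \<in> X r\<close> by blast
  then have "\<not> minimal (X r)" using R_subset_X[of r] R_minimals[of r] by (auto simp: minimal_def minimals_def)
  then show ?thesis using n X_neq_K by (simp add: nonminimals_def)
qed

lemma minimals_nonminimals_disjoint: "I \<in> minimals \<Longrightarrow> I \<notin> nonminimals"
  by (auto simp: minimals_def nonminimals_def)

lemma minimals_normal_form: assumes "M \<in> minimals" shows "\<exists>e \<in> U b. \<exists>r. e ` M = R r"
proof -
  obtain e r where e: "e \<in> U b" "R r \<subseteq> e ` M"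
    using inner_normal_form[of M b] minimals_D[OF assms] by blast
  have "minimal (e ` M)" using aut_minimals[OF U_aut[OF e(1)] assms] by (simp add: minimals_def)
  then have "e ` M = R r" using e R_minimals[of r] unfolding minimal_def minimals_def by blast
  then show ?thesis using e by blast
qed

lemma nonminimals_contains: assumes "N \<in> nonminimals" "R r \<subseteq> N" shows "N = X r \<or> N = X (r + 5)"
  using inner_classification[of N r] assms nonminimals_D[OF assms(1)] R_minimals[of r] minimals_nonminimals_disjoint[of N] by auto

lemma nonminimals_normal_form: assumes "N \<in> nonminimals" shows "\<exists>e \<in> U b. \<exists>r. e ` N = X r"
proof -
  obtain e r where e: "e \<in> U b" "R r \<subseteq> e ` N"
    using inner_normal_form[of N b] nonminimals_D[OF assms] by blast
  then show ?thesis using nonminimals_contains[OF aut_nonminimals[OF U_aut[OF e(1)] assms] e(2)] by blast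
qed

text \<open>The retraction of the building onto the standard apartment \<open>X 0\<close>, ...,
  \<open>X 5\<close>, centred at the chamber \<open>X b\<close>, \<open>X (b + 5)\<close> that
  \<open>U b\<close> fixes; \<open>leading_X\<close> and \<open>X_inj\<close> make it well defined
  on vertices.\<close>

definition vertex_type :: "6 \<Rightarrow> 'l set \<Rightarrow> 6" where "vertex_type b N = (THE r. leading b N = X r)"

lemma vertex_type_eq: assumes "N \<in> nonminimals" "e \<in> U b" "e ` N = X r" shows "vertex_type b N = r"
  unfolding vertex_type_def using leading_X[OF assms(2) _ _ assms(3)] nonminimals_D[OF assms(1)] X_inj by (intro the_equality) auto

section \<open>Adjacency of non-minimal ideals\<close>

definition adj :: "'l set \<Rightarrow> 'l set \<Rightarrow> bool" where
  "adj I J \<longleftrightarrow> I \<in> nonminimals \<and> J \<in> nonminimals \<and> I \<noteq> J \<and> I \<inter> J \<noteq> {0}"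

lemma adj_sym: "adj I J \<Longrightarrow> adj J I"
  by (auto simp: adj_def)

lemma aut_image_Int: "aut g \<Longrightarrow> I \<subseteq> K \<Longrightarrow> J \<subseteq> K \<Longrightarrow> g ` (I \<inter> J) = g ` I \<inter> g ` J"
  using autD(6) by (rule inj_on_image_Int)

lemma adj_aut: assumes g: "aut g" and a: "adj I J" shows "adj (g ` I) (g ` J)"
proof -
  have K: "I \<subseteq> K" "J \<subseteq> K" using a nonminimals_D by (auto simp: adj_def)
  have "g ` (I \<inter> J) \<noteq> {0}"
    using aut_image_eq_iff[OF g, of "I \<inter> J" "{0}"] K a aut_0[OF g] by (auto simp: adj_def)
  then show ?thesis using a aut_nonminimals[OF g] aut_image_eq_iff[OF g K] aut_image_Int[OF g K] by (simp add: adj_def)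
qed

lemma adj_aut_iff: assumes g: "aut g" and "I \<in> nonminimals" "J \<in> nonminimals" shows "adj (g ` I) (g ` J) \<longleftrightarrow> adj I J"
  using adj_aut[OF g, of I J] adj_aut[OF aut_inv[OF g], of "g ` I" "g ` J"] aut_inv_image[OF g] nonminimals_D(4) assms
  by auto

lemma X_Int_X: "X r \<inter> X (r + 5) = R r"
proof
  show "X r \<inter> X (r + 5) \<subseteq> R r"
  proof
    fix x assume x: "x \<in> X r \<inter> X (r + 5)"
    then have "pr (r + 1) x = 0" using X_D(3)[of x "r + 5"] by simp
    then show "x \<in> R r" using X_decomp[of x r] x X_D(1) pr_R[of x r] by force
  qed
qed (use R_subset_X[of r] R_subset_X[of "r + 5"] in auto)

lemma adj_X: "adj (X r) (X (r + 5))"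
proof -
  have "X r \<noteq> X (r + 5)" using X_inj[of r "r + 5"] by auto
  moreover have "R r \<noteq> {0}" using R_minimals minimals_D by blast
  ultimately show ?thesis by (simp add: adj_def X_nonminimals X_Int_X)
qed

text \<open>The intersection is itself a proper non-trivial inner ideal, so it can be moved to
  contain some \<open>R r\<close>. Both ideals then contain \<open>R r\<close>, and only two
  non-minimal ideals do.\<close>

lemma adj_normal_form:
  assumes "adj I J"
  shows "\<exists>e \<in> U b. \<exists>r. e ` (I \<inter> J) = R r \<and> (e ` I = X r \<and> e ` J = X (r + 5) \<or> e ` J = X r \<and> e ` I = X (r + 5))"
proof -
  have a: "I \<in> nonminimals" "J \<in> nonminimals" "I \<noteq> J" "I \<inter> J \<noteq> {0}" using assms by (auto simp: adj_def)
  have K: "I \<subseteq> K" "J \<subseteq> K" using a nonminimals_D by auto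
  have "inner (I \<inter> J)" using nonminimals_D(1)[OF a(1)] nonminimals_D(1)[OF a(2)] by (auto simp: inner_def subspace_inter)
  moreover have "I \<inter> J \<noteq> K" using K nonminimals_D(3)[OF a(1)] by blast
  ultimately obtain e r where e: "e \<in> U b" "R r \<subseteq> e ` (I \<inter> J)"
    using inner_normal_form[of "I \<inter> J" b] a(4) by blast
  have g: "aut e" using U_aut[OF e(1)] .
  have "e ` I = X r \<or> e ` I = X (r + 5)" using nonminimals_contains[OF aut_nonminimals[OF g a(1)], of r] e by blast
  moreover have "e ` J = X r \<or> e ` J = X (r + 5)" using nonminimals_contains[OF aut_nonminimals[OF g a(2)], of r] e by blast
  moreover have "e ` I \<noteq> e ` J" using aut_image_eq_iff[OF g K] a(3) by simp
  ultimately have c: "e ` I = X r \<and> e ` J = X (r + 5) \<or> e ` J = X r \<and> e ` I = X (r + 5)" by metis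
  then have "e ` (I \<inter> J) = R r" using aut_image_Int[OF g K] X_Int_X[of r] Int_commute[of "X r"] by metis
  then show ?thesis using e c by blast
qed

text \<open>One element of \<open>U b\<close> straightens both ends of an edge at once, so the types
  of both ends can be read off from the same conjugate.\<close>

lemma adj_vertex_type: assumes "adj I J" shows "vertex_type b J = vertex_type b I + 1 \<or> vertex_type b I = vertex_type b J + 1"
proof -
  have N: "I \<in> nonminimals" "J \<in> nonminimals" using assms by (auto simp: adj_def)
  obtain e r where e: "e \<in> U b" "e ` I = X r \<and> e ` J = X (r + 5) \<or> e ` J = X r \<and> e ` I = X (r + 5)"
    using adj_normal_form[OF assms, of b] by metis
  then show ?thesis using vertex_type_eq[OF N(1) e(1)] vertex_type_eq[OF N(2) e(1)] by (metis add_6(25) add_6(5) add_6(21))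
qed

lemma adj_third: assumes "adj I J" "N \<in> nonminimals" "I \<inter> J \<subseteq> N" shows "N = I \<or> N = J"
proof -
  have N: "I \<in> nonminimals" "J \<in> nonminimals" using assms by (auto simp: adj_def)
  obtain e r where e: "e \<in> U 0" "e ` (I \<inter> J) = R r" 
      "e ` I = X r \<and> e ` J = X (r + 5) \<or> e ` J = X r \<and> e ` I = X (r + 5)"
    using adj_normal_form[OF assms(1), of 0] by metis
  have g: "aut e" using U_aut[OF e(1)] .
  have "R r \<subseteq> e ` N" using e(2) assms(3) by blast
  then have "e ` N = e ` I \<or> e ` N = e ` J" using nonminimals_contains[OF aut_nonminimals[OF g assms(2)]] e(3) by metis
  then show ?thesis using aut_image_eq_iff[OF g] nonminimals_D(4) N assms(2) by metis
qed

lemma adj_minimals: assumes "adj I J" shows "I \<inter> J \<in> minimals"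
proof -
  have K: "I \<subseteq> K" using assms nonminimals_D by (auto simp: adj_def)
  obtain e r where e: "e \<in> U 0" "e ` (I \<inter> J) = R r" using adj_normal_form[OF assms, of 0] by metis
  have "aut e" using U_aut[OF e(1)] .
  then have "I \<inter> J = inv_into K e ` R r" using aut_inv_image[of e "I \<inter> J"] e K by auto
  then show ?thesis using aut_minimals[OF aut_inv[OF \<open>aut e\<close>] R_minimals] by simp
qed

section \<open>Root exponentials acting on vertices\<close>

lemma exp_root_X_fix: assumes y: "y \<in> R s" and x: "x \<in> X s \<or> x \<in> X (s + 5)" shows "exp_root y x = x"
proof -
  have xK: "x \<in> K" using x X_D by blast
  have yK: "y \<in> K" using y R_K by blast
  have "br y x = 0"
  proof -
    have "br y (pr s x) = 0" "br y (pr (s + 1) x) = 0" "br y (pr (s + 5) x) = 0"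
      using br_R_0[OF y] br_R_1[OF y] br_R_5[OF y] xK by auto
    then show ?thesis
      using x X_decomp[of x s] X_decomp[of x "s + 5"] br_add_right[of y "pr s x" "pr (s + 1) x"]
        br_add_right[of y "pr (s + 5) x" "pr s x"] xK yK by auto
  qed
  then show ?thesis using yK by (simp add: exp_root_def)
qed

lemma exp_root_X_fix_image: assumes y: "y \<in> R s" shows "exp_root y ` X s = X s" "exp_root y ` X (s + 5) = X (s + 5)"
  using exp_root_X_fix[OF y] by (auto simp: image_iff)

lemma exp_root_image_neg: assumes y: "y \<in> R s" and J: "J \<subseteq> K" shows "exp_root (- y) ` (exp_root y ` J) = J"
proof -
  have "exp_root (- y) (exp_root y x) = x" if "x \<in> J" for x using exp_root_neg[OF y] that J by auto
  then show ?thesis by (force simp: image_iff)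
qed

lemma exp_root_X_invariant:
  assumes y: "y \<in> R s" shows "exp_root y ` X (s + 1) = X (s + 1)" "exp_root y ` X (s + 4) = X (s + 4)"
proof -
  have sub: "exp_root y ` X (s + 1) \<subseteq> X (s + 1) \<and> exp_root y ` X (s + 4) \<subseteq> X (s + 4)" if y: "y \<in> R s" for y
  proof -
    note yD = R_D[OF y]
    have "exp_root y x \<in> X (s + 1)" if x: "x \<in> X (s + 1)" for x
    proof -
      note xD = X_D(1)[OF x] X_D(2-)[OF x, simplified]
      show ?thesis
        by (rule X_I) (simp_all add: exp_root_def pr_linear pr_br pz_br_at[of _ _ s] yD xD)
    qed
    moreover have "exp_root y x \<in> X (s + 4)" if x: "x \<in> X (s + 4)" for x
    proof -
      note xD = X_D(1)[OF x] X_D(2-)[OF x, simplified]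
      show ?thesis
        by (rule X_I) (simp_all add: exp_root_def pr_linear pr_br pz_br_at[of _ _ s] yD xD)
    qed
    ultimately show ?thesis by blast
  qed
  have ny: "- y \<in> R s" using y by (rule R_closed)
  have XK: "X j \<subseteq> K" for j using X_D by blast
  have "X (s + 1) \<subseteq> exp_root y ` X (s + 1)" "X (s + 4) \<subseteq> exp_root y ` X (s + 4)"
    using exp_root_image_neg[OF ny XK, of "s + 1"] exp_root_image_neg[OF ny XK, of "s + 4"] sub[OF ny]
      image_mono[of _ _ "exp_root y"] by (metis minus_minus)+
  then show "exp_root y ` X (s + 1) = X (s + 1)" "exp_root y ` X (s + 4) = X (s + 4)" using sub[OF y] by (auto intro!: subset_antisym simp del: image_subset_iff)
qed

text \<open>\<open>exp_root y\<close> fixes \<open>X s\<close> and \<open>X (s + 5)\<close>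
  pointwise, hence also the intersection of \<open>J\<close> with one of them. By
  \<open>adj_third\<close> the image of \<open>J\<close> is \<open>J\<close> or that ideal, and
  injectivity leaves only \<open>J\<close>.\<close>

lemma exp_root_fix: assumes y: "y \<in> R s" and J: "J = X s \<or> adj J (X s) \<or> J = X (s + 5) \<or> adj J (X (s + 5))"
  shows "exp_root y ` J = J"
proof -
  have g: "aut (exp_root y)" by (rule aut_exp_root[OF y])
  have main: "exp_root y ` J = J" if a: "adj J N" and fixN: "\<And>x. x \<in> N \<Longrightarrow> exp_root y x = x" for N
  proof -
    have JN: "J \<in> nonminimals" "N \<in> nonminimals" "J \<noteq> N" using a by (auto simp: adj_def)
    have "x = exp_root y x" if "x \<in> J \<inter> N" for x using that fixN by simp
    then have "J \<inter> N \<subseteq> exp_root y ` J" by blast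
    moreover have "exp_root y ` N = N" using fixN by (auto simp: image_iff)
    ultimately show ?thesis
      using adj_third[OF a aut_nonminimals[OF g JN(1)]] aut_image_eq_iff[OF g, of J N] JN nonminimals_D(4) by metis
  qed
  show ?thesis using J main[of "X s"] main[of "X (s + 5)"] exp_root_X_fix[OF y] exp_root_X_fix_image[OF y] by blast
qed

text \<open>A non-zero \<open>x\<close> in the intersection with \<open>X (s + 1)\<close> has a
  component at \<open>s + 2\<close>, since otherwise \<open>R (s + 1)\<close> would lie in
  \<open>J\<close> and force \<open>J = X s\<close>. The exponential of some \<open>y\<close> in
  \<open>R s\<close> removes the other component of \<open>x\<close> and so moves \<open>J\<close>
  to \<open>X (s + 2)\<close>. This is the transitivity behind the Moufang condition.\<close>

lemma neighbour_up:
  assumes a: "adj J (X (s + 1))" and ne: "J \<noteq> X s" shows "\<exists>y \<in> R s. exp_root y ` J = X (s + 2)"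
proof -
  have J: "J \<in> nonminimals" "J \<noteq> X (s + 1)" using a by (auto simp: adj_def)
  note JI = nonminimals_D[OF J(1)]
  have int: "inner (J \<inter> X (s + 1))" "J \<inter> X (s + 1) \<noteq> {0}"
    using minimals_D[OF adj_minimals[OF a]] by auto
  then obtain x where x: "x \<in> J" "x \<in> X (s + 1)" "x \<noteq> 0"
    using subspace_0[OF inner_subspace[OF int(1)]] by blast
  have xK: "x \<in> K" using JI x by blast
  have dec: "x = pr (s + 1) x + pr (s + 2) x" using X_decomp[OF x(2)] by simp
  have "pr (s + 2) x \<noteq> 0"
  proof
    assume "pr (s + 2) x = 0"
    then have "x \<in> R (s + 1)" using dec pr_R[OF xK, of "s + 1"] by simp
    then have "R (s + 1) \<subseteq> J" using inner_R_subset[OF JI(1)] x by blast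
    then show False using nonminimals_contains[OF J(1), of "s + 1"] J ne by simp
  qed
  then obtain y where y: "y \<in> R s" "br (pr (s + 2) x) y = pr (s + 1) x"
    using br_4_surj[of "pr (s + 2) x" "s + 2" "pr (s + 1) x"] xK by auto
  have yK: "y \<in> K" using y R_K by blast
  have 1: "br y (pr (s + 2) x) = - pr (s + 1) x" using br_anti[of "pr (s + 2) x" y] y yK xK by simp
  have 2: "br y (pr (s + 1) x) = 0" using br_R_1[OF y(1)] xK by simp
  have yx: "br y x = - pr (s + 1) x"
    using dec br_add_right[of "y" "pr (s + 1) x" "pr (s + 2) x"] 1 2 xK yK by simp
  have "exp_root y x = x - pr (s + 1) x" unfolding exp_root_def yx using 2 xK yK by (simp add: br_neg_right)
  also have "\<dots> = pr (s + 2) x" using dec by (simp add: algebra_simps)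
  finally have *: "pr (s + 2) x \<in> exp_root y ` J" using x by (metis image_eqI)
  have g: "aut (exp_root y)" by (rule aut_exp_root[OF y(1)])
  have "R (s + 2) \<subseteq> exp_root y ` J"
    using inner_R_subset[OF aut_inner[OF g JI(1)] *] \<open>pr (s + 2) x \<noteq> 0\<close> xK by simp
  then have "exp_root y ` J = X (s + 2) \<or> exp_root y ` J = X (s + 1)"
    using nonminimals_contains[OF aut_nonminimals[OF g J(1)], of "s + 2"] by simp
  moreover have "exp_root y ` J \<noteq> X (s + 1)"
    using aut_image_eq_iff[OF g JI(4), of "X (s + 1)"] exp_root_X_invariant(1)[OF y(1)] J X_D by blast
  ultimately show ?thesis using y by blast
qed

text \<open>Mirror image of \<open>neighbour_up\<close>, at the other end of the root.\<close>

lemma neighbour_down: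
  assumes a: "adj J (X (s + 4))" and ne: "J \<noteq> X (s + 5)" shows "\<exists>y \<in> R s. exp_root y ` J = X (s + 3)"
proof -
  have J: "J \<in> nonminimals" "J \<noteq> X (s + 4)" using a by (auto simp: adj_def)
  note JI = nonminimals_D[OF J(1)]
  have int: "inner (J \<inter> X (s + 4))" "J \<inter> X (s + 4) \<noteq> {0}"
    using minimals_D[OF adj_minimals[OF a]] by auto
  then obtain x where x: "x \<in> J" "x \<in> X (s + 4)" "x \<noteq> 0"
    using subspace_0[OF inner_subspace[OF int(1)]] by blast
  have xK: "x \<in> K" using JI x by blast
  have dec: "x = pr (s + 4) x + pr (s + 5) x" using X_decomp[OF x(2)] by simp
  have "pr (s + 4) x \<noteq> 0"
  proof
    assume "pr (s + 4) x = 0"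
    then have "x \<in> R (s + 5)" using dec pr_R[OF xK, of "s + 5"] by simp
    then have "R (s + 5) \<subseteq> J" using inner_R_subset[OF JI(1)] x by blast
    then show False using nonminimals_contains[OF J(1), of "s + 5"] J ne by simp
  qed
  then obtain y where y: "y \<in> R s" "br (pr (s + 4) x) y = pr (s + 5) x"
    using br_2_surj[of "pr (s + 4) x" "s + 4" "pr (s + 5) x"] xK by auto
  have yK: "y \<in> K" using y R_K by blast
  have 1: "br y (pr (s + 4) x) = - pr (s + 5) x" using br_anti[of "pr (s + 4) x" y] y yK xK by simp
  have 2: "br y (pr (s + 5) x) = 0" using br_R_5[OF y(1)] xK by simp
  have yx: "br y x = - pr (s + 5) x"
    using dec br_add_right[of "y" "pr (s + 4) x" "pr (s + 5) x"] 1 2 xK yK by simp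
  have "exp_root y x = x - pr (s + 5) x" unfolding exp_root_def yx using 2 xK yK by (simp add: br_neg_right)
  also have "\<dots> = pr (s + 4) x" using dec by (simp add: algebra_simps)
  finally have *: "pr (s + 4) x \<in> exp_root y ` J" using x by (metis image_eqI)
  have g: "aut (exp_root y)" by (rule aut_exp_root[OF y(1)])
  have "R (s + 4) \<subseteq> exp_root y ` J"
    using inner_R_subset[OF aut_inner[OF g JI(1)] *] \<open>pr (s + 4) x \<noteq> 0\<close> xK by simp
  then have "exp_root y ` J = X (s + 4) \<or> exp_root y ` J = X (s + 3)"
    using nonminimals_contains[OF aut_nonminimals[OF g J(1)], of "s + 4"] by simp
  moreover have "exp_root y ` J \<noteq> X (s + 4)"
    using aut_image_eq_iff[OF g JI(4), of "X (s + 4)"] exp_root_X_invariant(2)[OF y(1)] J X_D by blast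
  ultimately show ?thesis using y by blast
qed

lemma U_Ex1: "y \<in> R b \<or> y \<in> R (b + 1) \<or> y \<in> R (b + 5) \<Longrightarrow> exp_root y \<in> U b"
  using U_exp_root[OF U_id, of y b] by (simp add: comp_def)

text \<open>Seen from the chamber of \<open>s\<close>, the vertices \<open>d\<close> and
  \<open>c\<close> have types \<open>s + 1\<close> and \<open>s + 4\<close>, which differ by 3,
  while the types of adjacent vertices differ by 1.\<close>

lemma no_quadrangle_X:
  assumes "adj d (X s)" "d \<noteq> X (s + 5)" "adj c (X (s + 5))" "c \<noteq> X s" shows "\<not> adj c d"
proof
  assume cd: "adj c d"
  have N: "c \<in> nonminimals" "d \<in> nonminimals" using assms by (auto simp: adj_def)
  obtain y where y: "y \<in> R (s + 5)" "exp_root y ` d = X (s + 1)" using neighbour_up[of d "s + 5"] assms by auto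
  obtain z where z: "z \<in> R (s + 1)" "exp_root z ` c = X (s + 4)" using neighbour_down[of c "s + 1"] assms by auto
  have "vertex_type s d = s + 1" "vertex_type s c = s + 4"
    using vertex_type_eq[OF N(2) U_Ex1 y(2)] vertex_type_eq[OF N(1) U_Ex1 z(2)] y z by auto
  then show False using adj_vertex_type[OF cd, of s] by simp
qed

lemma no_quadrangle:
  assumes "adj v1 v2" "adj v2 v3" "adj v3 v4" "adj v4 v1" "v1 \<noteq> v3" shows "v2 = v4"
proof (rule ccontr)
  assume ne: "v2 \<noteq> v4"
  have N: "v1 \<in> nonminimals" "v2 \<in> nonminimals" "v3 \<in> nonminimals" "v4 \<in> nonminimals" using assms by (auto simp: adj_def)
  obtain e r where e: "e \<in> U 0" "e ` v1 = X r \<and> e ` v2 = X (r + 5) \<or> e ` v2 = X r \<and> e ` v1 = X (r + 5)"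
    using adj_normal_form[OF assms(1), of 0] by metis
  have g: "aut e" using U_aut[OF e(1)] .
  note a = assms(1-4)[THEN adj_aut[OF g]]
  have "e ` v1 \<noteq> e ` v3" "e ` v2 \<noteq> e ` v4" using aut_image_eq_iff[OF g] nonminimals_D(4) N ne assms(5) by auto
  then show False
    using e(2) a no_quadrangle_X[of "e ` v4" r "e ` v3"] no_quadrangle_X[of "e ` v3" r "e ` v4"] adj_sym by metis
qed

lemma U_fixes_X: assumes "g \<in> U b" shows "g ` X b = X b" "g ` X (b + 5) = X (b + 5)"
proof -
  have "g ` X b = X b \<and> g ` X (b + 5) = X (b + 5)" using assms
  proof (induction rule: U.induct)
    case (U_exp_root g y)
    have "exp_root y ` X b = X b \<and> exp_root y ` X (b + 5) = X (b + 5)"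
      using U_exp_root(2) exp_root_X_fix_image[of y b] exp_root_X_fix_image[of y "b + 1"] exp_root_X_invariant[of y "b + 1"]
        exp_root_X_fix_image[of y "b + 5"] exp_root_X_invariant[of y "b + 5"] by (elim disjE) simp_all
    then show ?case using U_exp_root unfolding image_comp[symmetric] by simp
  qed simp
  then show "g ` X b = X b" "g ` X (b + 5) = X (b + 5)" by auto
qed

lemma U_fixes_R_image: assumes "g \<in> U b" shows "g ` R b = R b"
proof -
  have "g ` R b = (\<lambda>x. x) ` R b" by (rule image_cong[OF refl]) (rule U_fixes_R[OF assms])
  then show ?thesis by simp
qed

text \<open>The second reduction uses as base root the \<open>r\<close> found by the first:
  \<open>U r\<close> stabilises \<open>R r\<close> and \<open>X r\<close>, so the first ideal stays
  in standard position while the second is straightened.\<close>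

lemma common_apartment:
  assumes I: "I \<in> minimals \<union> nonminimals" and J: "J \<in> minimals \<union> nonminimals"
  shows "\<exists>g r s. aut g \<and> (I = g ` R r \<or> I = g ` X r) \<and> (J = g ` R s \<or> J = g ` X s)"
proof -
  have K: "I \<subseteq> K" "J \<subseteq> K" using I J minimals_D(4) nonminimals_D(4) by blast+
  have nf: "\<exists>e \<in> U b. \<exists>r. e ` I = R r \<or> e ` I = X r" if "I \<in> minimals \<union> nonminimals" for I b
    using that minimals_normal_form[of I b] nonminimals_normal_form[of I b] by blast
  obtain e r where e: "e \<in> U 0" "e ` I = R r \<or> e ` I = X r" using nf[OF I] by blast
  have "e ` J \<in> minimals \<union> nonminimals" using J aut_minimals[OF U_aut[OF e(1)]] aut_nonminimals[OF U_aut[OF e(1)]] by blast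
  from nf[OF this, of r] obtain f s where f: "f \<in> U r" "f ` (e ` J) = R s \<or> f ` (e ` J) = X s" by blast
  have fI: "f ` (e ` I) = R r \<or> f ` (e ` I) = X r" using e(2) U_fixes_X(1)[OF f(1)] U_fixes_R_image[OF f(1)] by metis
  define h where "h = f \<circ> e"
  have h: "aut h" unfolding h_def by (rule aut_comp[OF U_aut[OF f(1)] U_aut[OF e(1)]])
  have i: "inv_into K h ` (h ` I) = I" "inv_into K h ` (h ` J) = J"
    by (rule aut_inv_image[OF h K(1)], rule aut_inv_image[OF h K(2)])
  have hI: "h ` I = R r \<or> h ` I = X r" and hJ: "h ` J = R s \<or> h ` J = X s"
    using fI f(2) by (simp_all only: h_def image_comp)
  have "I = inv_into K h ` R r \<or> I = inv_into K h ` X r" using hI i(1) by metis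
  moreover have "J = inv_into K h ` R s \<or> J = inv_into K h ` X s" using hJ i(2) by metis
  ultimately have "(I = inv_into K h ` R r \<or> I = inv_into K h ` X r) \<and> (J = inv_into K h ` R s \<or> J = inv_into K h ` X s)"
    by blast
  then show ?thesis using aut_inv[OF h] by blast
qed

section \<open>Points and lines, and rigidity of elations\<close>

definition is_point :: "'l set \<Rightarrow> bool" where "is_point N \<longleftrightarrow> vertex_type 0 N \<in> {0, 2, 4}"

lemma adj_is_point: assumes "adj I J" shows "is_point I \<longleftrightarrow> \<not> is_point J"
proof -
  have "(t + 1 \<in> {0, 2, 4}) \<longleftrightarrow> t \<notin> {0, 2, 4}" for t :: 6
    by (cases t "0 :: 6" rule: cases_6) simp_all
  then show ?thesis using adj_vertex_type[OF assms, of 0] unfolding is_point_def by metis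
qed

lemma is_point_apartment: assumes g: "aut g" shows "is_point (g ` X (r + 1)) \<longleftrightarrow> \<not> is_point (g ` X r)"
  using adj_is_point[OF adj_aut[OF g adj_X[of "r + 1"]]] by simp

lemma is_point_apartment_even: assumes g: "aut g" shows "is_point (g ` X s) \<longleftrightarrow> (is_point (g ` X r) \<longleftrightarrow> s \<in> {r, r + 2, r + 4})"
proof -
  note p = is_point_apartment[OF g, of r] is_point_apartment[OF g, of "r + 1"] is_point_apartment[OF g, of "r + 2"]
    is_point_apartment[OF g, of "r + 3"] is_point_apartment[OF g, of "r + 4"]
  show ?thesis by (cases s r rule: cases_6) (use p in simp_all)
qed

lemma aut_adj_X: "aut g \<Longrightarrow> adj (g ` X r) (g ` X (r + 1))" "aut g \<Longrightarrow> adj (g ` X (r + 1)) (g ` X r)"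
    "aut g \<Longrightarrow> adj (g ` X r) (g ` X (r + 5))"
  using adj_aut[OF _ adj_X[of "r + 1"]] adj_aut[OF _ adj_X[of "r"]] adj_sym by auto

lemma nonminimals_apartment:
  assumes "I \<in> nonminimals" "J \<in> nonminimals" obtains g r s where "aut g" "I = g ` X r" "J = g ` X s"
proof -
  have "I \<in> minimals \<union> nonminimals" "J \<in> minimals \<union> nonminimals" using assms by auto
  from common_apartment[OF this] obtain g r s
    where g: "aut g" "I = g ` R r \<or> I = g ` X r" "J = g ` R s \<or> J = g ` X s" by metis
  have "g ` R t \<notin> nonminimals" for t using minimals_nonminimals_disjoint[OF aut_minimals[OF g(1) R_minimals]] .
  then show thesis using that g assms by metis
qed

lemma common_neighbour:
  assumes "I \<in> nonminimals" "J \<in> nonminimals" "is_point I \<longleftrightarrow> is_point J" shows "\<exists>N. adj I N \<and> adj J N"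
proof -
  obtain g r s where g: "aut g" "I = g ` X r" "J = g ` X s"
    using nonminimals_apartment[OF assms(1,2)] .
  have "s = r \<or> s = r + 2 \<or> s = r + 4" using is_point_apartment_even[OF g(1), of s r] g(2,3) assms(3) by (cases "is_point (g ` X r)") simp_all
  then show ?thesis
    using aut_adj_X[OF g(1), of r] aut_adj_X[OF g(1), of "r + 1"] aut_adj_X[OF g(1), of "r + 4"]
    unfolding g(2,3) by (elim disjE) (simp_all, metis+)
qed

text \<open>Two neighbours lie in an apartment. The third is the image of \<open>X (r + 1)\<close>
  under an exponential from \<open>R (r + 5)\<close>, which stabilises \<open>X r\<close> and
  \<open>X (r + 5)\<close>; it moves \<open>X (r + 1)\<close> because \<open>br_2_inj\<close> yields
  a non-zero component at \<open>r\<close>.\<close>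

lemma three_neighbours:
  assumes "I \<in> nonminimals" shows "\<exists>a b c. adj I a \<and> adj I b \<and> adj I c \<and> a \<noteq> b \<and> b \<noteq> c \<and> a \<noteq> c"
proof -
  obtain g r where g: "aut g" "I = g ` X r"
    using nonminimals_apartment[OF assms assms] .
  obtain y where y: "y \<in> R (r + 5)" "y \<noteq> 0" by (rule R_nonzero)
  obtain x where x: "x \<in> R (r + 1)" "x \<noteq> 0" by (rule R_nonzero)
  have K: "x \<in> K" "y \<in> K" using x y R_K by auto
  have h: "aut (exp_root y)" by (rule aut_exp_root[OF y(1)])
  have XK: "X j \<subseteq> K" for j using X_D by blast
  have Xr: "exp_root y ` X r = X r" "exp_root y ` X (r + 5) = X (r + 5)"
    using exp_root_X_invariant(1)[OF y(1)] exp_root_X_fix_image[OF y(1)] by simp_all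
  have a3: "adj (X r) (exp_root y ` X (r + 1))" using aut_adj_X(1)[OF h, of r] Xr by simp
  have n1: "exp_root y ` X (r + 1) \<noteq> X (r + 5)"
    using aut_image_eq_iff[OF h XK XK, of "r + 1" "r + 5"] Xr X_inj[of "r + 1" "r + 5"] by auto
  have n2: "exp_root y ` X (r + 1) \<noteq> X (r + 1)"
  proof
    assume *: "exp_root y ` X (r + 1) = X (r + 1)"
    have "x \<in> X (r + 1)" using x R_subset_X by blast
    then have "exp_root y x \<in> X (r + 1)" using * by blast
    then have "pr r (exp_root y x) = 0" using X_D(6)[of "exp_root y x" "r + 1"] by simp
    then have "br y x = 0"
      using K by (simp add: exp_root_def pr_linear pr_br pz_br_at[of _ _ r] R_D[OF x(1)] R_D[OF y(1)])
    then show False using br_2_inj[OF y, of x] x by simp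
  qed
  have n3: "X (r + 1) \<noteq> X (r + 5)" using X_inj[of "r + 1" "r + 5"] by auto
  have a1: "adj (X r) (X (r + 1))" "adj (X r) (X (r + 5))" using adj_X[of "r + 1"] adj_X[of r] adj_sym by auto
  have EK: "exp_root y ` X (r + 1) \<subseteq> K" using a3 nonminimals_D by (auto simp: adj_def)
  show ?thesis
  proof (intro exI conjI)
    show "adj I (g ` X (r + 1))" "adj I (g ` X (r + 5))" "adj I (g ` (exp_root y ` X (r + 1)))"
      unfolding g(2) by (rule adj_aut[OF g(1)], rule a1 a3)+
    show "g ` X (r + 1) \<noteq> g ` X (r + 5)" "g ` X (r + 5) \<noteq> g ` (exp_root y ` X (r + 1))"
      "g ` X (r + 1) \<noteq> g ` (exp_root y ` X (r + 1))"
      using aut_image_eq_iff[OF g(1) XK XK, of "r + 1" "r + 5"] aut_image_eq_iff[OF g(1) XK EK]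
        n1 n2 n3 by metis+
  qed
qed

text \<open>If \<open>v\<close> is called a point, it is the centre, \<open>w\<close> is the axis
  and \<open>y\<close> is a fixed point off the axis. A point \<open>p\<close> off the line
  \<open>x\<close> is the meet of its line to \<open>v\<close>, fixed since it passes through the
  centre, and its line to \<open>y\<close>, fixed since it also meets the axis in a fixed point.
  Points and lines are told apart relative to \<open>v\<close>, so the dual situation is
  included.\<close>

lemma elation_rigid:
  assumes g: "\<And>a b. a \<in> nonminimals \<Longrightarrow> b \<in> nonminimals \<Longrightarrow> adj a b \<Longrightarrow> adj (g a) (g b)"
    and vw: "adj v w" and fv: "\<And>a. adj a v \<Longrightarrow> g a = a" and fw: "\<And>a. adj a w \<Longrightarrow> g a = a"
    and x: "adj x v" "x \<noteq> w" and y: "adj y x" "y \<noteq> v" "g y = y" and z: "z \<in> nonminimals"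
  shows "g z = z"
proof -
  have g: "adj (g a) (g b)" if "adj a b" for a b using that g by (auto simp: adj_def)
  have N: "v \<in> nonminimals" "w \<in> nonminimals" "x \<in> nonminimals" "y \<in> nonminimals" using vw x y by (auto simp: adj_def)
  have fixv: "g v = v" using fw[OF vw] .
  have two: "a = b" if "adj a l" "adj a m" "adj b l" "adj b m" "l \<noteq> m" for a b l m
    using no_quadrangle[of l a m b] that adj_sym by blast
  \<comment> \<open>\<open>q\<close> may be any fixed point off the axis, with \<open>m\<close> its
    line to the centre, because the points on \<open>x\<close> require a choice other than
    \<open>y\<close>.\<close>
  have A: "g p = p" if q: "q \<in> nonminimals" "g q = q" "\<not> adj q w" "adj m v" "adj m q" 
    and p: "p \<in> nonminimals" "is_point p \<longleftrightarrow> is_point v" "\<not> adj p m" for q m p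
  proof -
    have qv: "q \<noteq> v" using q vw by blast
    have ptq: "is_point q \<longleftrightarrow> is_point v" using adj_is_point q by blast
    obtain l1 where l1: "adj p l1" "adj v l1" using common_neighbour[OF p(1) N(1)] p by blast
    obtain l2 where l2: "adj p l2" "adj q l2" using common_neighbour[OF p(1) q(1)] p ptq by blast
    have gl1: "g l1 = l1" using fv l1 adj_sym by blast
    have "l2 \<in> nonminimals" using l2 by (simp add: adj_def)
    moreover have "is_point l2 \<longleftrightarrow> is_point w" using adj_is_point l2 ptq vw by blast
    ultimately obtain c where c: "adj l2 c" "adj w c" using common_neighbour N by blast
    have gc: "g c = c" using fw c adj_sym by blast
    have cq: "c \<noteq> q" using c q adj_sym by blast
    have "g l2 = l2" using two[of "g l2" c q l2] g[OF c(1)] g[OF l2(2)] gc q c l2 cq adj_sym by metis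
    moreover have "l1 \<noteq> l2"
    proof
      assume "l1 = l2"
      then have "l1 = m" using two[of l1 v q m] l1 l2 q qv adj_sym by blast
      then show False using p l1 by blast
    qed
    ultimately show ?thesis using two[of "g p" l1 l2 p] g[OF l1(1)] g[OF l2(1)] gl1 l1 l2 by simp
  qed
  have yw: "\<not> adj y w"
  proof
    assume "adj y w"
    then have "x = w" using two[of x v y w] x y vw adj_sym by blast
    then show False using x by simp
  qed
  have P: "g p = p" if p: "p \<in> nonminimals" "is_point p \<longleftrightarrow> is_point v" for p
  proof (cases "adj p x")
    case False
    then show ?thesis using A[OF N(4) y(3) yw x(1) _ p] y adj_sym by blast
  next
    case True
    show ?thesis
    proof (cases "p = v")
      case False
      \<comment> \<open>For \<open>p\<close> on \<open>x\<close> a new point \<open>q\<close> is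
        taken on a third line \<open>m\<close> through \<open>v\<close>; it is fixed by the case
        already settled, and \<open>p\<close> does not lie on \<open>m\<close>.\<close>
      obtain m where m: "adj v m" "m \<noteq> x" "m \<noteq> w" using three_neighbours[OF N(1)] by metis
      have mN: "m \<in> nonminimals" using m by (simp add: adj_def)
      obtain q where q: "adj m q" "q \<noteq> v" using three_neighbours[OF mN] by metis
      have qN: "q \<in> nonminimals" using q by (simp add: adj_def)
      have qw: "\<not> adj q w" using two[of q m w v] q m vw adj_sym by blast
      have qx: "\<not> adj q x" using two[of q m x v] q m x adj_sym by blast
      have ptq: "is_point q \<longleftrightarrow> is_point v" using adj_is_point q m by blast
      have gq: "g q = q" using A[OF N(4) y(3) yw x(1) _ qN ptq qx] y adj_sym by blast
      have "\<not> adj p m" using two[of p m x v] m x True False adj_sym by blast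
      then show ?thesis using A[OF qN gq qw _ q(1) p] m adj_sym by blast
    qed (use fixv in simp)
  qed
  show ?thesis
  proof (cases "is_point z \<longleftrightarrow> is_point v")
    case True
    then show ?thesis using P z by blast
  next
    case False
    obtain a b where ab: "adj z a" "adj z b" "a \<noteq> b" using three_neighbours[OF z] by metis
    then have "a \<in> nonminimals" "b \<in> nonminimals" "is_point a \<longleftrightarrow> is_point v" "is_point b \<longleftrightarrow> is_point v" 
      using adj_is_point[of z a] adj_is_point[of z b] False by (auto simp: adj_def)
    then show ?thesis using two[of "g z" a b z] g[OF ab(1)] g[OF ab(2)] P ab by simp
  qed
qed

end

section \<open>Plane, hexagon and root groups\<close>

lemma graph_aut_groupI: "group (graph_aut_group G)"
proof (rule groupI)
  let ?V = "gverts G"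
  fix f g h
  assume f: "f \<in> carrier (graph_aut_group G)"
  then have fb: "bij_betw f ?V ?V" and fE: "\<And>x y. x \<in> ?V \<Longrightarrow> y \<in> ?V \<Longrightarrow> {f x, f y} \<in> gedges G \<longleftrightarrow> {x, y} \<in> gedges G"
    and fe: "f \<in> extensional ?V"
    by (auto simp: graph_aut_group_def graph_iso_def)
  have fV: "f x \<in> ?V" if "x \<in> ?V" for x using fb that by (rule bij_betw_apply)
  show "\<one>\<^bsub>graph_aut_group G\<^esub> \<otimes>\<^bsub>graph_aut_group G\<^esub> f = f"
    using fe fV by (auto simp: graph_aut_group_def compose_def restrict_def extensional_def fun_eq_iff)
  show "\<exists>g \<in> carrier (graph_aut_group G). g \<otimes>\<^bsub>graph_aut_group G\<^esub> f = \<one>\<^bsub>graph_aut_group G\<^esub>"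
  proof (intro bexI)
    let ?g = "\<lambda>x \<in> ?V. inv_into ?V f x"
    have i: "inv_into ?V f x \<in> ?V" "f (inv_into ?V f x) = x" if "x \<in> ?V" for x
      using fb that by (auto simp: bij_betw_def inv_into_into f_inv_into_f)
    show "?g \<otimes>\<^bsub>graph_aut_group G\<^esub> f = \<one>\<^bsub>graph_aut_group G\<^esub>"
      using i by (auto simp: graph_aut_group_def compose_def restrict_def fun_eq_iff)
    have "bij_betw ?g ?V ?V"
      using bij_betw_inv_into[OF fb] by (subst bij_betw_cong[where g = "inv_into ?V f"]) auto
    moreover have "{?g x, ?g y} \<in> gedges G \<longleftrightarrow> {x, y} \<in> gedges G" if "x \<in> ?V" "y \<in> ?V" for x y
      using fE[of "?g x" "?g y"] i that by simp
    ultimately show "?g \<in> carrier (graph_aut_group G)" by (simp add: graph_aut_group_def graph_iso_def)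
  qed
  assume g: "g \<in> carrier (graph_aut_group G)"
  then have gb: "bij_betw g ?V ?V" and gE: "\<And>x y. x \<in> ?V \<Longrightarrow> y \<in> ?V \<Longrightarrow> {g x, g y} \<in> gedges G \<longleftrightarrow> {x, y} \<in> gedges G"
    by (auto simp: graph_aut_group_def graph_iso_def)
  have gV: "g x \<in> ?V" if "x \<in> ?V" for x using gb that by (rule bij_betw_apply)
  have "bij_betw (compose ?V g f) ?V ?V" using fb gb by (rule bij_betw_compose)
  then show "f \<otimes>\<^bsub>graph_aut_group G\<^esub> g \<in> carrier (graph_aut_group G)"
    using fV fE gE by (auto simp: graph_aut_group_def graph_iso_def compose_def)
  assume h: "h \<in> carrier (graph_aut_group G)"
  show "f \<otimes>\<^bsub>graph_aut_group G\<^esub> g \<otimes>\<^bsub>graph_aut_group G\<^esub> h = f \<otimes>\<^bsub>graph_aut_group G\<^esub> (g \<otimes>\<^bsub>graph_aut_group G\<^esub> h)"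
    using fV by (auto simp: graph_aut_group_def compose_def restrict_def fun_eq_iff)
qed (auto simp: graph_aut_group_def graph_iso_def bij_betw_def inj_on_def)

context a2_graded_lie_algebra begin

section \<open>The graph and the geometries of the ideals\<close>

definition ideal_graph :: "'l set ugraph" where
  "ideal_graph = \<lparr> gverts = nonminimals, gedges = {{I, J} | I J. I \<in> nonminimals \<and> J \<in> nonminimals \<and> I \<noteq> J \<and> I \<inter> J \<noteq> {0}} \<rparr>"

definition ideal_geometry :: "('l set, 'l set) geometry" where
  "ideal_geometry = \<lparr> gpoints = minimals, glines = nonminimals, ginc = (\<subseteq>) \<rparr>"

definition ideal_plane :: "('l set, 'l set) geometry" where
  "ideal_plane = \<lparr> gpoints = {N \<in> nonminimals. is_point N}, glines = {N \<in> nonminimals. \<not> is_point N}, ginc = (\<lambda>p l. p \<inter> l \<noteq> {0}) \<rparr>"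

definition act :: "('l \<Rightarrow> 'l) \<Rightarrow> 'l set \<Rightarrow> 'l set" where "act g = (\<lambda>I \<in> nonminimals. g ` I)"

abbreviation (input) vertex_of :: "'l set + 'l set \<Rightarrow> 'l set" where "vertex_of \<equiv> case_sum id id"

lemma ideal_graph_verts [simp]: "gverts ideal_graph = nonminimals" by (simp add: ideal_graph_def)

lemma ideal_graph_edge [simp]: "{I, J} \<in> gedges ideal_graph \<longleftrightarrow> adj I J"
  by (auto simp: ideal_graph_def adj_def doubleton_eq_iff)

lemma adj_nonminimals: "adj I J \<Longrightarrow> I \<in> nonminimals" "adj I J \<Longrightarrow> J \<in> nonminimals"
  by (auto simp: adj_def)

lemma ideal_plane_simps [simp]: "p \<in> gpoints ideal_plane \<longleftrightarrow> p \<in> nonminimals \<and> is_point p" "l \<in> glines ideal_plane \<longleftrightarrow> l \<in> nonminimals \<and> \<not> is_point l"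
  by (auto simp: ideal_plane_def)

lemma ideal_plane_inc: "p \<in> gpoints ideal_plane \<Longrightarrow> l \<in> glines ideal_plane \<Longrightarrow> ginc ideal_plane p l \<longleftrightarrow> adj p l"
  by (auto simp: ideal_plane_def adj_def)

lemma ideal_plane_verts: "gverts (incidence_graph ideal_plane) = gpoints ideal_plane <+> glines ideal_plane"
  by (simp add: incidence_graph_def)

lemma vertex_of_nonminimals: "x \<in> gpoints ideal_plane <+> glines ideal_plane \<Longrightarrow> vertex_of x \<in> nonminimals"
  by auto

lemma ideal_plane_edge: assumes "x \<in> gpoints ideal_plane <+> glines ideal_plane" "y \<in> gpoints ideal_plane <+> glines ideal_plane"
  shows "{x, y} \<in> gedges (incidence_graph ideal_plane) \<longleftrightarrow> adj (vertex_of x) (vertex_of y)"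
proof -
  have "{x, y} \<in> gedges (incidence_graph ideal_plane) \<longleftrightarrow>
      (\<exists>p l. p \<in> gpoints ideal_plane \<and> l \<in> glines ideal_plane \<and> adj p l \<and> (x = Inl p \<and> y = Inr l \<or> x = Inr l \<and> y = Inl p))"
    by (auto simp: incidence_graph_def ideal_plane_inc doubleton_eq_iff)
  also have "\<dots> \<longleftrightarrow> adj (vertex_of x) (vertex_of y)"
    using assms by (auto dest: adj_is_point intro: adj_sym)
  finally show ?thesis .
qed

lemma ideal_plane_edge_verts: "{x, y} \<in> gedges (incidence_graph ideal_plane) \<Longrightarrow> x \<in> gpoints ideal_plane <+> glines ideal_plane \<and> y \<in> gpoints ideal_plane <+> glines ideal_plane"
  by (auto simp: incidence_graph_def doubleton_eq_iff)

lemma vertex_of_bij: "bij_betw vertex_of (gpoints ideal_plane <+> glines ideal_plane) nonminimals"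
proof (rule bij_betw_imageI)
  show "inj_on vertex_of (gpoints ideal_plane <+> glines ideal_plane)" by (auto simp: inj_on_def)
  show "vertex_of ` (gpoints ideal_plane <+> glines ideal_plane) = nonminimals"
  proof (intro equalityI subsetI)
    fix N assume N: "N \<in> nonminimals"
    show "N \<in> vertex_of ` (gpoints ideal_plane <+> glines ideal_plane)"
    proof (rule image_eqI)
      show "N = vertex_of (if is_point N then Inl N else Inr N)" by simp
      show "(if is_point N then Inl N else Inr N) \<in> gpoints ideal_plane <+> glines ideal_plane" using N by (auto simp: Plus_def)
    qed
  qed (use vertex_of_nonminimals in blast)
qed

lemma ideal_plane_iso: "graph_iso vertex_of (incidence_graph ideal_plane) ideal_graph"
  unfolding graph_iso_def ideal_plane_verts ideal_graph_verts
proof (intro conjI ballI vertex_of_bij)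
  fix x y assume "x \<in> gpoints ideal_plane <+> glines ideal_plane" "y \<in> gpoints ideal_plane <+> glines ideal_plane"
  from ideal_plane_edge[OF this] show "{vertex_of x, vertex_of y} \<in> gedges ideal_graph \<longleftrightarrow> {x, y} \<in> gedges (incidence_graph ideal_plane)"
    by (simp only: ideal_graph_edge)
qed

text \<open>Partial linearity is the absence of quadrangles, and the only polygons left to exclude
  are digons. Two elements lie in an image of the standard apartment, in which every second vertex
  is a point of the triangle.\<close>

lemma generalized_triangle: "generalized_gon 3 ideal_plane"
  unfolding generalized_gon_def
proof (intro conjI allI impI ballI)
  show pls: "partial_linear_space ideal_plane"
    unfolding partial_linear_space_def
  proof (intro ballI impI)
    fix p q l m assume "p \<in> gpoints ideal_plane" "q \<in> gpoints ideal_plane" "l \<in> glines ideal_plane" "m \<in> glines ideal_plane"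
      "p \<noteq> q \<and> ginc ideal_plane p l \<and> ginc ideal_plane q l \<and> ginc ideal_plane p m \<and> ginc ideal_plane q m"
    then show "l = m" using no_quadrangle[of p l q m] by (simp add: ideal_plane_inc adj_sym)
  qed
  fix m :: nat assume m: "m < 3"
  show "\<not> (\<exists>ps ls. ordinary_gon ideal_plane m ps ls)"
  proof
    assume "\<exists>ps ls. ordinary_gon ideal_plane m ps ls"
    then obtain ps ls where o: "ordinary_gon ideal_plane m ps ls" by blast
    then have "m = 2" using m by (simp add: ordinary_gon_def)
    with o obtain p q l k where "ps = [p, q]" "ls = [l, k]"
      by (auto simp: ordinary_gon_def length_Suc_conv numeral_2_eq_2)
    moreover have "\<forall>i < 2. ginc ideal_plane (ps ! i) (ls ! i) \<and> ginc ideal_plane (ps ! (Suc i mod 2)) (ls ! i)"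
      "distinct ps" "distinct ls" "set ps \<subseteq> gpoints ideal_plane" "set ls \<subseteq> glines ideal_plane"
      using o unfolding ordinary_gon_def \<open>m = 2\<close> by simp_all
    ultimately have "p \<noteq> q" "l \<noteq> k" "p \<in> gpoints ideal_plane" "q \<in> gpoints ideal_plane" "l \<in> glines ideal_plane" "k \<in> glines ideal_plane"
      "ginc ideal_plane p l" "ginc ideal_plane q l" "ginc ideal_plane q k" "ginc ideal_plane p k"
      by (simp_all add: numeral_2_eq_2 All_less_Suc2)
    then show False using pls unfolding partial_linear_space_def by metis
  qed
next
  fix x y assume x: "x \<in> gpoints ideal_plane <+> glines ideal_plane" and y: "y \<in> gpoints ideal_plane <+> glines ideal_plane"
  obtain g r s where g: "aut g" "vertex_of x = g ` X r" "vertex_of y = g ` X s"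
    using nonminimals_apartment[OF vertex_of_nonminimals[OF x] vertex_of_nonminimals[OF y]] .
  \<comment> \<open>The type of vertices alternates along the apartment; \<open>t\<close> is an
    index at which it shows a point.\<close>
  obtain t where t: "is_point (g ` X t)" using is_point_apartment[OF g(1), of 0] by blast
  have N: "g ` X j \<in> nonminimals" for j using aut_nonminimals[OF g(1) X_nonminimals] .
  have ne: "g ` X i = g ` X j \<longleftrightarrow> i = j" for i j
    using aut_image_eq_iff[OF g(1), of "X i" "X j"] X_inj nonminimals_D(4)[OF X_nonminimals] by auto
  have p: "is_point (g ` X j) \<longleftrightarrow> j \<in> {t, t + 2, t + 4}" for j using is_point_apartment_even[OF g(1), of j t] t by simp
  let ?ps = "[g ` X t, g ` X (t + 2), g ` X (t + 4)]" and ?ls = "[g ` X (t + 1), g ` X (t + 3), g ` X (t + 5)]"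
  have mem: "z \<in> set ?ps <+> set ?ls" if z: "z \<in> gpoints ideal_plane <+> glines ideal_plane" "vertex_of z = g ` X j" for z j
  proof (cases z)
    case (Inl a)
    then have "j \<in> {t, t + 2, t + 4}" using z p[of j] by auto
    then show ?thesis using Inl z by auto
  next
    case (Inr a)
    then have "j \<notin> {t, t + 2, t + 4}" using z p[of j] by auto
    then have "j \<in> {t + 1, t + 3, t + 5}" by (cases j t rule: cases_6) auto
    then show ?thesis using Inr z by auto
  qed
  have inc: "ginc ideal_plane (g ` X i) (g ` X j)" if "i \<in> {t, t + 2, t + 4}" "j \<notin> {t, t + 2, t + 4}" "j = i + 1 \<or> j = i + 5" for i j
    using that ideal_plane_inc[of "g ` X i" "g ` X j"] N p[of i] p[of j] aut_adj_X[OF g(1), of i] by auto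
  have inc6: "ginc ideal_plane (g ` X t) (g ` X (t + 1))" "ginc ideal_plane (g ` X (t + 2)) (g ` X (t + 3))"
    "ginc ideal_plane (g ` X (t + 4)) (g ` X (t + 5))" "ginc ideal_plane (g ` X (t + 2)) (g ` X (t + 1))"
    "ginc ideal_plane (g ` X (t + 4)) (g ` X (t + 3))" "ginc ideal_plane (g ` X t) (g ` X (t + 5))"
    by (rule inc; simp)+
  have "ordinary_gon ideal_plane 3 ?ps ?ls"
    unfolding ordinary_gon_def
  proof (intro conjI allI impI)
    show "distinct ?ps" "distinct ?ls" by (simp_all add: ne)
    show "set ?ps \<subseteq> gpoints ideal_plane" "set ?ls \<subseteq> glines ideal_plane" using N p by simp_all
    fix i :: nat assume "i < 3"
    then have "i = 0 \<or> i = 1 \<or> i = 2" by linarith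
    then show "ginc ideal_plane (?ps ! i) (?ls ! i)" "ginc ideal_plane (?ps ! (Suc i mod 3)) (?ls ! i)"
      using inc6 by (elim disjE; simp del: image_eqI)+
  qed simp_all
  then show "\<exists>ps ls. ordinary_gon ideal_plane 3 ps ls \<and> x \<in> set ps <+> set ls \<and> y \<in> set ps <+> set ls"
    using mem[OF x g(2)] mem[OF y g(3)] by blast
qed simp

text \<open>The exponentials of \<open>y\<close> and \<open>z\<close> send \<open>f v\<close> and
  \<open>f w\<close> to the same vertex, so going there with the first and back with the second
  carries \<open>v\<close> to \<open>w\<close>. Conjugation by \<open>f\<close> keeps the fixed
  neighbourhoods.\<close>

lemma root_elation:
  assumes f: "aut f" and b: "f ` a = X r \<and> f ` c = X (r + 5) \<or> f ` c = X r \<and> f ` a = X (r + 5)"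
    and N: "a \<in> nonminimals" "c \<in> nonminimals" "v \<in> nonminimals" "w \<in> nonminimals"
    and yz: "y \<in> R r" "z \<in> R r" "exp_root y ` (f ` v) = exp_root z ` (f ` w)"
  shows "\<exists>h. aut h \<and> (\<forall>u. u = a \<or> adj u a \<or> u = c \<or> adj u c \<longrightarrow> h ` u = u) \<and> h ` v = w"
proof -
  have nz: "- z \<in> R r" using yz by (intro R_closed)
  define h where "h = inv_into K f \<circ> (exp_root (- z) \<circ> (exp_root y \<circ> f))"
  have h: "h ` u = inv_into K f ` (exp_root (- z) ` (exp_root y ` (f ` u)))" for u by (simp add: h_def image_comp comp_assoc)
  have fK: "f ` u \<in> nonminimals" if "u \<in> nonminimals" for u using aut_nonminimals[OF f that] .
  have "aut h" unfolding h_def by (intro aut_comp aut_inv aut_exp_root[OF nz] aut_exp_root[OF yz(1)] f)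
  moreover have "h ` u = u" if u: "u = a \<or> adj u a \<or> u = c \<or> adj u c" for u
  proof -
    have uN: "u \<in> nonminimals" using u N adj_nonminimals by blast
    have *: "f ` u = X r \<or> adj (f ` u) (X r) \<or> f ` u = X (r + 5) \<or> adj (f ` u) (X (r + 5))"
      using u b adj_aut[OF f, of u a] adj_aut[OF f, of u c] by metis
    have "exp_root y ` (f ` u) = f ` u" "exp_root (- z) ` (f ` u) = f ` u" using exp_root_fix[OF yz(1) *] exp_root_fix[OF nz *] .
    then show ?thesis using aut_inv_image[OF f nonminimals_D(4)[OF uN]] h by simp
  qed
  moreover have "h ` v = w"
    using exp_root_image_neg[OF yz(2) nonminimals_D(4)[OF fK[OF N(4)]]] yz(3) aut_inv_image[OF f nonminimals_D(4)[OF N(4)]] h by simp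
  ultimately show ?thesis by blast
qed

text \<open>The edge \<open>b\<close>, \<open>c\<close> is put into standard position, and a root
  exponential that stabilises both ends moves \<open>a\<close> to the next vertex of the apartment.
  The exponentials of \<open>R r\<close> then fix all vertices near \<open>b\<close> and
  \<open>c\<close>, and by \<open>neighbour_up\<close> or \<open>neighbour_down\<close> they are
  transitive on the neighbours of \<open>a\<close> other than \<open>b\<close>.\<close>

lemma moufang_aut:
  assumes ab: "adj a b" "adj b c" "a \<noteq> c" and v: "adj v a" "v \<noteq> b" and w: "adj w a" "w \<noteq> b"
  shows "\<exists>h. aut h \<and> (\<forall>u. u = b \<or> adj u b \<or> u = c \<or> adj u c \<longrightarrow> h ` u = u) \<and> h ` v = w"
proof -
  note N = adj_nonminimals[OF ab(1)] adj_nonminimals[OF ab(2)] adj_nonminimals[OF v(1)] adj_nonminimals[OF w(1)]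
  obtain e r where e: "e \<in> U 0" "e ` b = X r \<and> e ` c = X (r + 5) \<or> e ` c = X r \<and> e ` b = X (r + 5)"
    using adj_normal_form[OF ab(2), of 0] by metis
  have ea: "aut e" by (rule U_aut[OF e(1)])
  have neq: "f ` I \<noteq> f ` J" if "aut f" "I \<noteq> J" "I \<in> nonminimals" "J \<in> nonminimals" for f I J
    using aut_image_eq_iff[OF that(1)] that nonminimals_D(4) by simp
  have "\<exists>f. aut f \<and> (f ` a = X (r + 1) \<and> f ` b = X r \<and> f ` c = X (r + 5)
      \<or> f ` a = X (r + 4) \<and> f ` b = X (r + 5) \<and> f ` c = X r)"
    using e(2)
  proof
    assume *: "e ` b = X r \<and> e ` c = X (r + 5)"
    have "adj (e ` a) (X r)" "e ` a \<noteq> X (r + 5)" using adj_aut[OF ea ab(1)] neq[OF ea ab(3)] N * by simp_all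
    then obtain y where y: "y \<in> R (r + 5)" "exp_root y ` (e ` a) = X (r + 1)" using neighbour_up[of "e ` a" "r + 5"] by auto
    have "aut (exp_root y \<circ> e)" by (intro aut_comp aut_exp_root[OF y(1)] ea)
    moreover have "(exp_root y \<circ> e) ` a = X (r + 1)" "(exp_root y \<circ> e) ` b = X r" "(exp_root y \<circ> e) ` c = X (r + 5)"
      using * y exp_root_X_invariant(1)[OF y(1)] exp_root_X_fix_image(1)[OF y(1)] by (simp_all only: image_comp[symmetric] add_6)
    ultimately show ?thesis by blast
  next
    assume *: "e ` c = X r \<and> e ` b = X (r + 5)"
    have "adj (e ` a) (X (r + 5))" "e ` a \<noteq> X r" using adj_aut[OF ea ab(1)] neq[OF ea ab(3)] N * by simp_all
    then obtain y where y: "y \<in> R (r + 1)" "exp_root y ` (e ` a) = X (r + 4)" using neighbour_down[of "e ` a" "r + 1"] by auto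
    have "aut (exp_root y \<circ> e)" by (intro aut_comp aut_exp_root[OF y(1)] ea)
    moreover have "(exp_root y \<circ> e) ` a = X (r + 4)" "(exp_root y \<circ> e) ` b = X (r + 5)" "(exp_root y \<circ> e) ` c = X r"
      using * y exp_root_X_invariant(2)[OF y(1)] exp_root_X_fix_image(2)[OF y(1)] by (simp_all only: image_comp[symmetric] add_6)
    ultimately show ?thesis by blast
  qed
  then obtain f where f: "aut f" "f ` a = X (r + 1) \<and> f ` b = X r \<and> f ` c = X (r + 5)
      \<or> f ` a = X (r + 4) \<and> f ` b = X (r + 5) \<and> f ` c = X r" by metis
  have "\<exists>y \<in> R r. \<exists>z \<in> R r. exp_root y ` (f ` v) = exp_root z ` (f ` w)"
    using f(2)
  proof
    assume *: "f ` a = X (r + 1) \<and> f ` b = X r \<and> f ` c = X (r + 5)"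
    have "adj (f ` v) (X (r + 1))" "f ` v \<noteq> X r" "adj (f ` w) (X (r + 1))" "f ` w \<noteq> X r"
      using adj_aut[OF f(1) v(1)] neq[OF f(1) v(2)] adj_aut[OF f(1) w(1)] neq[OF f(1) w(2)] N * by simp_all
    then show ?thesis using neighbour_up[of "f ` v" r] neighbour_up[of "f ` w" r] by metis
  next
    assume *: "f ` a = X (r + 4) \<and> f ` b = X (r + 5) \<and> f ` c = X r"
    have "adj (f ` v) (X (r + 4))" "f ` v \<noteq> X (r + 5)" "adj (f ` w) (X (r + 4))" "f ` w \<noteq> X (r + 5)"
      using adj_aut[OF f(1) v(1)] neq[OF f(1) v(2)] adj_aut[OF f(1) w(1)] neq[OF f(1) w(2)] N * by simp_all
    then show ?thesis using neighbour_down[of "f ` v" r] neighbour_down[of "f ` w" r] by metis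
  qed
  then obtain y z where yz: "y \<in> R r" "z \<in> R r" "exp_root y ` (f ` v) = exp_root z ` (f ` w)" by metis
  have "f ` b = X r \<and> f ` c = X (r + 5) \<or> f ` c = X r \<and> f ` b = X (r + 5)" using f(2) by metis
  from root_elation[OF f(1) this N(2,4,5,7) yz] show ?thesis .
qed

lemma act_aut: assumes "aut h" shows "act h \<in> carrier (graph_aut_group ideal_graph)"
proof -
  have "bij_betw (act h) nonminimals nonminimals"
  proof (rule bij_betw_imageI)
    show "inj_on (act h) nonminimals" using aut_image_eq_iff[OF assms] nonminimals_D(4) by (auto simp: inj_on_def act_def)
    show "act h ` nonminimals = nonminimals"
    proof
      show "act h ` nonminimals \<subseteq> nonminimals" using aut_nonminimals[OF assms] by (auto simp: act_def)
      show "nonminimals \<subseteq> act h ` nonminimals"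
      proof
        fix N assume N: "N \<in> nonminimals"
        have "act h (inv_into K h ` N) = N"
          using aut_nonminimals[OF aut_inv[OF assms] N] aut_image_inv[OF assms nonminimals_D(4)[OF N]] by (simp add: act_def)
        then show "N \<in> act h ` nonminimals" using aut_nonminimals[OF aut_inv[OF assms] N] by (metis image_eqI)
      qed
    qed
  qed
  then show ?thesis using adj_aut_iff[OF assms] by (simp add: graph_aut_group_def graph_iso_def act_def)
qed

text \<open>\<open>moufang_aut\<close> speaks of ideals; the bijection \<open>vertex_of\<close>
  transports its automorphism to the tagged vertices of the incidence graph.\<close>

lemma moufang_triangle: "moufang_gon 3 ideal_plane"
  unfolding moufang_gon_def
proof (intro conjI allI impI generalized_triangle)
  let ?G = "incidence_graph ideal_plane" and ?V = "gpoints ideal_plane <+> glines ideal_plane"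
  fix xs y z assume xs: "graph_path ?G xs \<and> length xs = Suc 3"
    and yz: "{xs ! 0, y} \<in> gedges ?G \<and> y \<noteq> xs ! 1 \<and> {xs ! 0, z} \<in> gedges ?G \<and> z \<noteq> xs ! 1"
  have V: "xs ! i \<in> ?V" if "i < 4" for i using xs that by (auto simp: graph_path_def ideal_plane_verts simp del: ideal_plane_simps)
  have E: "{xs ! i, xs ! Suc i} \<in> gedges ?G" if "i < 3" for i using xs that by (simp add: graph_path_def)
  have yzV: "y \<in> ?V" "z \<in> ?V" using yz ideal_plane_edge_verts by blast+
  have inj: "vertex_of p = vertex_of q \<longleftrightarrow> p = q" if "p \<in> ?V" "q \<in> ?V" for p q
    using vertex_of_bij that by (auto simp: bij_betw_def inj_on_def simp del: ideal_plane_simps)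
  have d: "xs ! 0 \<noteq> xs ! 2" using xs nth_eq_iff_index_eq[of xs 0 2] by (simp add: graph_path_def)
  have a: "adj (vertex_of (xs ! 0)) (vertex_of (xs ! 1))" "adj (vertex_of (xs ! 1)) (vertex_of (xs ! 2))"
    using E[of 0] E[of 1] V[of 0] V[of 1] V[of 2] by (simp_all add: ideal_plane_edge numeral_2_eq_2 del: ideal_plane_simps)
  have d: "vertex_of (xs ! 0) \<noteq> vertex_of (xs ! 2)" using inj[OF V V] d by simp
  have v: "adj (vertex_of y) (vertex_of (xs ! 0))" "adj (vertex_of z) (vertex_of (xs ! 0))"
    using yz ideal_plane_edge[OF V[of 0] yzV(1)] ideal_plane_edge[OF V[of 0] yzV(2)] adj_sym by simp_all
  have w: "vertex_of y \<noteq> vertex_of (xs ! 1)" "vertex_of z \<noteq> vertex_of (xs ! 1)"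
    using yz inj[OF yzV(1) V[of 1]] inj[OF yzV(2) V[of 1]] by simp_all
  obtain h where hh: "aut h \<and> (\<forall>u. u = vertex_of (xs ! 1) \<or> adj u (vertex_of (xs ! 1)) \<or> u = vertex_of (xs ! 2) \<or> adj u (vertex_of (xs ! 2))
      \<longrightarrow> h ` u = u) \<and> h ` vertex_of y = vertex_of z"
    using moufang_aut[OF a d v(1) w(1) v(2) w(2)] by (rule exE)
  have h: "aut h" "h ` vertex_of y = vertex_of z"
    by (rule conjunct1[OF hh], rule conjunct2[OF conjunct2[OF hh]])
  have hfix: "h ` u = u" if "u = vertex_of (xs ! 1) \<or> adj u (vertex_of (xs ! 1)) \<or> u = vertex_of (xs ! 2) \<or> adj u (vertex_of (xs ! 2))" for u
    by (rule conjunct1[OF conjunct2[OF hh], THEN spec, THEN mp, OF that])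
  let ?inv = "inv_into ?V vertex_of"
  define g where "g = (\<lambda>x \<in> ?V. ?inv (h ` vertex_of x))"
  have iV: "?inv N \<in> ?V" "vertex_of (?inv N) = N" if "N \<in> nonminimals" for N
    using vertex_of_bij that by (metis bij_betw_imp_surj_on inv_into_into, metis bij_betw_inv_into_right)
  have ui: "?inv (vertex_of x) = x" if "x \<in> ?V" for x using vertex_of_bij that by (metis bij_betw_inv_into_left)
  have hN: "h ` vertex_of x \<in> nonminimals" if "x \<in> ?V" for x using aut_nonminimals[OF h(1) vertex_of_nonminimals[OF that]] .
  have ug: "vertex_of (g x) = h ` vertex_of x" "g x \<in> ?V" if "x \<in> ?V" for x using iV[OF hN[OF that]] that by (simp_all add: g_def)
  have "bij_betw g ?V ?V"
  proof (rule bij_betw_imageI)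
    show "inj_on g ?V"
    proof (rule inj_onI)
      fix p q assume "p \<in> ?V" "q \<in> ?V" "g p = g q"
      then have "h ` vertex_of p = h ` vertex_of q" using ug by metis
      then have "vertex_of p = vertex_of q" using aut_image_eq_iff[OF h(1)] nonminimals_D(4) vertex_of_nonminimals \<open>p \<in> ?V\<close> \<open>q \<in> ?V\<close> by metis
      then show "p = q" using inj \<open>p \<in> ?V\<close> \<open>q \<in> ?V\<close> by blast
    qed
    show "g ` ?V = ?V"
    proof
      show "g ` ?V \<subseteq> ?V" using ug(2) by blast
      show "?V \<subseteq> g ` ?V"
      proof
        fix x assume x: "x \<in> ?V"
        let ?N = "inv_into K h ` vertex_of x"
        have N: "?N \<in> nonminimals" using aut_nonminimals[OF aut_inv[OF h(1)] vertex_of_nonminimals[OF x]] .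
        have "vertex_of (g (?inv ?N)) = vertex_of x"
          using ug(1)[OF iV(1)[OF N]] iV(2)[OF N] aut_image_inv[OF h(1) nonminimals_D(4)[OF vertex_of_nonminimals[OF x]]] by simp
        then have "g (?inv ?N) = x" by (rule iffD1[OF inj[OF ug(2)[OF iV(1)[OF N]] x]])
        then show "x \<in> g ` ?V" by (rule image_eqI[OF sym iV(1)[OF N]])
      qed
    qed
  qed
  moreover have "{g p, g q} \<in> gedges ?G \<longleftrightarrow> {p, q} \<in> gedges ?G" if "p \<in> ?V" "q \<in> ?V" for p q
    using that ug adj_aut_iff[OF h(1) vertex_of_nonminimals vertex_of_nonminimals] by (simp add: ideal_plane_edge del: ideal_plane_simps)
  ultimately have "g \<in> carrier (graph_aut_group ?G)"
    by (simp add: graph_aut_group_def graph_iso_def ideal_plane_verts g_def)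
  moreover have "g u = u" if i: "1 \<le> i \<and> Suc i < length xs" and u: "u \<in> gverts ?G" "u = xs ! i \<or> {u, xs ! i} \<in> gedges ?G" for i u
  proof -
    have i: "i = 1 \<or> i = 2" using i xs by auto
    then have iV': "xs ! i \<in> ?V" using V by auto
    have uV: "u \<in> ?V" using u by (simp add: ideal_plane_verts)
    have "vertex_of u = vertex_of (xs ! i) \<or> adj (vertex_of u) (vertex_of (xs ! i))"
      using u(2) ideal_plane_edge[OF uV iV'] by (elim disjE) simp_all
    then have "h ` vertex_of u = vertex_of u" using hfix i by metis
    then show ?thesis using uV ui by (simp add: g_def)
  qed
  ultimately have "g \<in> root_group ?G xs" unfolding root_group_def by blast
  moreover have "g y = z" using h(2) ui yzV by (simp add: g_def)
  ultimately show "\<exists>g \<in> root_group ?G xs. g y = z" by blast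
qed

text \<open>Given \<open>g\<close> in the root group, \<open>neighbour_up\<close> yields a
  \<open>y\<close> such that \<open>g\<close> followed by \<open>exp_root y\<close> fixes
  \<open>X (s + 2)\<close>. By \<open>elation_rigid\<close> this composite is the identity on
  vertices, so \<open>g\<close> is the action of \<open>exp_root (- y)\<close>.\<close>

lemma root_group_eq:
  "root_group ideal_graph [X (s + 1), X s, X (s + 5), X (s + 4)] = act ` {exp_root y | y. y \<in> R s}"
proof -
  have rg: "root_group ideal_graph [X (s + 1), X s, X (s + 5), X (s + 4)] = {g \<in> carrier (graph_aut_group ideal_graph).
      \<forall>N \<in> nonminimals. N = X s \<or> adj N (X s) \<or> N = X (s + 5) \<or> adj N (X (s + 5)) \<longrightarrow> g N = N}"
  proof -
    let ?xs = "[X (s + 1), X s, X (s + 5), X (s + 4)]"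
    have i: "(1 \<le> i \<and> Suc i < 4) = (i = 1 \<or> i = 2)" for i :: nat by auto
    have xs: "length ?xs = 4" "?xs ! 1 = X s" "?xs ! 2 = X (s + 5)" by simp_all
    have q: "(\<forall>i. i = 1 \<or> i = 2 \<longrightarrow> Q i) \<longleftrightarrow> Q 1 \<and> Q 2" for Q :: "nat \<Rightarrow> bool" by blast
    show ?thesis
      unfolding root_group_def xs(1) i q xs(2,3) ideal_graph_verts ideal_graph_edge
      by (rule Collect_cong) metis
  qed
  show ?thesis
  proof (intro equalityI subsetI)
    fix g assume "g \<in> act ` {exp_root y | y. y \<in> R s}"
    then obtain y where y: "y \<in> R s" "g = act (exp_root y)" by blast
    then show "g \<in> root_group ideal_graph [X (s + 1), X s, X (s + 5), X (s + 4)]"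
      unfolding rg
    proof (intro CollectI conjI ballI impI)
      show "g \<in> carrier (graph_aut_group ideal_graph)" unfolding y(2) by (rule act_aut[OF aut_exp_root[OF y(1)]])
      fix N assume "N \<in> nonminimals" "N = X s \<or> adj N (X s) \<or> N = X (s + 5) \<or> adj N (X (s + 5))"
      then show "g N = N" using exp_root_fix[OF y(1)] by (simp only: y(2) act_def restrict_apply if_True)
    qed
  next
    fix g assume "g \<in> root_group ideal_graph [X (s + 1), X s, X (s + 5), X (s + 4)]"
    then have g: "g \<in> carrier (graph_aut_group ideal_graph)" 
      and fixN: "\<And>N. N = X s \<or> adj N (X s) \<or> N = X (s + 5) \<or> adj N (X (s + 5)) \<Longrightarrow> g N = N"
      unfolding rg using X_nonminimals adj_nonminimals by auto
    have gn: "g \<in> extensional nonminimals" "bij_betw g nonminimals nonminimals"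
      "\<And>a b. a \<in> nonminimals \<Longrightarrow> b \<in> nonminimals \<Longrightarrow> adj (g a) (g b) \<longleftrightarrow> adj a b"
      using g by (auto simp: graph_aut_group_def graph_iso_def)
    have a: "adj (X (s + 2)) (X (s + 1))" "adj (X (s + 1)) (X s)" "adj (X s) (X (s + 5))"
      using adj_X[of "s + 2"] adj_X[of "s + 1"] adj_X[of s] by simp_all
    have ne: "X (s + 2) \<noteq> X s" "X (s + 1) \<noteq> X (s + 5)" using X_inj[of "s + 2" s] X_inj[of "s + 1" "s + 5"] by auto
    have g1: "g (X (s + 1)) = X (s + 1)" using fixN a by blast
    then have "adj (g (X (s + 2))) (X (s + 1))" using gn(3)[of "X (s + 2)" "X (s + 1)"] a X_nonminimals by simp
    moreover have "g (X (s + 2)) \<noteq> X s"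
      using gn(2) ne(1) fixN[of "X s"] X_nonminimals unfolding bij_betw_def inj_on_def by metis
    ultimately obtain y where y: "y \<in> R s" "exp_root y ` (g (X (s + 2))) = X (s + 2)" using neighbour_up by blast
    have gN: "g N \<in> nonminimals" if "N \<in> nonminimals" for N using gn(2) that by (rule bij_betw_apply)
    have E: "aut (exp_root y)" by (rule aut_exp_root[OF y(1)])
    have ny: "- y \<in> R s" using y by (intro R_closed)
    have rigid: "exp_root y ` (g N) = N" if N: "N \<in> nonminimals" for N
    proof (rule elation_rigid[where g = "\<lambda>N. exp_root y ` (g N)" and v = "X s" and w = "X (s + 5)" and x = "X (s + 1)" and y = "X (s + 2)"])
      show "adj (exp_root y ` g a) (exp_root y ` g b)" if "a \<in> nonminimals" "b \<in> nonminimals" "adj a b" for a b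
        using adj_aut[OF E] gn(3) that by blast
      show "exp_root y ` g a = a" if "adj a (X s)" for a using fixN[of a] exp_root_fix[OF y(1), of a] that by simp
      show "exp_root y ` g a = a" if "adj a (X (s + 5))" for a using fixN[of a] exp_root_fix[OF y(1), of a] that by simp
    qed (use a ne y N in auto)
    have "g = act (exp_root (- y))"
    proof
      fix N show "g N = act (exp_root (- y)) N"
      proof (cases "N \<in> nonminimals")
        case True
        then show ?thesis using rigid[OF True] exp_root_image_neg[OF y(1) nonminimals_D(4)[OF gN[OF True]]] by (simp add: act_def)
      next
        case False
        then show ?thesis using gn(1) by (simp add: act_def extensional_def)
      qed
    qed
    then show "g \<in> act ` {exp_root y | y. y \<in> R s}" using ny by blast
  qed
qed

section \<open>The thin hexagon\<close>

lemma minimals_edge: assumes "M \<in> minimals" obtains I J where "adj I J" "I \<inter> J = M"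
proof -
  obtain e r where e: "e \<in> U 0" "e ` M = R r" using minimals_normal_form[OF assms, of 0] by blast
  have h: "aut (inv_into K e)" using aut_inv[OF U_aut[OF e(1)]] .
  have XK: "X j \<subseteq> K" for j using nonminimals_D(4)[OF X_nonminimals] .
  have "inv_into K e ` X r \<inter> inv_into K e ` X (r + 5) = M"
    using aut_image_Int[OF h XK XK, of r "r + 5"] X_Int_X[of r] aut_inv_image[OF U_aut[OF e(1)] minimals_D(4)[OF assms]] e by simp
  then show thesis using that[OF aut_adj_X(3)[OF h]] by blast
qed

lemma minimals_subset_eq: assumes "M \<in> minimals" "N \<in> minimals" "M \<subseteq> N" shows "M = N"
  using assms by (auto simp: minimals_def minimal_def)

lemma thin_hexagon: "thin ideal_geometry"
  unfolding thin_def
proof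
  fix M assume "M \<in> gpoints ideal_geometry"
  then have M: "M \<in> minimals" by (simp add: ideal_geometry_def)
  obtain I J where IJ: "adj I J" "I \<inter> J = M" using minimals_edge[OF M] .
  have "{l \<in> glines ideal_geometry. ginc ideal_geometry M l} = {I, J}"
    using adj_third[OF IJ(1)] adj_nonminimals[OF IJ(1)] IJ(2) by (auto simp: ideal_geometry_def)
  moreover have "I \<noteq> J" using IJ by (simp add: adj_def)
  ultimately show "card {l \<in> glines ideal_geometry. ginc ideal_geometry M l} = 2" by simp
qed

lemma adj_if_minimals: assumes "M \<in> minimals" "I \<in> nonminimals" "J \<in> nonminimals" "M \<subseteq> I" "M \<subseteq> J" "I \<noteq> J" 
  shows "adj I J" "I \<inter> J = M"
proof -
  have "0 \<in> M" using subspace_0[OF inner_subspace[OF minimals_D(1)[OF assms(1)]]] .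
  then have "\<exists>x \<in> M. x \<noteq> 0" using minimals_D(2)[OF assms(1)] by blast
  then have "I \<inter> J \<noteq> {0}" using assms by blast
  then show a: "adj I J" using assms by (simp add: adj_def)
  show "I \<inter> J = M" using minimals_subset_eq[OF assms(1) adj_minimals[OF a]] assms by blast
qed

text \<open>Consecutive lines of an ordinary polygon are adjacent vertices, so a polygon with
  \<open>m\<close> sides gives a closed path of length \<open>m\<close> in the graph. Lengths 3 and
  5 contradict the bipartition, length 4 is \<open>no_quadrangle\<close>, and for
  \<open>m = 2\<close> two lines would share two minimal ideals.\<close>

lemma generalized_hexagon: "generalized_gon 6 ideal_geometry"
  unfolding generalized_gon_def
proof (intro conjI allI impI ballI)
  show pls: "partial_linear_space ideal_geometry"
    unfolding partial_linear_space_def using adj_if_minimals(2) by (simp add: ideal_geometry_def) metis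
  fix m :: nat assume m: "m < 6"
  show "\<not> (\<exists>ps ls. ordinary_gon ideal_geometry m ps ls)"
  proof
    assume "\<exists>ps ls. ordinary_gon ideal_geometry m ps ls"
    then obtain ps ls where o: "ordinary_gon ideal_geometry m ps ls" by blast
    then have m2: "2 \<le> m" and len: "length ps = m" "length ls = m" and dist: "distinct ps" "distinct ls"
      and pn: "\<And>i. i < m \<Longrightarrow> ps ! i \<in> minimals" and ln: "\<And>i. i < m \<Longrightarrow> ls ! i \<in> nonminimals"
      and inc: "\<And>i. i < m \<Longrightarrow> ps ! i \<subseteq> ls ! i \<and> ps ! (Suc i mod m) \<subseteq> ls ! i"
      by (auto simp: ordinary_gon_def ideal_geometry_def)
    have adjl: "adj (ls ! i) (ls ! (Suc i mod m))" if i: "i < m" for i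
    proof -
      have j: "Suc i mod m < m" using m2 by simp
      have "Suc i mod m \<noteq> i" using m2 i by (cases "Suc i = m") auto
      then have "ls ! i \<noteq> ls ! (Suc i mod m)" using dist len i j nth_eq_iff_index_eq by metis
      then show ?thesis using adj_if_minimals(1)[OF pn[OF j] ln[OF i] ln[OF j]] inc[OF i] inc[OF j] by blast
    qed
    have step: "adj (ls ! i) (ls ! j)" if "i < m" "Suc i mod m = j" for i j
      using adjl[OF that(1)] unfolding that(2) .
    consider "m = 2" | "m = 3" | "m = 4" | "m = 5" using m m2 by linarith
    then show False
    proof cases
      case 1
      have d: "ls ! 0 \<noteq> ls ! 1" "ps ! 0 \<noteq> ps ! 1" using dist len 1 by (simp_all add: nth_eq_iff_index_eq)
      have i: "ps ! 0 \<subseteq> ls ! 0" "ps ! 1 \<subseteq> ls ! 0" "ps ! 1 \<subseteq> ls ! 1" "ps ! 0 \<subseteq> ls ! 1"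
        using inc[of 0] inc[of 1] 1 by simp_all
      have m: "0 < m" "1 < m" using 1 by simp_all
      have e0: "ls ! 0 \<inter> ls ! 1 = ps ! 0" by (rule adj_if_minimals(2)[OF pn[OF m(1)] ln[OF m(1)] ln[OF m(2)] i(1,4) d(1)])
      have e1: "ls ! 0 \<inter> ls ! 1 = ps ! 1" by (rule adj_if_minimals(2)[OF pn[OF m(2)] ln[OF m(1)] ln[OF m(2)] i(2,3) d(1)])
      show False by (rule notE[OF d(2) trans[OF sym[OF e0] e1]])
    next
      case 2
      have a: "adj (ls ! 0) (ls ! 1)" "adj (ls ! 1) (ls ! 2)" "adj (ls ! 2) (ls ! 0)"
        by (rule step; simp add: 2)+
      show False using a[THEN adj_is_point] by argo
    next
      case 3
      have d: "ls ! 0 \<noteq> ls ! 2" "ls ! 1 \<noteq> ls ! 3" using dist len 3 by (simp_all add: nth_eq_iff_index_eq)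
      have a: "adj (ls ! 0) (ls ! 1)" "adj (ls ! 1) (ls ! 2)" "adj (ls ! 2) (ls ! 3)" "adj (ls ! 3) (ls ! 0)"
        by (rule step; simp add: 3)+
      show False by (rule notE[OF d(2) no_quadrangle[OF a d(1)]])
    next
      case 4
      have a: "adj (ls ! 0) (ls ! 1)" "adj (ls ! 1) (ls ! 2)" "adj (ls ! 2) (ls ! 3)" "adj (ls ! 3) (ls ! 4)" "adj (ls ! 4) (ls ! 0)"
        by (rule step; simp add: 4)+
      show False using a[THEN adj_is_point] by argo
    qed
  qed
next
  fix x y assume x: "x \<in> gpoints ideal_geometry <+> glines ideal_geometry" and y: "y \<in> gpoints ideal_geometry <+> glines ideal_geometry"
  have K: "vertex_of x \<in> minimals \<union> nonminimals" "vertex_of y \<in> minimals \<union> nonminimals" using x y by (auto simp: ideal_geometry_def)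
  from common_apartment[OF this] obtain g r s where g: "aut g" "vertex_of x = g ` R r \<or> vertex_of x = g ` X r" "vertex_of y = g ` R s \<or> vertex_of y = g ` X s"
    by metis
  let ?is = "[0, 1, 2, 3, 4, 5] :: 6 list"
  let ?ps = "map (\<lambda>i. g ` R i) ?is" and ?ls = "map (\<lambda>i. g ` X i) ?is"
  have N: "g ` X j \<in> nonminimals" "g ` R j \<in> minimals" for j using aut_nonminimals[OF g(1) X_nonminimals] aut_minimals[OF g(1) R_minimals] .
  have neX: "g ` X i = g ` X j \<longleftrightarrow> i = j" for i j
    using aut_image_eq_iff[OF g(1), of "X i" "X j"] X_inj nonminimals_D(4)[OF X_nonminimals] by auto
  have Rinj: "i = j" if e: "R i = R j" for i j
  proof -
    obtain v where v: "v \<in> R i" "v \<noteq> 0" by (rule R_nonzero)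
    then show ?thesis using R_D(3)[of v i i] R_D(3)[of v j i] e by (metis (full_types))
  qed
  have neR: "g ` R i = g ` R j \<longleftrightarrow> i = j" for i j
    using aut_image_eq_iff[OF g(1), of "R i" "R j"] Rinj minimals_D(4)[OF R_minimals] by auto
  have U: "UNIV = set ?is" using UNIV_6[of 0] by simp
  have mem: "z \<in> set ?ps <+> set ?ls" if z: "z \<in> gpoints ideal_geometry <+> glines ideal_geometry" "vertex_of z = g ` R j \<or> vertex_of z = g ` X j" for z j
  proof -
    have j: "j \<in> set ?is" using U by blast
    show ?thesis
    proof (cases z)
      case (Inl a)
      then have a: "a = g ` R j" using z N(1)[of j] minimals_nonminimals_disjoint[of a] by (auto simp: ideal_geometry_def)
      show ?thesis unfolding Inl a set_map by (rule InlI[OF imageI[OF j]])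
    next
      case (Inr a)
      then have a: "a = g ` X j" using z N(2)[of j] minimals_nonminimals_disjoint[of a] by (auto simp: ideal_geometry_def)
      show ?thesis unfolding Inr a set_map by (rule InrI[OF imageI[OF j]])
    qed
  qed
  have sub: "g ` R i \<subseteq> g ` X i" "g ` R (i + 1) \<subseteq> g ` X i" for i using R_subset_X image_mono by blast+
  have "ordinary_gon ideal_geometry 6 ?ps ?ls"
    unfolding ordinary_gon_def
  proof (intro conjI allI impI)
    show "distinct ?ps" "distinct ?ls" by (simp_all add: neR neX)
    show "set ?ps \<subseteq> gpoints ideal_geometry" "set ?ls \<subseteq> glines ideal_geometry" using N by (auto simp: ideal_geometry_def)
    fix i :: nat assume "i < 6"
    then have "i = 0 \<or> i = 1 \<or> i = 2 \<or> i = 3 \<or> i = 4 \<or> i = 5" by linarith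
    \<comment> \<open>Closes the cycle: in the type \<open>6\<close> the successor of the last index
      is 0.\<close>
    moreover have six: "(6 :: 6) = 0" by simp
    note sub2 = sub(2)[of 0] sub(2)[of 1] sub(2)[of 2] sub(2)[of 3] sub(2)[of 4] sub(2)[of 5]
    ultimately show "ginc ideal_geometry (?ps ! i) (?ls ! i)" "ginc ideal_geometry (?ps ! (Suc i mod 6)) (?ls ! i)"
      using sub2 by (elim disjE; simp add: ideal_geometry_def six sub(1) del: image_subset_iff)+
  qed simp_all
  then show "\<exists>ps ls. ordinary_gon ideal_geometry 6 ps ls \<and> x \<in> set ps <+> set ls \<and> y \<in> set ps <+> set ls"
    using mem[OF x g(2)] mem[OF y g(3)] by blast
qed simp

text \<open>A flag goes to its intersection, a minimal ideal; by \<open>adj_third\<close> no further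
  vertex contains that ideal, so the flag can be recovered from it.\<close>

lemma dual_double_iso: "geometry_iso (\<lambda>(p, l). p \<inter> l) vertex_of (dual_double ideal_plane) ideal_geometry"
proof -
  have flag: "(p, l) \<in> gpoints (dual_double ideal_plane) \<longleftrightarrow> is_point p \<and> \<not> is_point l \<and> adj p l" for p l
    using ideal_plane_inc[of p l] adj_nonminimals by (auto simp: dual_double_def)
  have lines: "glines (dual_double ideal_plane) = gpoints ideal_plane <+> glines ideal_plane" by (simp add: dual_double_def)
  have third: "p' = p \<and> l' = l" if "is_point p" "\<not> is_point l" "adj p l" "is_point p'" "\<not> is_point l'" "adj p' l'" "p \<inter> l = p' \<inter> l'" for p l p' l'
    using adj_third[OF that(3) adj_nonminimals(1)[OF that(6)]] adj_third[OF that(3) adj_nonminimals(2)[OF that(6)]] that by blast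
  have "bij_betw (\<lambda>(p, l). p \<inter> l) (gpoints (dual_double ideal_plane)) minimals"
  proof (rule bij_betw_imageI)
    show "inj_on (\<lambda>(p, l). p \<inter> l) (gpoints (dual_double ideal_plane))"
    proof (rule inj_onI, clarify)
      fix p l p' l' assume "(p, l) \<in> gpoints (dual_double ideal_plane)" "(p', l') \<in> gpoints (dual_double ideal_plane)" "p \<inter> l = p' \<inter> l'"
      then show "p = p' \<and> l = l'" using third unfolding flag by metis
    qed
    show "(\<lambda>(p, l). p \<inter> l) ` gpoints (dual_double ideal_plane) = minimals"
    proof (intro equalityI subsetI)
      fix M assume "M \<in> minimals"
      then obtain I J where IJ: "adj I J" "I \<inter> J = M" using minimals_edge by blast
      then have "(I, J) \<in> gpoints (dual_double ideal_plane) \<or> (J, I) \<in> gpoints (dual_double ideal_plane)"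
        unfolding flag using adj_is_point adj_sym by blast
      then show "M \<in> (\<lambda>(p, l). p \<inter> l) ` gpoints (dual_double ideal_plane)"
      proof
        assume "(I, J) \<in> gpoints (dual_double ideal_plane)"
        from imageI[OF this, of "\<lambda>(p, l). p \<inter> l"] show ?thesis by (simp only: prod.case IJ(2))
      next
        assume "(J, I) \<in> gpoints (dual_double ideal_plane)"
        from imageI[OF this, of "\<lambda>(p, l). p \<inter> l"] show ?thesis by (simp only: prod.case Int_commute[of J I] IJ(2))
      qed
    next
      fix M assume "M \<in> (\<lambda>(p, l). p \<inter> l) ` gpoints (dual_double ideal_plane)"
      then obtain f where f: "M = (\<lambda>(p, l). p \<inter> l) f" "f \<in> gpoints (dual_double ideal_plane)" by (rule imageE)
      obtain p l where pl: "f = (p, l)" by (cases f)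
      have "adj p l" using f(2) flag unfolding pl by simp
      then show "M \<in> minimals" using adj_minimals unfolding f(1) pl prod.case by simp
    qed
  qed
  moreover have "ginc ideal_geometry (case f of (p, l) \<Rightarrow> p \<inter> l) (vertex_of x) \<longleftrightarrow> ginc (dual_double ideal_plane) f x"
    if f: "f \<in> gpoints (dual_double ideal_plane)" and x: "x \<in> glines (dual_double ideal_plane)" for f x
  proof -
    obtain p l where pl: "f = (p, l)" by (cases f)
    have fl: "is_point p" "\<not> is_point l" "adj p l" using f flag unfolding pl by auto
    have xV: "x \<in> gpoints ideal_plane <+> glines ideal_plane" using x lines by simp
    have "p \<inter> l \<subseteq> vertex_of x \<longleftrightarrow> vertex_of x = p \<or> vertex_of x = l" using adj_third[OF fl(3) vertex_of_nonminimals[OF xV]] by blast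
    also have "\<dots> \<longleftrightarrow> x = Inl p \<or> x = Inr l" using xV fl by (cases x) auto
    finally show ?thesis by (simp add: pl ideal_geometry_def dual_double_def)
  qed
  ultimately show ?thesis unfolding geometry_iso_def using vertex_of_bij lines by (simp add: ideal_geometry_def)
qed

end

section \<open>The unipotent group of the negative part\<close>

context a2_graded_lie_algebra begin

section \<open>Exponentials of the negative part\<close>

definition exp_ad :: "'l \<Rightarrow> 'l \<Rightarrow> 'l" where
  "exp_ad n x = (\<Sum>i\<le>4. sc (inverse (of_nat (fact i))) ((br n ^^ i) x))"

text \<open>The nilpotent subalgebra formed by the root spaces \<open>b + 5\<close>,
  \<open>b\<close> and \<open>b + 1\<close>. Its brackets end in \<open>R b\<close>, which is
  central in it, as in a Heisenberg algebra.\<close>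

definition neg_part :: "6 \<Rightarrow> 'l set" where
  "neg_part b = {x \<in> K. pz x = 0 \<and> pr (b + 2) x = 0 \<and> pr (b + 3) x = 0 \<and> pr (b + 4) x = 0}"

lemma neg_part_D: assumes "x \<in> neg_part b" shows "x \<in> K" "pz x = 0" "pr (b + 2) x = 0" "pr (b + 3) x = 0" "pr (b + 4) x = 0"
  using assms by (auto simp: neg_part_def)

lemma subspace_neg_part: "subspace (neg_part b)"
  by (auto simp: subspace_def neg_part_def pr_linear)

lemma R_subset_neg_part: "y \<in> R b \<or> y \<in> R (b + 1) \<or> y \<in> R (b + 5) \<Longrightarrow> y \<in> neg_part b"
  by (auto simp: neg_part_def R_D)

lemma neg_part_decomp: assumes "x \<in> neg_part b" shows "x = pr b x + pr (b + 1) x + pr (b + 5) x"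
  using decomp_at[of x b] neg_part_D[OF assms] by simp

lemma neg_part_br: assumes m: "m \<in> neg_part b" and n: "n \<in> neg_part b" shows "br m n \<in> R b"
proof (rule R_I)
  fix j assume "j \<noteq> b" then show "pr j (br m n) = 0"
    by (cases j b rule: cases_6) (simp_all add: pr_br pz_br_at[of _ _ b] neg_part_D[OF m] neg_part_D[OF n])
qed (simp_all add: pz_br_at[of _ _ b] neg_part_D[OF m] neg_part_D[OF n])

lemma R_br_neg_part: assumes y: "y \<in> R b" and n: "n \<in> neg_part b" shows "br y n = 0" "br n y = 0"
proof -
  show "br y n = 0"
  proof (rule zero_if)
    fix j show "pr j (br y n) = 0"
      by (cases j b rule: cases_6) (simp_all add: pr_br pz_br_at[of _ _ b] R_D[OF y] neg_part_D[OF n])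
  qed (simp_all add: pz_br_at[of _ _ b] R_D[OF y] neg_part_D[OF n])
  then show "br n y = 0" using br_anti[of y n] R_K[OF y] neg_part_D(1)[OF n] by simp
qed

text \<open>The filtration of the 5-grading given by the root \<open>b\<close>, with the highest part first.\<close>

definition filt5 :: "6 \<Rightarrow> nat \<Rightarrow> 'l set" where
  "filt5 b k = {x \<in> K. (1 \<le> k \<longrightarrow> pr (b + 3) x = 0) \<and> (2 \<le> k \<longrightarrow> pr (b + 2) x = 0 \<and> pr (b + 4) x = 0)
    \<and> (3 \<le> k \<longrightarrow> pz x = 0) \<and> (4 \<le> k \<longrightarrow> pr (b + 1) x = 0 \<and> pr (b + 5) x = 0) \<and> (5 \<le> k \<longrightarrow> pr b x = 0)}"

lemma filt5_K: "x \<in> filt5 b k \<Longrightarrow> x \<in> K" and K_filt5: "x \<in> K \<Longrightarrow> x \<in> filt5 b 0"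
  by (auto simp: filt5_def)

lemma filt5_0: assumes "x \<in> filt5 b k" "5 \<le> k" shows "x = 0"
  using decomp_at[of x b] assms by (auto simp: filt5_def)

lemma neg_part_filt5: assumes n: "n \<in> neg_part b" and x: "x \<in> filt5 b k" shows "br n x \<in> filt5 b (Suc k)"
  using x unfolding filt5_def
  by (auto simp: pr_br pz_br_at[of _ _ b] neg_part_D[OF n])

lemma R_filt5: assumes n: "n \<in> R b" and x: "x \<in> filt5 b k" shows "br n x \<in> filt5 b (k + 2)"
  using x unfolding filt5_def
  by (auto simp: pr_br pz_br_at[of _ _ b] R_D[OF n])

lemma funpow_K: "n \<in> K \<Longrightarrow> x \<in> K \<Longrightarrow> (br n ^^ i) x \<in> K"
  by (induction i) auto

lemma exp_ad_K: "n \<in> K \<Longrightarrow> x \<in> K \<Longrightarrow> exp_ad n x \<in> K"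
  unfolding exp_ad_def by (intro K_sum K_scale funpow_K)

lemma exp_ad_expand: "exp_ad n x = x + br n x + sc (1/2) (br n (br n x)) + sc (1/6) (br n (br n (br n x)))
    + sc (1/24) (br n (br n (br n (br n x))))"
proof -
  have "{..4::nat} = {0, 1, 2, 3, 4}" by auto
  moreover have "fact 4 = (24::nat)" "fact 3 = (6::nat)" "fact 2 = (2::nat)" by (simp_all add: fact_numeral)
  ultimately show ?thesis
    by (simp add: exp_ad_def eval_nat_numeral(2,3) inverse_eq_divide add.assoc[where 'a='l])
qed

lemma exp_ad_R: assumes "y \<in> R j" "x \<in> K" shows "exp_ad y x = exp_root y x"
  using ad_cube[OF assms] R_K[OF assms(1)] by (simp add: exp_ad_expand exp_root_def)

text \<open>The commutator of \<open>ad m\<close> and \<open>ad n\<close> is \<open>2 ad z\<close>,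
  and \<open>ad z\<close> commutes with both, so words in \<open>p\<close>, \<open>q\<close>,
  \<open>w\<close> can be sorted into the form \<open>p^a q^c w^d\<close>. With weight 2 for
  \<open>w\<close>, words of weight 5 or more vanish. Both sides become combinations of the sorted
  words \<open>W a c d\<close> and are compared coefficient by coefficient.\<close>

theorem baker_campbell_hausdorff:
  assumes m: "m \<in> neg_part b" and n: "n \<in> neg_part b" and x: "x \<in> K"
  shows "exp_ad m (exp_ad n x) = exp_ad (m + n + sc (1/2) (br m n)) x"
proof -
  define z where "z = sc (1/2) (br m n)"
  define p where "p = br m" define q where "q = br n" define w where "w = br z"
  have z: "z \<in> R b" unfolding z_def by (intro R_closed neg_part_br m n)
  have K [simp]: "m \<in> K" "n \<in> K" "z \<in> K" using m n z neg_part_D R_K by auto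
  have pK [simp]: "v \<in> K \<Longrightarrow> p v \<in> K" and qK [simp]: "v \<in> K \<Longrightarrow> q v \<in> K" and wK [simp]: "v \<in> K \<Longrightarrow> w v \<in> K" for v
    by (simp_all add: p_def q_def w_def)
  have lin: "v \<in> K \<Longrightarrow> v' \<in> K \<Longrightarrow> f (v + v') = f v + f v'" "v \<in> K \<Longrightarrow> f (sc c v) = sc c (f v)"
      "v \<in> K \<Longrightarrow> v' \<in> K \<Longrightarrow> f (v - v') = f v - f v'" "v \<in> K \<Longrightarrow> f (- v) = - f v"
    if "f \<in> {p, q, w}" for f v v' c
    using that by (auto simp: p_def q_def w_def br_linear)
  have half: "sc 2 z = br m n" by (simp add: z_def)
  have qp: "q (p v) = p (q v) - sc 2 (w v)" if "v \<in> K" for v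
    using jacobi[of m n v] that half br_scale_left[of z v 2] by (simp add: p_def q_def w_def)
  have wp: "w (p v) = p (w v)" and wq: "w (q v) = q (w v)" if "v \<in> K" for v
    using jacobi[of z m v] jacobi[of z n v] R_br_neg_part[OF z m] R_br_neg_part[OF z n] that by (simp_all add: p_def q_def w_def)
  define W where "W a c d = (p ^^ a) ((q ^^ c) ((w ^^ d) x))" for a c d
  have FdW: "W a c d \<in> filt5 b (a + c + 2 * d)" for a c d
  proof -
    have 1: "(w ^^ d) x \<in> filt5 b (2 * d)"
      by (induction d) (use R_filt5[OF z] K_filt5 x in \<open>auto simp: w_def\<close>)
    have 2: "(q ^^ c) ((w ^^ d) x) \<in> filt5 b (c + 2 * d)"
      by (induction c) (use neg_part_filt5[OF n] 1 in \<open>auto simp: q_def\<close>)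
    show ?thesis unfolding W_def
      by (induction a) (use neg_part_filt5[OF m] 2 in \<open>auto simp: p_def\<close>)
  qed
  have WK [simp]: "W a c d \<in> K" for a c d using FdW filt5_K by blast
  have W0: "W a c d = 0" if "5 \<le> a + c + 2 * d" for a c d using filt5_0[OF FdW that] .
  have pW: "p (W a c d) = W (Suc a) c d" for a c d by (simp add: W_def)
  have wpow: "w ((p ^^ a) v) = (p ^^ a) (w v)" "(p ^^ a) v \<in> K" if "v \<in> K" for a v
    using that by (induction a) (auto simp: wp)
  have wqpow: "w ((q ^^ a) v) = (q ^^ a) (w v)" "(q ^^ a) v \<in> K" if "v \<in> K" for a v
    using that by (induction a) (auto simp: wq)
  have wdK: "(w ^^ d) x \<in> K" for d using x by (induction d) auto
  have wW: "w (W a c d) = W a c (Suc d)" for a c d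
    unfolding W_def by (simp add: wpow wqpow wdK)
  have qW0: "q (W 0 c d) = W 0 (Suc c) d" for c d by (simp add: W_def)
  have qW: "q (W (Suc a) c d) = p (q (W a c d)) - sc 2 (W a c (Suc d))" for a c d
    using qp[OF WK, of a c d] by (simp add: pW wW)
  have qW1: "q (W (Suc 0) c d) = W (Suc 0) (Suc c) d - sc 2 (W 0 c (Suc d))" for c d
    by (simp add: qW qW0 pW)
  have qW2: "q (W (Suc (Suc 0)) c d) = W (Suc (Suc 0)) (Suc c) d - sc 2 (W (Suc 0) c (Suc d)) - sc 2 (W (Suc 0) c (Suc d))" for c d
    by (simp add: qW[of "Suc 0"] qW1 pW lin)
  have qW3: "q (W (Suc (Suc (Suc 0))) c d) = W (Suc (Suc (Suc 0))) (Suc c) d - sc 2 (W (Suc (Suc 0)) c (Suc d))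
      - sc 2 (W (Suc (Suc 0)) c (Suc d)) - sc 2 (W (Suc (Suc 0)) c (Suc d))" for c d
    by (simp add: qW[of "Suc (Suc 0)"] qW2 pW lin)
  define s where "s = br (m + n + z)"
  have s: "s v = p v + q v + w v" if "v \<in> K" for v using that by (simp add: s_def p_def q_def w_def br_linear)
  have two: "sc 2 v = v + v" for v using scale_left_distrib[of 1 1 v] by simp
  have three: "sc 3 v = v + v + v" for v using scale_left_distrib[of 2 1 v] by (simp add: two)
  have four: "sc 4 v = v + v + v + v" for v using scale_left_distrib[of 3 1 v] by (simp add: three)
  have six: "sc 6 v = sc 3 v + sc 3 v" for v using scale_left_distrib[of 3 3 v] by simp
  have twelve: "sc 12 v = sc 6 v + sc 6 v" for v using scale_left_distrib[of 6 6 v] by simp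
  have t24: "sc 24 v = sc 12 v + sc 12 v" for v using scale_left_distrib[of 12 12 v] by simp
  note sums = two three four six twelve t24
  note alg = add.assoc[where 'a='l] add.commute[where 'a='l] add.left_commute[where 'a='l] diff_eq_eq[where 'a='l]
    eq_diff_eq[where 'a='l] diff_diff_eq[where 'a='l] diff_diff_eq2[where 'a='l] add_diff_eq[where 'a='l] diff_add_eq[where 'a='l]
  let ?o = "Suc 0" let ?t = "Suc (Suc 0)" let ?h = "Suc (Suc (Suc 0))" let ?f = "Suc (Suc (Suc (Suc 0)))"
  have x0: "x = W 0 0 0" by (simp add: W_def)
  have S1: "s x = W ?o 0 0 + W 0 ?o 0 + W 0 0 ?o"
    using s[OF x] by (simp add: x0 pW qW0 wW)
  have S2: "s (s x) = W ?t 0 0 + sc 2 (W ?o ?o 0) + W 0 ?t 0 - sc 2 (W 0 0 ?o)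
      + sc 2 (W ?o 0 ?o) + sc 2 (W 0 ?o ?o) + W 0 0 ?t"
    unfolding S1 by (simp add: s lin pW qW0 qW1 wW) (simp add: sums alg)
  have S3: "s (s (s x)) = W ?h 0 0 + sc 3 (W ?t ?o 0) + sc 3 (W ?o ?t 0) + W 0 ?h 0
      - sc 6 (W ?o 0 ?o) - sc 6 (W 0 ?o ?o)
      + sc 3 (W ?t 0 ?o) + sc 6 (W ?o ?o ?o) + sc 3 (W 0 ?t ?o) - sc 3 (W 0 0 ?t) - sc 3 (W 0 0 ?t)"
    unfolding S2 by (simp add: s lin pW qW0 qW1 qW2 wW W0) (simp add: sums alg)
  have S4: "s (s (s (s x))) = W ?f 0 0 + sc 4 (W ?h ?o 0) + sc 6 (W ?t ?t 0) + sc 4 (W ?o ?h 0) + W 0 ?f 0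
      - sc 12 (W ?t 0 ?o) - sc 24 (W ?o ?o ?o) - sc 12 (W 0 ?t ?o) + sc 12 (W 0 0 ?t)"
    unfolding S3 by (simp add: s lin pW qW0 qW1 qW2 qW3 wW W0) (simp add: sums alg)
  \<comment> \<open>Both sides are written as 1/24 times a combination with integer coefficients, 24
    being the common denominator of the exponential series up to degree 4.\<close>
  define h where "h = inverse (24 :: 'k)"
  have n6: "(6::'k) \<noteq> 0" using two_nonzero three_nonzero mult_eq_0_iff[of "2::'k" 3] by simp
  have n24: "(24::'k) \<noteq> 0" using n6 four_nonzero mult_eq_0_iff[of "6::'k" 4] by simp
  have h: "1 / 2 = h * 12" "1 / 6 = h * 4" "1 / 24 = h" "1 = h * 24"
    using n6 n24 by (simp_all add: h_def field_simps)
  have hh: "sc (1/2) v = sc h (sc 12 v)" "sc (1/6) v = sc h (sc 4 v)" "sc (1/24) v = sc h v" for v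
    by (simp_all only: h(1-3) scale_scale)
  \<comment> \<open>The product of the two quadratic terms carries 1/4, that is 6/24.\<close>
  have h4: "sc (1/2) (sc (1/2) v) = sc h (sc 6 v)" for v
  proof -
    have "(1/2) * (1/2) = h * (6::'k)" using n6 n24 by (simp add: h_def field_simps)
    then show ?thesis by simp
  qed
  have h1: "v = sc h (sc 24 v)" for v using h(4) by simp
  have L1: "exp_ad n x = W 0 0 0 + W 0 ?o 0 + sc (1/2) (W 0 ?t 0) + sc (1/6) (W 0 ?h 0) + sc (1/24) (W 0 ?f 0)"
    unfolding exp_ad_expand q_def[symmetric] by (subst (1 2 3 4 5) x0) (simp only: qW0)
  have LHS: "exp_ad m (exp_ad n x) = (W 0 0 0 + W 0 ?o 0 + sc (1/2) (W 0 ?t 0) + sc (1/6) (W 0 ?h 0) + sc (1/24) (W 0 ?f 0))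
     + (W ?o 0 0 + W ?o ?o 0 + sc (1/2) (W ?o ?t 0) + sc (1/6) (W ?o ?h 0))
     + (sc (1/2) (W ?t 0 0) + sc (1/2) (W ?t ?o 0) + sc (1/2) (sc (1/2) (W ?t ?t 0)))
     + (sc (1/6) (W ?h 0 0) + sc (1/6) (W ?h ?o 0)) + sc (1/24) (W ?f 0 0)"
    unfolding exp_ad_expand[of m] p_def[symmetric] L1
    by (simp add: lin pW W0 scale_right_distrib del: scale_scale)
  have R: "exp_ad (m + n + z) x = x + s x + sc (1/2) (s (s x)) + sc (1/6) (s (s (s x))) + sc (1/24) (s (s (s (s x))))"
    unfolding exp_ad_expand s_def ..
  have LHS': "exp_ad m (exp_ad n x) = sc h (sc 24 (W 0 0 0) + sc 24 (W 0 ?o 0) + sc 12 (W 0 ?t 0) + sc 4 (W 0 ?h 0) + W 0 ?f 0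
     + (sc 24 (W ?o 0 0) + sc 24 (W ?o ?o 0) + sc 12 (W ?o ?t 0) + sc 4 (W ?o ?h 0))
     + (sc 12 (W ?t 0 0) + sc 12 (W ?t ?o 0) + sc 6 (W ?t ?t 0))
     + (sc 4 (W ?h 0 0) + sc 4 (W ?h ?o 0)) + W ?f 0 0)"
    unfolding LHS h4 unfolding hh
    by (subst (1) h1[of "W 0 0 0"], subst (1) h1[of "W 0 ?o 0"], subst (1) h1[of "W ?o 0 0"], subst (1) h1[of "W ?o ?o 0"])
      (simp only: scale_right_distrib)
  have R': "exp_ad (m + n + z) x = sc h (sc 24 x + sc 24 (s x) + sc 12 (s (s x)) + sc 4 (s (s (s x))) + s (s (s (s x))))"
    unfolding R hh by (subst (1) h1[of x], subst (1) h1[of "s x"]) (simp only: scale_right_distrib)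
  have "sc 24 x + sc 24 (s x) + sc 12 (s (s x)) + sc 4 (s (s (s x))) + s (s (s (s x))) =
     sc 24 (W 0 0 0) + sc 24 (W 0 ?o 0) + sc 12 (W 0 ?t 0) + sc 4 (W 0 ?h 0) + W 0 ?f 0
     + (sc 24 (W ?o 0 0) + sc 24 (W ?o ?o 0) + sc 12 (W ?o ?t 0) + sc 4 (W ?o ?h 0))
     + (sc 12 (W ?t 0 0) + sc 12 (W ?t ?o 0) + sc 6 (W ?t ?t 0))
     + (sc 4 (W ?h 0 0) + sc 4 (W ?h ?o 0)) + W ?f 0 0"
    unfolding S4 unfolding S3 unfolding S2 unfolding S1 by (subst (1) x0) (simp add: scale_right_distrib scale_right_diff_distrib alg)
  then show ?thesis unfolding LHS' R'[unfolded z_def] z_def[symmetric] R' by simp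
qed

text \<open>Two applications of \<open>baker_campbell_hausdorff\<close>, with the part in
  \<open>R b\<close> corrected by half of the bracket of the other two parts. The factorisation
  shows that \<open>exp_ad n\<close> is an automorphism and a product of root exponentials.\<close>

lemma exp_ad_exp_root:
  assumes n: "n \<in> neg_part b" and x: "x \<in> K"
  shows "exp_ad n x = exp_root (pr (b + 5) n) (exp_root (pr (b + 1) n) (exp_root (pr b n - sc (1/2) (br (pr (b + 5) n) (pr (b + 1) n))) x))"
proof -
  let ?u = "pr (b + 5) n" and ?v = "pr (b + 1) n" let ?w = "sc (1/2) (br ?u ?v)"
  let ?z = "pr b n - ?w"
  have nK [simp]: "n \<in> K" using n neg_part_D by blast
  have u: "?u \<in> R (b + 5)" and v: "?v \<in> R (b + 1)" by simp_all
  have uv: "?u \<in> neg_part b" "?v \<in> neg_part b" using R_subset_neg_part u v by blast+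
  have w: "?w \<in> R b" by (intro R_closed neg_part_br uv)
  have z: "?z \<in> R b" by (intro R_closed w) simp
  have zN: "?z \<in> neg_part b" using R_subset_neg_part z by blast
  have vz: "?v + ?z \<in> neg_part b" by (intro subspace_add[OF subspace_neg_part] uv zN)
  have K: "?u \<in> K" "?v \<in> K" "?z \<in> K" "exp_root ?z x \<in> K" "exp_root ?v (exp_root ?z x) \<in> K" using z x R_K by auto
  have "exp_root ?u (exp_root ?v (exp_root ?z x)) = exp_ad ?u (exp_ad ?v (exp_ad ?z x))"
    using exp_ad_R[OF u] exp_ad_R[OF v] exp_ad_R[OF z] K x by simp
  also have "exp_ad ?v (exp_ad ?z x) = exp_ad (?v + ?z) x"
    using baker_campbell_hausdorff[OF uv(2) zN x] R_br_neg_part[OF z uv(2)] by simp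
  also have "exp_ad ?u (exp_ad (?v + ?z) x) = exp_ad (?u + (?v + ?z) + sc (1/2) (br ?u (?v + ?z))) x"
    by (rule baker_campbell_hausdorff[OF uv(1) vz x])
  also have "br ?u (?v + ?z) = br ?u ?v" using R_br_neg_part[OF z uv(1)] K by (simp add: br_add_right)
  also have "?u + (?v + ?z) + ?w = pr b n + ?v + ?u" by (simp add: algebra_simps)
  also have "\<dots> = n" using neg_part_decomp[OF n] by simp
  finally show ?thesis by simp
qed

section \<open>The action of the unipotent group on the graph\<close>

definition exp_neg :: "'l \<Rightarrow> 'l \<Rightarrow> 'l" where "exp_neg n = (\<lambda>x \<in> K. exp_ad n x)"

lemma act_cong: "(\<And>x. x \<in> K \<Longrightarrow> f x = g x) \<Longrightarrow> act f = act g"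
  unfolding act_def by (intro restrict_ext image_cong refl) (use nonminimals_D(4) in blast)

lemma act_compose: assumes g: "aut g" shows "act (compose K f g) = compose nonminimals (act f) (act g)"
proof
  fix N show "act (compose K f g) N = compose nonminimals (act f) (act g) N"
  proof (cases "N \<in> nonminimals")
    case True
    have "(\<lambda>x. compose K f g x) ` N = f ` (g ` N)"
      unfolding image_image by (rule image_cong[OF refl]) (use nonminimals_D(4)[OF True] in \<open>auto simp: compose_def\<close>)
    then show ?thesis using True aut_nonminimals[OF g True] by (simp add: act_def compose_def)
  qed (simp add: act_def compose_def)
qed

lemma aut_cong: assumes "aut f" "\<And>x. x \<in> K \<Longrightarrow> f x = g x" shows "aut g"
proof -
  have "bij_betw g K K" using autD(1)[OF assms(1)] bij_betw_cong[of K f g K] assms(2) by blast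
  then show ?thesis unfolding aut_def using autD[OF assms(1)] assms(2)
    by (metis K_add K_scale br_closed)
qed

lemma aut_exp_neg: assumes n: "n \<in> neg_part b" shows "aut (exp_neg n)"
proof -
  let ?u = "pr (b + 5) n" and ?v = "pr (b + 1) n" let ?z = "pr b n - sc (1/2) (br ?u ?v)"
  have nK [simp]: "n \<in> K" using n neg_part_D by blast
  have u: "?u \<in> R (b + 5)" and v: "?v \<in> R (b + 1)" by simp_all
  have z: "?z \<in> R b" by (intro R_closed neg_part_br R_subset_neg_part) (use u v in auto)
  have "aut (exp_root ?u \<circ> (exp_root ?v \<circ> exp_root ?z))" by (intro aut_comp aut_exp_root[OF u] aut_exp_root[OF v] aut_exp_root[OF z])
  then show ?thesis by (rule aut_cong) (simp add: exp_neg_def exp_ad_exp_root[OF n])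
qed

lemma exp_neg_compose: assumes "m \<in> neg_part b" "n \<in> neg_part b" shows "compose K (exp_neg m) (exp_neg n) = exp_neg (m + n + sc (1/2) (br m n))"
  using baker_campbell_hausdorff[OF assms] exp_ad_K[OF neg_part_D(1)[OF assms(2)]]
  by (auto simp: compose_def exp_neg_def fun_eq_iff)

lemma act_exp_neg_R: assumes "y \<in> R j" shows "act (exp_neg y) = act (exp_root y)"
  by (rule act_cong) (simp add: exp_neg_def exp_ad_R[OF assms])

lemma exp_neg_0: "exp_neg 0 = (\<lambda>x \<in> K. x)"
  by (auto simp: exp_neg_def fun_eq_iff exp_ad_expand)

lemma neg_part_add: "m \<in> neg_part b \<Longrightarrow> n \<in> neg_part b \<Longrightarrow> m + n + sc c (br m n) \<in> neg_part b"
  by (intro subspace_add[OF subspace_neg_part] subspace_scale[OF subspace_neg_part] R_subset_neg_part[OF disjI1[OF neg_part_br]])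

abbreviation G :: "('l set \<Rightarrow> 'l set) monoid" where "G \<equiv> graph_aut_group ideal_graph"

text \<open>Products in the automorphism group are read from left to right, so the factors enter the
  Baker-Campbell-Hausdorff formula in the opposite order.\<close>

lemma act_exp_neg_mult: assumes "m \<in> neg_part b" "n \<in> neg_part b"
  shows "act (exp_neg m) \<otimes>\<^bsub>G\<^esub> act (exp_neg n) = act (exp_neg (n + m + sc (1/2) (br n m)))"
  using act_compose[OF aut_exp_neg[OF assms(1)], of "exp_neg n"] exp_neg_compose[OF assms(2,1)]
  by (simp add: graph_aut_group_def)

lemma act_exp_neg_carrier: "n \<in> neg_part b \<Longrightarrow> act (exp_neg n) \<in> carrier G"
  by (intro act_aut aut_exp_neg)

lemma act_exp_neg_one: "act (exp_neg 0) = \<one>\<^bsub>G\<^esub>"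
proof -
  have "(\<lambda>x \<in> K. x) ` N = N" if "N \<in> nonminimals" for N
    using image_cong[OF refl, of N "\<lambda>x \<in> K. x" "\<lambda>x. x"] nonminimals_D(4)[OF that] by auto
  then show ?thesis by (auto simp: exp_neg_0 act_def graph_aut_group_def fun_eq_iff restrict_def)
qed

lemma act_exp_neg_inv: assumes "n \<in> neg_part b" shows "inv\<^bsub>G\<^esub> act (exp_neg n) = act (exp_neg (- n))"
proof -
  interpret group G by (rule graph_aut_groupI)
  have n': "- n \<in> neg_part b" using assms by (rule subspace_neg[OF subspace_neg_part])
  have "act (exp_neg (- n)) \<otimes>\<^bsub>G\<^esub> act (exp_neg n) = act (exp_neg (n + - n + sc (1/2) (br n (- n))))" by (rule act_exp_neg_mult[OF n' assms])
  also have "br n (- n) = 0" using neg_part_D(1)[OF assms] by (simp add: br_neg_right br_self)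
  finally have "act (exp_neg (- n)) \<otimes>\<^bsub>G\<^esub> act (exp_neg n) = \<one>\<^bsub>G\<^esub>" by (simp add: act_exp_neg_one)
  then show ?thesis by (rule inv_equality) (use act_exp_neg_carrier assms n' in auto)
qed

text \<open>An \<open>exp_neg l\<close> with trivial action preserves \<open>R (b + 3)\<close>, the
  intersection of two vertices. In the image of a non-zero \<open>t\<close> from it, the components
  at \<open>b + 4\<close>, at \<open>b + 2\<close> and in the zero part must vanish, and they detect
  the three components of \<open>l\<close> one after the other.\<close>

lemma act_exp_neg_inj: assumes m: "m \<in> neg_part b" and n: "n \<in> neg_part b" and eq: "act (exp_neg m) = act (exp_neg n)" shows "m = n"
proof -
  interpret group G by (rule graph_aut_groupI)
  have triv: "l = 0" if l: "l \<in> neg_part b" and one: "act (exp_neg l) = \<one>\<^bsub>G\<^esub>" for l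
  proof -
    have lK [simp]: "l \<in> K" using l neg_part_D by blast
    have X: "exp_neg l ` X r = X r" for r
    proof -
      have "act (exp_neg l) (X r) = X r" unfolding one by (simp add: graph_aut_group_def X_nonminimals)
      then show ?thesis by (simp add: act_def X_nonminimals)
    qed
    obtain t where t: "t \<in> R (b + 3)" "t \<noteq> 0" by (rule R_nonzero)
    have tK [simp]: "t \<in> K" using t R_K by blast
    have "t \<in> X (b + 3)" "t \<in> X (b + 2)" using R_subset_X(1)[of "b + 3"] R_subset_X(2)[of "b + 2"] t by auto
    then have "exp_neg l t \<in> X (b + 3) \<inter> X (b + 2)" using imageI[of t _ "exp_neg l"] X by auto
    then have e: "exp_ad l t \<in> R (b + 3)" using eqset_imp_iff[OF X_Int_X[of "b + 3"], of "exp_ad l t"] by (simp add: exp_neg_def)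
    note lD = neg_part_D[OF l] and tD = R_D[OF t(1)]
    have "pr (b + 4) (exp_ad l t) = br (pr (b + 5) l) t" "pr (b + 2) (exp_ad l t) = br (pr (b + 1) l) t"
      by (simp_all add: exp_ad_expand pr_linear pr_br pz_br_at[of _ _ b] lD tD)
    then have "br (pr (b + 5) l) t = 0" "br (pr (b + 1) l) t = 0" using R_D(3)[OF e] by simp_all
    then have "br t (pr (b + 5) l) = 0" "br t (pr (b + 1) l) = 0" using br_anti[of _ t] by simp_all
    then have 1: "pr (b + 5) l = 0" "pr (b + 1) l = 0"
      using br_2_inj[OF t, of "pr (b + 5) l"] br_4_inj[OF t, of "pr (b + 1) l"] by simp_all
    have "pz (exp_ad l t) = br (pr b l) t"
      by (simp add: exp_ad_expand pr_linear pr_br pz_br_at[of _ _ b] lD tD 1)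
    then have "br (pr b l) t = 0" using R_D(2)[OF e] by simp
    then have "br t (br t (pr b l)) = 0" using br_anti[of "pr b l" t] by simp
    then have "pr b l = 0" using ad2_inj[OF t, of "pr b l"] by simp
    then show ?thesis using neg_part_decomp[OF l] 1 by simp
  qed
  have n': "- n \<in> neg_part b" using n by (rule subspace_neg[OF subspace_neg_part])
  have K: "m \<in> K" "n \<in> K" using m n neg_part_D by auto
  have "act (exp_neg m) \<otimes>\<^bsub>G\<^esub> act (exp_neg (- n)) = \<one>\<^bsub>G\<^esub>"
    unfolding eq act_exp_neg_inv[OF n, symmetric] using act_exp_neg_carrier[OF n] by simp
  then have "act (exp_neg (- n + m + sc (1/2) (br (- n) m))) = \<one>\<^bsub>G\<^esub>" using act_exp_neg_mult[OF m n'] by simp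
  then have 0: "- n + m + sc (1/2) (br (- n) m) = 0" by (intro triv neg_part_add n' m)
  have r: "br (- n) m \<in> R b" by (rule neg_part_br[OF n' m])
  \<comment> \<open>Bracketing with \<open>n\<close> isolates \<open>[n, m]\<close>, because the
    half bracket is central.\<close>
  have "br n (- n + m + sc (1/2) (br (- n) m)) = br n m"
    using K R_K[OF r] R_br_neg_part(2)[OF r n] by (simp add: br_linear br_self)
  then have "br n m = 0" using 0 K by simp
  then show ?thesis using 0 K by (simp add: br_neg_left)
qed

text \<open>One inclusion holds because the exponentials are closed under products and inverses by
  the Baker-Campbell-Hausdorff formula; the other is the factorisation
  \<open>exp_ad_exp_root\<close>.\<close>

theorem root_groups_generated:
  "act ` (exp_neg ` neg_part b) = generate G (act ` {exp_root y | y. y \<in> R b} \<union> act ` {exp_root y | y. y \<in> R (b + 1)} \<union> act ` {exp_root y | y. y \<in> R (b + 5)})"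
  (is "_ = generate G ?S")
proof
  interpret group G by (rule graph_aut_groupI)
  show "generate G ?S \<subseteq> act ` (exp_neg ` neg_part b)"
  proof
    fix g assume "g \<in> generate G ?S"
    then show "g \<in> act ` (exp_neg ` neg_part b)"
    proof (induction rule: generate.induct)
      case one
      have "0 \<in> neg_part b" by (rule subspace_0[OF subspace_neg_part])
      then show ?case using act_exp_neg_one by (metis image_eqI)
    next
      case (incl h)
      then obtain y j where y: "h = act (exp_root y)" "y \<in> R j" "j = b \<or> j = b + 1 \<or> j = b + 5" by blast
      then have "y \<in> neg_part b" using R_subset_neg_part by blast
      then show ?case using act_exp_neg_R[OF y(2)] y(1) by (metis image_eqI)
    next
      case (inv h)
      then obtain y j where y: "h = act (exp_root y)" "y \<in> R j" "j = b \<or> j = b + 1 \<or> j = b + 5" by blast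
      then have yN: "y \<in> neg_part b" using R_subset_neg_part by blast
      then have "inv\<^bsub>G\<^esub> h = act (exp_neg (- y))" using act_exp_neg_R[OF y(2)] y(1) act_exp_neg_inv by metis
      moreover have "- y \<in> neg_part b" using yN by (rule subspace_neg[OF subspace_neg_part])
      ultimately show ?case by (metis image_eqI)
    next
      case (eng h1 h2)
      then obtain m n where mn: "m \<in> neg_part b" "n \<in> neg_part b" "h1 = act (exp_neg m)" "h2 = act (exp_neg n)" by blast
      then have "h1 \<otimes>\<^bsub>G\<^esub> h2 = act (exp_neg (n + m + sc (1/2) (br n m)))" using act_exp_neg_mult by blast
      then show ?case using neg_part_add[OF mn(2,1)] by (metis image_eqI)
    qed
  qed
  show "act ` (exp_neg ` neg_part b) \<subseteq> generate G ?S"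
  proof
    fix g assume "g \<in> act ` (exp_neg ` neg_part b)"
    then obtain n where n: "n \<in> neg_part b" "g = act (exp_neg n)" by blast
    let ?u = "pr (b + 5) n" and ?v = "pr (b + 1) n" let ?z = "pr b n - sc (1/2) (br ?u ?v)"
    have nK [simp]: "n \<in> K" using n neg_part_D by blast
    have u: "?u \<in> R (b + 5)" and v: "?v \<in> R (b + 1)" by simp_all
    have z: "?z \<in> R b" by (intro R_closed neg_part_br R_subset_neg_part) (use u v in auto)
    have "act (exp_neg n) = act (compose K (exp_root ?u) (compose K (exp_root ?v) (exp_root ?z)))"
      by (rule act_cong) (use z R_K in \<open>simp add: exp_neg_def exp_ad_exp_root[OF n(1)] compose_def\<close>)
    also have "\<dots> = compose nonminimals (act (exp_root ?u)) (compose nonminimals (act (exp_root ?v)) (act (exp_root ?z)))"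
    proof -
      have "aut (compose K (exp_root ?v) (exp_root ?z))"
        by (rule aut_cong[OF aut_comp[OF aut_exp_root[OF v] aut_exp_root[OF z]]]) (simp add: compose_def)
      then show ?thesis using act_compose[of "compose K (exp_root ?v) (exp_root ?z)" "exp_root ?u"] act_compose[OF aut_exp_root[OF z], of "exp_root ?v"] by simp
    qed
    also have "\<dots> = (act (exp_root ?z) \<otimes>\<^bsub>G\<^esub> act (exp_root ?v)) \<otimes>\<^bsub>G\<^esub> act (exp_root ?u)" by (simp add: graph_aut_group_def)
    also have "\<dots> \<in> generate G ?S"
    proof (intro generate.eng)
      show "act (exp_root ?z) \<in> generate G ?S" using z by (intro generate.incl) blast
      show "act (exp_root ?v) \<in> generate G ?S" using v by (intro generate.incl) blast
      show "act (exp_root ?u) \<in> generate G ?S" using u by (intro generate.incl) blast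
    qed
    finally show "g \<in> generate G ?S" using n by simp
  qed
qed

text \<open>In the Baker-Campbell-Hausdorff formula the products in the two orders have opposite
  half brackets; they differ by the full bracket \<open>[n, m]\<close>, which is central.\<close>

lemma act_commutator: assumes m: "m \<in> neg_part b" and n: "n \<in> neg_part b"
  shows "group_commutator G (act (exp_neg m)) (act (exp_neg n)) = act (exp_neg (br n m))"
proof -
  interpret group G by (rule graph_aut_groupI)
  let ?x = "act (exp_neg m)" and ?y = "act (exp_neg n)" and ?z = "act (exp_neg (br n m))"
  have K: "m \<in> K" "n \<in> K" using m n neg_part_D by auto
  have r: "br n m \<in> R b" by (rule neg_part_br[OF n m])
  then have z: "br n m \<in> neg_part b" using R_subset_neg_part by blast
  have c: "?x \<in> carrier G" "?y \<in> carrier G" "?z \<in> carrier G" using act_exp_neg_carrier m n z by auto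
  let ?k = "m + n + sc (1/2) (br m n)"
  have k: "?k \<in> neg_part b" by (rule neg_part_add[OF m n])
  have "?y \<otimes>\<^bsub>G\<^esub> ?x \<otimes>\<^bsub>G\<^esub> ?z = act (exp_neg ?k) \<otimes>\<^bsub>G\<^esub> ?z" using act_exp_neg_mult[OF n m] by simp
  also have "\<dots> = act (exp_neg (br n m + ?k + sc (1/2) (br (br n m) ?k)))" by (rule act_exp_neg_mult[OF k z])
  also have "br (br n m) ?k = 0" by (rule R_br_neg_part(1)[OF r k])
  also have "br n m + ?k + sc (1/2) 0 = n + m + sc (1/2) (br n m)"
  proof -
    have "sc (1/2) (br n m) + sc (1/2) (br n m) = br n m" by (simp flip: scale_left_distrib)
    then have "br n m - sc (1/2) (br n m) = sc (1/2) (br n m)" by (metis add_diff_cancel_left')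
    then show ?thesis using br_anti[OF K(2,1)] by (simp add: algebra_simps)
  qed
  also have "act (exp_neg \<dots>) = ?x \<otimes>\<^bsub>G\<^esub> ?y" using act_exp_neg_mult[OF m n] by simp
  finally have *: "?x \<otimes>\<^bsub>G\<^esub> ?y = ?y \<otimes>\<^bsub>G\<^esub> ?x \<otimes>\<^bsub>G\<^esub> ?z" by simp
  have "group_commutator G ?x ?y = inv\<^bsub>G\<^esub> (?y \<otimes>\<^bsub>G\<^esub> ?x) \<otimes>\<^bsub>G\<^esub> (?x \<otimes>\<^bsub>G\<^esub> ?y)"
    unfolding group_commutator_def using c by (simp add: inv_mult_group m_assoc)
  also have "\<dots> = ?z"
    unfolding * using c m_assoc[of "inv\<^bsub>G\<^esub> (?y \<otimes>\<^bsub>G\<^esub> ?x)" "?y \<otimes>\<^bsub>G\<^esub> ?x" ?z] l_inv[of "?y \<otimes>\<^bsub>G\<^esub> ?x"]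
    by simp
  finally show ?thesis .
qed

theorem act_iso:
  "act \<in> iso \<lparr> carrier = exp_neg ` neg_part b, mult = (\<lambda>f g. compose K g f), one = (\<lambda>x \<in> K. x) \<rparr>
     (G \<lparr> carrier := generate G (act ` {exp_root y | y. y \<in> R b} \<union> act ` {exp_root y | y. y \<in> R (b + 1)} \<union> act ` {exp_root y | y. y \<in> R (b + 5)}) \<rparr>)"
proof (rule isoI)
  show "act \<in> hom \<lparr> carrier = exp_neg ` neg_part b, mult = (\<lambda>f g. compose K g f), one = (\<lambda>x \<in> K. x) \<rparr>
     (G \<lparr> carrier := generate G (act ` {exp_root y | y. y \<in> R b} \<union> act ` {exp_root y | y. y \<in> R (b + 1)} \<union> act ` {exp_root y | y. y \<in> R (b + 5)}) \<rparr>)"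
    unfolding root_groups_generated[symmetric]
  proof (rule homI)
    fix f g assume "f \<in> carrier \<lparr> carrier = exp_neg ` neg_part b, mult = (\<lambda>f g. compose K g f), one = (\<lambda>x \<in> K. x) \<rparr>"
    then have "aut f" using aut_exp_neg by auto
    from act_compose[OF this, of g]
    show "act (f \<otimes>\<^bsub>\<lparr>carrier = exp_neg ` neg_part b, mult = \<lambda>f g. compose K g f, one = \<lambda>x\<in>K. x\<rparr>\<^esub> g) =
           act f \<otimes>\<^bsub>G\<lparr>carrier := act ` exp_neg ` neg_part b\<rparr>\<^esub> act g"
      by (simp add: graph_aut_group_def)
  qed simp
  show "bij_betw act (carrier \<lparr> carrier = exp_neg ` neg_part b, mult = (\<lambda>f g. compose K g f), one = (\<lambda>x \<in> K. x) \<rparr>)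
     (carrier (G \<lparr> carrier := generate G (act ` {exp_root y | y. y \<in> R b} \<union> act ` {exp_root y | y. y \<in> R (b + 1)} \<union> act ` {exp_root y | y. y \<in> R (b + 5)}) \<rparr>))"
    unfolding root_groups_generated[symmetric] bij_betw_def
    using act_exp_neg_inj by (auto simp: inj_on_def)
qed

end

section \<open>Trialities of an alternative division algebra\<close>

lemma reduce_6 [simp]: "(6 :: 6) = 0" "(7 :: 6) = 1" "(8 :: 6) = 2" "(9 :: 6) = 3" "(10 :: 6) = 4"
  by simp_all

locale alternative_division_algebra_char = alternative_division_algebra F
  for F :: "('k::field, 'a::ab_group_add, 'm) nalgebra_scheme" +
  assumes two [simp]: "(2 :: 'k) \<noteq> 0" and three [simp]: "(3 :: 'k) \<noteq> 0"
begin

section \<open>Alternativity in terms of the associator\<close>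

abbreviation mu :: "'a \<Rightarrow> 'a \<Rightarrow> 'a" (infixl "\<cdot>" 70) where "x \<cdot> y \<equiv> mul F x y"
abbreviation e1 :: 'a where "e1 \<equiv> unity F"

lemma mul_0 [simp]: "0 \<cdot> x = 0" "x \<cdot> 0 = 0"
  using mul_add_left[of 0 0 x] mul_add_right[of x 0 0] by simp_all

lemma mul_neg [simp]: "(- x) \<cdot> y = - (x \<cdot> y)" "x \<cdot> (- y) = - (x \<cdot> y)"
  using mul_add_left[of x "- x" y] mul_add_right[of x y "- y"] by (simp_all add: eq_neg_iff_add_eq_0 add.commute)

lemma mul_diff: "(x - y) \<cdot> z = x \<cdot> z - y \<cdot> z" "x \<cdot> (y - z) = x \<cdot> y - x \<cdot> z"
  using mul_add_left[of x "- y" z] mul_add_right[of x y "- z"] by simp_all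

lemmas mul_linear = mul_add_left mul_add_right mul_diff mul_scal_left mul_scal_right
declare unity_left [simp] unity_right [simp]

lemma halve: assumes "x + x = y + y" shows "x = (y :: 'a)"
proof -
  have "scal F 2 v = v + v" for v using scale_left_distrib[of 1 1 v] by simp
  then have "scal F 2 x = scal F 2 y" using assms by simp
  then show ?thesis by simp
qed

definition associator :: "'a \<Rightarrow> 'a \<Rightarrow> 'a \<Rightarrow> 'a" where "associator x y z = (x \<cdot> y) \<cdot> z - x \<cdot> (y \<cdot> z)"

lemma associator_left: "associator y x z = - associator x y z"
proof -
  have "((x + y) \<cdot> (x + y)) \<cdot> z = (x + y) \<cdot> ((x + y) \<cdot> z)" by (rule left_alternative)
  then show ?thesis using left_alternative[of x z] left_alternative[of y z]
    by (simp add: associator_def mul_linear algebra_simps)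
qed

lemma associator_right: "associator x z y = - associator x y z"
proof -
  have "(x \<cdot> (y + z)) \<cdot> (y + z) = x \<cdot> ((y + z) \<cdot> (y + z))" by (rule right_alternative)
  then show ?thesis using right_alternative[of x z] right_alternative[of x y]
    by (simp add: associator_def mul_linear algebra_simps)
qed

lemma associator_perm: "associator y x z = - associator x y z" "associator x z y = - associator x y z" "associator y z x = associator x y z"
  "associator z x y = associator x y z" "associator z y x = - associator x y z"
  using associator_left[of y x z] associator_right[of x z y] associator_right[of y z x] associator_left[of z x y] associator_right[of z y x]
  by (metis (no_types) associator_left associator_right minus_minus)+

lemma associator_unity [simp]: "associator e1 x y = 0" "associator x e1 y = 0" "associator x y e1 = 0"
  by (simp_all add: associator_def)

text \<open>As a rewrite rule it brings products of three factors to left-nested form up to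
  associators, on which alternativity reduces to the signs of \<open>associator_perm\<close>;
  identities of degree three become linear.\<close>

lemma mul_assoc_associator: "x \<cdot> (y \<cdot> z) = (x \<cdot> y) \<cdot> z - associator x y z"
  by (simp add: associator_def)

text \<open>The product \<open>[x\<^sub>i, y\<^sub>i\<^sub>+\<^sub>2]\<close> of root elements.\<close>

definition root_mul :: "6 \<Rightarrow> 'a \<Rightarrow> 'a \<Rightarrow> 'a" where
  "root_mul i x y = (if i \<in> {0, 2, 4} then x \<cdot> y else - (y \<cdot> x))"

lemma root_mul_simps [simp]: "root_mul 0 x y = x \<cdot> y" "root_mul 2 x y = x \<cdot> y" "root_mul 4 x y = x \<cdot> y"
  "root_mul 1 x y = - (y \<cdot> x)" "root_mul 3 x y = - (y \<cdot> x)" "root_mul 5 x y = - (y \<cdot> x)"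
  by (simp_all add: root_mul_def)

text \<open>Infinitesimal trialities: one map for each root space, with the Leibniz rule for every
  bracket of the roots \<open>i\<close> and \<open>i + 2\<close>. These are the possible actions of
  an element of degree zero.\<close>

definition triality :: "(6 \<Rightarrow> 'a \<Rightarrow> 'a) \<Rightarrow> bool" where
  "triality t \<longleftrightarrow> (\<forall>i x y. t i (x + y) = t i x + t i y) \<and> (\<forall>i c x. t i (scal F c x) = scal F c (t i x))
    \<and> (\<forall>i x y. t (i + 1) (root_mul i x y) = root_mul i (t i x) y + root_mul i x (t (i + 2) y))"

lemma triality_add: "triality t \<Longrightarrow> t i (x + y) = t i x + t i y" and triality_scale: "triality t \<Longrightarrow> t i (scal F c x) = scal F c (t i x)"
  by (auto simp: triality_def)

lemma triality_0: "triality t \<Longrightarrow> t i 0 = 0" and triality_neg: "triality t \<Longrightarrow> t i (- x) = - t i x"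
  using triality_scale[of t i 0 0] triality_scale[of t i "-1" x] by simp_all

lemma triality_diff: "triality t \<Longrightarrow> t i (x - y) = t i x - t i y"
  using triality_add[of t i x "- y"] by (simp add: triality_neg)

lemma triality_root_mul: "triality t \<Longrightarrow> t (i + 1) (root_mul i x y) = root_mul i (t i x) y + root_mul i x (t (i + 2) y)"
  by (auto simp: triality_def)

lemmas triality_linear = triality_add triality_scale triality_0 triality_neg triality_diff

lemma triality_mul: assumes "triality t"
  shows "t 1 (x \<cdot> y) = t 0 x \<cdot> y + x \<cdot> t 2 y" "t 2 (y \<cdot> x) = y \<cdot> t 1 x + t 3 y \<cdot> x"
    "t 3 (x \<cdot> y) = t 2 x \<cdot> y + x \<cdot> t 4 y" "t 4 (y \<cdot> x) = y \<cdot> t 3 x + t 5 y \<cdot> x"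
    "t 5 (x \<cdot> y) = t 4 x \<cdot> y + x \<cdot> t 0 y" "t 0 (y \<cdot> x) = y \<cdot> t 5 x + t 1 y \<cdot> x"
  using triality_root_mul[OF assms, of 0 x y] triality_root_mul[OF assms, of 1 x y] triality_root_mul[OF assms, of 2 x y]
    triality_root_mul[OF assms, of 3 x y] triality_root_mul[OF assms, of 4 x y] triality_root_mul[OF assms, of 5 x y]
  by (simp_all add: triality_neg[OF assms] eq_neg_iff_add_eq_0 algebra_simps)

lemma triI:
  assumes "\<And>i x y. t i (x + y) = t i x + t i y" "\<And>i c x. t i (scal F c x) = scal F c (t i x)"
    "\<And>x y. t 1 (x \<cdot> y) = t 0 x \<cdot> y + x \<cdot> t 2 y" "\<And>x y. t 2 (y \<cdot> x) = y \<cdot> t 1 x + t 3 y \<cdot> x"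
    "\<And>x y. t 3 (x \<cdot> y) = t 2 x \<cdot> y + x \<cdot> t 4 y" "\<And>x y. t 4 (y \<cdot> x) = y \<cdot> t 3 x + t 5 y \<cdot> x"
    "\<And>x y. t 5 (x \<cdot> y) = t 4 x \<cdot> y + x \<cdot> t 0 y" "\<And>x y. t 0 (y \<cdot> x) = y \<cdot> t 5 x + t 1 y \<cdot> x"
  shows "triality t"
proof -
  have neg: "t i (- x) = - t i x" for i x using assms(2)[of i "-1" x] by simp
  have "t (i + 1) (root_mul i x y) = root_mul i (t i x) y + root_mul i x (t (i + 2) y)" for i x y
    by (cases i "0 :: 6" rule: cases_6) (simp_all add: assms(3-) neg)
  then show ?thesis using assms(1,2) by (simp add: triality_def)
qed

lemma triality_plus: "triality t \<Longrightarrow> triality u \<Longrightarrow> triality (\<lambda>i x. t i x + u i x)"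
  by (rule triI) (simp_all add: triality_linear triality_mul mul_linear scale_right_distrib algebra_simps)

lemma triality_scaled: "triality t \<Longrightarrow> triality (\<lambda>i x. scal F c (t i x))"
  by (rule triI) (simp_all add: triality_linear triality_mul mul_linear scale_right_distrib mult.commute)

lemma triality_minus: "triality t \<Longrightarrow> triality u \<Longrightarrow> triality (\<lambda>i x. t i x - u i x)"
  by (rule triI) (simp_all add: triality_linear triality_mul mul_linear scale_right_diff_distrib algebra_simps)

lemma triality_comm: "triality t \<Longrightarrow> triality u \<Longrightarrow> triality (\<lambda>i x. t i (u i x) - u i (t i x))"
  by (rule triI) (simp_all add: triality_linear triality_mul mul_linear scale_right_diff_distrib algebra_simps)

lemma triality_zero: "triality (\<lambda>i x. 0)"
  by (rule triI) simp_all

text \<open>\<open>root_mul\<close> depends only on the parity of the root, so rotations by an even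
  number of steps preserve the Leibniz rules.\<close>

lemma triality_shift: assumes t: "triality t" shows "triality (\<lambda>i. t (i + 2))" "triality (\<lambda>i. t (i + 4))"
proof -
  show "triality (\<lambda>i. t (i + 2))" "triality (\<lambda>i. t (i + 4))"
    by (rule triI; simp add: triality_linear[OF t] triality_mul[OF t])+
qed

lemma triality_zero_odd:
  assumes t: "triality t" and z: "\<And>x. t 1 x = 0" "\<And>x. t 3 x = 0" "\<And>x. t 5 x = 0" shows "t i x = 0"
proof -
  have "t 2 x = 0" "t 4 x = 0" "t 0 x = 0"
    using triality_mul(2)[OF t, of x e1] triality_mul(4)[OF t, of x e1] triality_mul(6)[OF t, of x e1] z by simp_all
  then show ?thesis by (cases i "0 :: 6" rule: cases_6) (simp_all add: z)
qed

lemma triality_zero_even: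
  assumes t: "triality t" and z: "\<And>x. t 0 x = 0" "\<And>x. t 2 x = 0" "\<And>x. t 4 x = 0" shows "t i x = 0"
proof -
  have "t 1 x = 0" "t 3 x = 0" "t 5 x = 0"
    using triality_mul(1)[OF t, of x e1] triality_mul(3)[OF t, of x e1] triality_mul(5)[OF t, of x e1] z by simp_all
  then show ?thesis by (cases i "0 :: 6" rule: cases_6) (simp_all add: z)
qed

text \<open>Putting 1 for one factor of a Leibniz rule expresses a further map by its neighbours, so
  a triality is determined by its maps 1 and 2. Equality of trialities thus becomes a check on two
  components.\<close>

lemma triality_zero_12:
  assumes t: "triality t" and z: "\<And>x. t 1 x = 0" "\<And>x. t 2 x = 0" shows "t i x = 0"
proof -
  have 3: "t 3 y = 0" for y using triality_mul(2)[OF t, of y e1] z by simp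
  have 4: "t 4 y = 0" for y using triality_mul(3)[OF t, of e1 y] z 3 by simp
  show ?thesis
    by (rule triality_zero_even[OF t]) (use triality_mul(1)[OF t, of _ e1] z 4 in auto)
qed

text \<open>The action of \<open>[x\<^sub>0, y\<^sub>3]\<close> on the root spaces.\<close>

definition inner_der :: "'a \<Rightarrow> 'a \<Rightarrow> 6 \<Rightarrow> 'a \<Rightarrow> 'a" where
  "inner_der x y j z = (if j = 0 then (x \<cdot> y) \<cdot> z + (z \<cdot> y) \<cdot> x else if j = 1 then x \<cdot> (y \<cdot> z)
     else if j = 2 then - (y \<cdot> (x \<cdot> z)) else if j = 3 then - (y \<cdot> (x \<cdot> z)) - z \<cdot> (x \<cdot> y)
     else if j = 4 then - ((z \<cdot> x) \<cdot> y) else (z \<cdot> y) \<cdot> x)"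

lemma inner_der_simps [simp]: "inner_der x y 0 z = (x \<cdot> y) \<cdot> z + (z \<cdot> y) \<cdot> x" "inner_der x y 1 z = x \<cdot> (y \<cdot> z)"
  "inner_der x y 2 z = - (y \<cdot> (x \<cdot> z))" "inner_der x y 3 z = - (y \<cdot> (x \<cdot> z)) - z \<cdot> (x \<cdot> y)"
  "inner_der x y 4 z = - ((z \<cdot> x) \<cdot> y)" "inner_der x y 5 z = (z \<cdot> y) \<cdot> x"
  by (simp_all add: inner_der_def)

lemma inner_der_linear:
  "inner_der (x + x') y j z = inner_der x y j z + inner_der x' y j z" "inner_der x (y + y') j z = inner_der x y j z + inner_der x y' j z"
  "inner_der x y j (z + z') = inner_der x y j z + inner_der x y j z'"
  "inner_der (x - x') y j z = inner_der x y j z - inner_der x' y j z" "inner_der x (y - y') j z = inner_der x y j z - inner_der x y' j z"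
  "inner_der x y j (z - z') = inner_der x y j z - inner_der x y j z'"
  "inner_der (- x) y j z = - inner_der x y j z" "inner_der x (- y) j z = - inner_der x y j z" "inner_der x y j (- z) = - inner_der x y j z"
  "inner_der (scal F c x) y j z = scal F c (inner_der x y j z)" "inner_der x (scal F c y) j z = scal F c (inner_der x y j z)"
  "inner_der x y j (scal F c z) = scal F c (inner_der x y j z)"
  by (simp_all add: inner_der_def mul_linear scale_right_distrib scale_right_diff_distrib algebra_simps)

lemma inner_der_0 [simp]: "inner_der 0 y j z = 0" "inner_der x 0 j z = 0" "inner_der x y j 0 = 0"
  by (simp_all add: inner_der_def)

text \<open>With 1 as second argument the Leibniz rules have degree three in \<open>x\<close>,
  \<open>a\<close>, \<open>b\<close> and follow from the associator being alternating.\<close>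

lemma triality_inner_der_unity: "triality (inner_der x e1)"
proof (rule triI)
  fix a b
  note p = associator_perm[where x = x and y = a and z = b]
  show "inner_der x e1 1 (a \<cdot> b) = inner_der x e1 0 a \<cdot> b + a \<cdot> inner_der x e1 2 b"
    "inner_der x e1 2 (b \<cdot> a) = b \<cdot> inner_der x e1 1 a + inner_der x e1 3 b \<cdot> a"
    "inner_der x e1 3 (a \<cdot> b) = inner_der x e1 2 a \<cdot> b + a \<cdot> inner_der x e1 4 b"
    "inner_der x e1 4 (b \<cdot> a) = b \<cdot> inner_der x e1 3 a + inner_der x e1 5 b \<cdot> a"
    "inner_der x e1 5 (a \<cdot> b) = inner_der x e1 4 a \<cdot> b + a \<cdot> inner_der x e1 0 b"
    "inner_der x e1 0 (b \<cdot> a) = b \<cdot> inner_der x e1 5 a + inner_der x e1 1 b \<cdot> a"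
    by (simp_all add: mul_linear mul_assoc_associator p algebra_simps)
qed (simp_all add: inner_der_linear)

text \<open>\<open>2 [x\<^sub>0, y\<^sub>3] = [[x\<^sub>0, 1\<^sub>3], [y\<^sub>0, 1\<^sub>3]] + [(x y + y x)\<^sub>0, 1\<^sub>3]\<close>, which reduces the identities of
  degree 4 to identities of degree 3.\<close>

lemma triality_inner_der: "triality (inner_der x y)"
proof -
  let ?t = "\<lambda>j z. inner_der x e1 j (inner_der y e1 j z) - inner_der y e1 j (inner_der x e1 j z) + inner_der (x \<cdot> y + y \<cdot> x) e1 j z"
  have t: "triality ?t" by (intro triality_plus triality_comm triality_inner_der_unity)
  have "?t j z = inner_der x y j z + inner_der x y j z" for j z
    by (cases j "0 :: 6" rule: cases_6) (simp_all add: mul_linear mul_assoc_associator associator_perm[where x = x and y = y and z = z] algebra_simps)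
  then have "inner_der x y j z = scal F (1/2) (?t j z)" for j z by (simp add: scale_right_distrib) (simp flip: scale_left_distrib)
  then have "inner_der x y = (\<lambda>j z. scal F (1/2) (?t j z))" by blast
  then show ?thesis using triality_scaled[OF t, of "1/2"] by simp
qed

text \<open>The Leibniz rule of the triality \<open>inner_der x y\<close>, evaluated at its own
  argument \<open>x\<close>, is twice the Moufang identity.\<close>

lemma left_moufang: "x \<cdot> (y \<cdot> (x \<cdot> b)) = ((x \<cdot> y) \<cdot> x) \<cdot> b"
  by (rule halve) (use triality_mul(1)[OF triality_inner_der, of x y x b] in \<open>simp add: mul_linear algebra_simps\<close>)

lemma right_moufang: "((a \<cdot> x) \<cdot> y) \<cdot> x = a \<cdot> ((x \<cdot> y) \<cdot> x)"
  by (rule halve) (use triality_mul(5)[OF triality_inner_der, of x y a x] in \<open>simp add: mul_linear algebra_simps\<close>)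

lemma middle_moufang: "(x \<cdot> y) \<cdot> (b \<cdot> x) = (x \<cdot> (y \<cdot> b)) \<cdot> x"
  using triality_mul(6)[OF triality_inner_der, of x y b x] right_moufang[of b x y] by (simp add: mul_linear algebra_simps)

lemma middle_moufang_linear: "(x \<cdot> y) \<cdot> (b \<cdot> w) + (w \<cdot> y) \<cdot> (b \<cdot> x) = (x \<cdot> (y \<cdot> b)) \<cdot> w + (w \<cdot> (y \<cdot> b)) \<cdot> x"
  using middle_moufang[of "x + w" y b] middle_moufang[of x y b] middle_moufang[of w y b]
  by (simp add: mul_linear algebra_simps)

text \<open>Let \<open>P\<close> send \<open>v\<close> to \<open>x (y v)\<close> and
  \<open>Q\<close> send \<open>v\<close> to \<open>y (x v)\<close>. The left Moufang identity makes
  both idempotent, and alternativity gives \<open>P + Q = 2\<close>. Then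
  \<open>(2 - P)^2 = 2 - P\<close> yields \<open>2 P = 2\<close>, so \<open>P\<close> is the
  identity.\<close>

lemma inverse_property_left: assumes "x \<cdot> y = e1" "y \<cdot> x = e1" shows "x \<cdot> (y \<cdot> z) = z"
proof -
  define p where "p = x \<cdot> (y \<cdot> z)"
  have xy: "x \<cdot> (y \<cdot> p) = p" using left_moufang[of y x z] assms by (simp add: p_def)
  have yx: "y \<cdot> (x \<cdot> (y \<cdot> (x \<cdot> z))) = y \<cdot> (x \<cdot> z)" using left_moufang[of x y z] assms by simp
  have s: "y \<cdot> (x \<cdot> v) = v + v - x \<cdot> (y \<cdot> v)" for v
    using associator_left[of y x v] assms by (simp add: associator_def algebra_simps)
  have "y \<cdot> (x \<cdot> (z + z - p)) = z + z - p"
    using yx unfolding s[of z] p_def[symmetric] .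
  then have "p + p = z + z"
    unfolding s[of "z + z - p"] by (simp add: mul_linear xy flip: p_def) (simp add: algebra_simps)
  then show ?thesis using halve unfolding p_def by blast
qed

lemma inverse_property_right: assumes "x \<cdot> y = e1" "y \<cdot> x = e1" shows "(z \<cdot> x) \<cdot> y = z"
proof -
  define p where "p = (z \<cdot> x) \<cdot> y"
  have xy: "(p \<cdot> x) \<cdot> y = p" using right_moufang[of z x y] assms by (simp add: p_def)
  have yx: "(((z \<cdot> y) \<cdot> x) \<cdot> y) \<cdot> x = (z \<cdot> y) \<cdot> x" using right_moufang[of z y x] assms by simp
  have s: "(v \<cdot> y) \<cdot> x = v + v - (v \<cdot> x) \<cdot> y" for v
    using associator_right[of v y x] assms by (simp add: associator_def algebra_simps)
  have "((z + z - p) \<cdot> y) \<cdot> x = z + z - p"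
    using yx unfolding s[of z] p_def[symmetric] .
  then have "p + p = z + z"
    unfolding s[of "z + z - p"] by (simp add: mul_linear xy flip: p_def) (simp add: algebra_simps)
  then show ?thesis using halve unfolding p_def by blast
qed

text \<open>The Leibniz rule of \<open>t\<close> for brackets of the roots 0 and 3. Both sides are
  trialities, so it suffices to compare the components 1 and 2, where \<open>inner_der\<close> is a
  single product.\<close>

lemma triality_inner_der_comm:
  assumes t: "triality t"
  shows "t j (inner_der x y j z) - inner_der x y j (t j z) = inner_der (t 0 x) y j z + inner_der x (t 3 y) j z"
proof -
  let ?u = "\<lambda>j z. t j (inner_der x y j z) - inner_der x y j (t j z) - (inner_der (t 0 x) y j z + inner_der x (t 3 y) j z)"
  have u: "triality ?u" by (intro triality_minus[OF triality_comm triality_plus] triality_inner_der t)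
  have "?u 1 v = 0" "?u 2 v = 0" for v
    using t by (simp_all add: triality_linear triality_mul mul_linear algebra_simps)
  then have "?u j z = 0" using triality_zero_12[OF u] by blast
  then show ?thesis by simp
qed

text \<open>The Jacobi identity for elements of the roots 0, 2 and 4, whose sum is zero. On the even
  components it is the linearised middle Moufang identity, and \<open>triality_zero_even\<close>
  carries it to the odd ones.\<close>

lemma inner_der_cyclic_even: "inner_der a (b \<cdot> c) j z + inner_der b (c \<cdot> a) (j + 4) z + inner_der c (a \<cdot> b) (j + 2) z = 0"
proof -
  let ?u = "\<lambda>j z. inner_der a (b \<cdot> c) j z + inner_der b (c \<cdot> a) (j + 4) z + inner_der c (a \<cdot> b) (j + 2) z"
  have u: "triality ?u" by (intro triality_plus triality_inner_der triality_shift)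
  have "?u 0 v = 0" "?u 2 v = 0" "?u 4 v = 0" for v
    using middle_moufang_linear[of a b c v] middle_moufang_linear[of b c a v] middle_moufang_linear[of c a b v]
    by (simp_all add: algebra_simps)
  then show ?thesis using triality_zero_even[OF u] by blast
qed

text \<open>The Jacobi identity for the roots 1, 3 and 5, checked on the odd components; there the
  flexible law is used along with the middle Moufang identity.\<close>

lemma inner_der_cyclic_odd: "inner_der (c \<cdot> b) a (j + 2) z + inner_der (a \<cdot> c) b j z + inner_der (b \<cdot> a) c (j + 4) z = 0"
proof -
  let ?u = "\<lambda>j z. inner_der (c \<cdot> b) a (j + 2) z + inner_der (a \<cdot> c) b j z + inner_der (b \<cdot> a) c (j + 4) z"
  have u: "triality ?u" by (intro triality_plus triality_inner_der triality_shift)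
  have flex: "b \<cdot> (m \<cdot> v) + v \<cdot> (m \<cdot> b) = (b \<cdot> m) \<cdot> v + (v \<cdot> m) \<cdot> b" for b m v
    using associator_perm(5)[where x = b and y = m and z = v] by (simp add: associator_def algebra_simps)
  have "?u 1 v = 0" "?u 3 v = 0" "?u 5 v = 0" for v
    using middle_moufang_linear[of b a c v] middle_moufang_linear[of a c b v] middle_moufang_linear[of c b a v]
      flex[of b "a \<cdot> c" v] flex[of a "c \<cdot> b" v] flex[of c "b \<cdot> a" v]
    by (simp_all add: algebra_simps)
  then show ?thesis using triality_zero_odd[OF u] by blast
qed

text \<open>The action on the root space \<open>j\<close> of the zero component of the bracket of
  two elements with root coordinates \<open>v\<close> and \<open>w\<close>. The opposite pairs 2, 5
  and 4, 1 come from the pair 0, 3 by even rotations, the reversed pairs by antisymmetry.\<close>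

definition zero_part :: "(6 \<Rightarrow> 'a) \<Rightarrow> (6 \<Rightarrow> 'a) \<Rightarrow> 6 \<Rightarrow> 'a \<Rightarrow> 'a" where
  "zero_part v w j z = inner_der (v 0) (w 3) j z + inner_der (v 2) (w 5) (j + 4) z + inner_der (v 4) (w 1) (j + 2) z
     - (inner_der (w 0) (v 3) j z + inner_der (w 2) (v 5) (j + 4) z + inner_der (w 4) (v 1) (j + 2) z)"

definition root_part :: "(6 \<Rightarrow> 'a) \<Rightarrow> (6 \<Rightarrow> 'a) \<Rightarrow> 6 \<Rightarrow> 'a" where
  "root_part v w i = root_mul (i + 5) (v (i + 5)) (w (i + 1)) - root_mul (i + 5) (w (i + 5)) (v (i + 1))"

lemma triality_zero_part: "triality (zero_part v w)"
  unfolding zero_part_def by (intro triality_minus triality_plus triality_inner_der triality_shift)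

lemma zero_part_linear:
  "zero_part (\<lambda>i. v i + v' i) w j z = zero_part v w j z + zero_part v' w j z" "zero_part v (\<lambda>i. w i + w' i) j z = zero_part v w j z + zero_part v w' j z"
  "zero_part (\<lambda>i. v i - v' i) w j z = zero_part v w j z - zero_part v' w j z" "zero_part v (\<lambda>i. w i - w' i) j z = zero_part v w j z - zero_part v w' j z"
  "zero_part (\<lambda>i. scal F c (v i)) w j z = scal F c (zero_part v w j z)"
  by (simp_all add: zero_part_def inner_der_linear scale_right_distrib scale_right_diff_distrib)

lemma zero_part_anti: "zero_part w v j z = - zero_part v w j z"
  by (simp add: zero_part_def)

lemma root_mul_linear: "root_mul i (x + x') y = root_mul i x y + root_mul i x' y" "root_mul i x (y + y') = root_mul i x y + root_mul i x y'"
  "root_mul i (x - x') y = root_mul i x y - root_mul i x' y" "root_mul i x (y - y') = root_mul i x y - root_mul i x y'"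
  "root_mul i (scal F c x) y = scal F c (root_mul i x y)" "root_mul i x (scal F c y) = scal F c (root_mul i x y)"
  "root_mul i 0 y = 0" "root_mul i x 0 = 0" "root_mul i (- x) y = - root_mul i x y" "root_mul i x (- y) = - root_mul i x y"
  by (simp_all add: root_mul_def mul_linear)

lemma root_part_linear:
  "root_part (\<lambda>i. v i + v' i) w i = root_part v w i + root_part v' w i" "root_part v (\<lambda>i. w i + w' i) i = root_part v w i + root_part v w' i"
  "root_part (\<lambda>i. v i - v' i) w i = root_part v w i - root_part v' w i" "root_part v (\<lambda>i. w i - w' i) i = root_part v w i - root_part v w' i"
  "root_part (\<lambda>i. scal F c (v i)) w i = scal F c (root_part v w i)"
  by (simp_all add: root_part_def root_mul_linear scale_right_distrib scale_right_diff_distrib)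

lemma root_part_anti: "root_part w v i = - root_part v w i"
  by (simp add: root_part_def)

lemma triality_root_part: assumes t: "triality t" shows "t i (root_part v w i) = root_part (\<lambda>i. t i (v i)) w i + root_part v (\<lambda>i. t i (w i)) i"
  using triality_root_mul[OF t, of "i + 5" "v (i + 5)" "w (i + 1)"] triality_root_mul[OF t, of "i + 5" "w (i + 5)" "v (i + 1)"]
  by (simp add: root_part_def triality_linear[OF t])

lemma triality_zero_part_comm: assumes t: "triality t"
  shows "t j (zero_part v w j z) - zero_part v w j (t j z) = zero_part (\<lambda>i. t i (v i)) w j z + zero_part v (\<lambda>i. t i (w i)) j z"
proof -
  note a = triality_inner_der_comm[OF t, of j] triality_inner_der_comm[OF triality_shift(2)[OF t], of "j + 2"] triality_inner_der_comm[OF triality_shift(1)[OF t], of "j + 4"]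
  show ?thesis
    using a(1)[of "v 0" "w 3" z] a(1)[of "w 0" "v 3" z] a(2)[of "v 4" "w 1" z] a(2)[of "w 4" "v 1" z]
      a(3)[of "v 2" "w 5" z] a(3)[of "w 2" "v 5" z]
    by (simp add: zero_part_def triality_linear[OF t] inner_der_linear algebra_simps)
qed

lemma zero_part_root_part_cyclic: "zero_part v (root_part w x) j z + zero_part w (root_part x v) j z + zero_part x (root_part v w) j z = 0"
proof -
  \<comment> \<open>The cyclic identities, solved for the terms shifted by \<open>j + 2\<close>,
    serve as rewrite rules; once these terms are eliminated the rest cancels.\<close>
  have ev: "inner_der c (a \<cdot> b) (j + 2) z = - inner_der a (b \<cdot> c) j z - inner_der b (c \<cdot> a) (j + 4) z" for a b c
    using inner_der_cyclic_even[of a b c j z] by (simp add: eq_neg_iff_add_eq_0 algebra_simps)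
  have od: "inner_der (c \<cdot> b) a (j + 2) z = - inner_der (a \<cdot> c) b j z - inner_der (b \<cdot> a) c (j + 4) z" for a b c
    using inner_der_cyclic_odd[of c b a j z] by (simp add: eq_neg_iff_add_eq_0 algebra_simps)
  show ?thesis
    by (simp add: zero_part_def root_part_def inner_der_linear ev od)
qed

text \<open>The root component of the Jacobi identity for three elements without zero part. All
  terms have degree three, so the alternating associator suffices.\<close>

lemma root_part_root_part_cyclic: "root_part v (root_part w x) i + root_part w (root_part x v) i + root_part x (root_part v w) i = zero_part w x i (v i) + zero_part x v i (w i) + zero_part v w i (x i)"
proof -
  note p = associator_perm[where x = "v i" and y = "w i" and z = "x (i + 3)"] associator_perm[where x = "v i" and y = "x i" and z = "w (i + 3)"] associator_perm[where x = "w i" and y = "x i" and z = "v (i + 3)"]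
  show ?thesis
    by (cases i "0 :: 6" rule: cases_6; use p in \<open>simp add: zero_part_def root_part_def mul_linear mul_assoc_associator algebra_simps\<close>)
qed

end

section \<open>The Lie algebra of the double\<close>

context alternative_division_algebra_char begin

section \<open>Coordinates of the Lie algebra of the double by trialities\<close>

abbreviation A :: "('k, 'a \<times> 'a) ialgebra" where "A \<equiv> double F"

lemma double_simps [simp]:
  "mul A (a, b) (c, d) = (a \<cdot> c, d \<cdot> b)" "invo A (a, b) = (b, a)" "unity A = (e1, e1)"
  "scal A k (a, b) = (scal F k a, scal F k b)"
  by (simp_all add: double_def)

lemma vector_space_A: "vector_space (scal A)"
  by unfold_locales (auto simp: scale_right_distrib scale_left_distrib)

lemma vector_space_maps: "vector_space (\<lambda>c T x. scal A c (T x) :: 'a \<times> 'a)"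
proof -
  interpret V: vector_space "scal A" by (rule vector_space_A)
  show ?thesis by unfold_locales (auto simp: fun_eq_iff V.scale_right_distrib V.scale_left_distrib)
qed

lemma vector_space_kan: "vector_space (scalK A)"
proof -
  interpret V: vector_space "scal A" by (rule vector_space_A)
  show ?thesis
    by unfold_locales (auto simp: scalK_def fun_eq_iff V.scale_right_distrib V.scale_left_distrib
      scale_right_distrib scale_left_distrib)
qed

text \<open>An operator on the double carries only the maps for the roots 0 and 2;
  \<open>eps\<close> and \<open>delta\<close> recover the other four.\<close>

definition pair_map :: "(6 \<Rightarrow> 'a \<Rightarrow> 'a) \<Rightarrow> 'a \<times> 'a \<Rightarrow> 'a \<times> 'a" where
  "pair_map t = (\<lambda>(x, y). (t 0 x, t 2 y))"

text \<open>The dictionary between roots and summands: 0, 1, 2 are \<open>(F, 0)\<close>, the skew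
  elements and \<open>(0, F)\<close> of the positive part, and 3, 4, 5 are \<open>(0, F)\<close>,
  the skew elements and \<open>(F, 0)\<close> of the negative part. A skew element
  \<open>(x, - x)\<close> has the coordinate \<open>x\<close>.\<close>

definition kan_of :: "(6 \<Rightarrow> 'a \<Rightarrow> 'a) \<Rightarrow> (6 \<Rightarrow> 'a) \<Rightarrow> ('a \<times> 'a) kan" where
  "kan_of t v = ((v 4, - v 4), (v 5, v 3), pair_map t, (v 0, v 2), (v 1, - v 1))"

lemma pair_map_simp [simp]: "pair_map t (x, y) = (t 0 x, t 2 y)" by (simp add: pair_map_def)

text \<open>By the Leibniz rule at 1 times 1, the value of the operator at the unity plus its
  conjugate is \<open>t 1 e1\<close> in both coordinates. Subtracting multiplication by it turns
  \<open>t 0\<close> into \<open>t 5\<close> and \<open>t 2\<close> into \<open>t 3\<close>, again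
  by Leibniz rules with a factor 1.\<close>

lemma eps_pair_map: assumes t: "triality t" shows "eps A (pair_map t) (x, y) = (t 5 x, t 3 y)"
proof -
  have 1: "t 0 e1 + t 2 e1 = t 1 e1" using triality_mul(1)[OF t, where x = e1 and y = e1] by simp
  have "t 2 e1 + t 0 e1 = t 1 e1" using 1 by (simp add: add.commute)
  then show ?thesis
    using 1 triality_mul(6)[OF t, where x = x and y = e1] triality_mul(2)[OF t, where x = e1 and y = y]
    by (simp add: eps_def)
qed

lemma delta_pair_map: assumes t: "triality t" shows "delta A (pair_map t) (x, - x) = (t 1 x, - t 1 x)"
  using triality_mul(1)[OF t, where x = x and y = e1] triality_mul(1)[OF t, where x = e1 and y = x]
  by (simp add: delta_def triality_neg[OF t])

lemma delta_eps_pair_map: assumes t: "triality t" shows "delta A (eps A (pair_map t)) (x, - x) = (t 4 x, - t 4 x)"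
  using triality_mul(4)[OF t, where x = e1 and y = x] triality_mul(4)[OF t, where x = x and y = e1]
  by (simp add: delta_def triality_neg[OF t] eps_pair_map[OF t] add.commute)

lemma V_op_pair_map: "V_op A (b1, b2) (a1, a2) = pair_map (\<lambda>j z. inner_der b1 a2 j z + inner_der b2 a1 (j + 4) z)"
proof
  fix z :: "'a \<times> 'a"
  obtain z1 z2 where z: "z = (z1, z2)" by (cases z)
  show "V_op A (b1, b2) (a1, a2) z = pair_map (\<lambda>j z. inner_der b1 a2 j z + inner_der b2 a1 (j + 4) z) z"
    using associator_perm[where x = b2 and y = a1 and z = z2]
    by (simp add: z V_op_def mul_assoc_associator[of z2] mul_assoc_associator[of b2])
qed

lemma bracket_kan_of:
  assumes t: "triality t" and u: "triality u"
  shows "bracket A (kan_of t v) (kan_of u w) =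
    kan_of (\<lambda>j z. t j (u j z) - u j (t j z) + zero_part v w j z) (\<lambda>i. t i (w i) - u i (v i) + root_part v w i)"
proof -
  have op: "(\<lambda>x. pair_map t (pair_map u x) - pair_map u (pair_map t x) + V_op A (v 0, v 2) (w 5, w 3) x - V_op A (w 0, w 2) (v 5, v 3) x
        + mul A (v 1, - v 1) (mul A (w 4, - w 4) x) - mul A (w 1, - w 1) (mul A (v 4, - v 4) x))
      = pair_map (\<lambda>j z. t j (u j z) - u j (t j z) + zero_part v w j z)"
    by (rule ext) (auto simp: V_op_pair_map zero_part_def algebra_simps)
  show ?thesis
    unfolding kan_of_def bracket.simps op
    by (simp add: psi_def eps_pair_map t u delta_pair_map delta_eps_pair_map root_part_def algebra_simps)
qed

lemma kan_of_add: "kan_of t v + kan_of u w = kan_of (\<lambda>j z. t j z + u j z) (\<lambda>i. v i + w i)"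
  by (auto simp: kan_of_def fun_eq_iff)

lemma kan_of_scale: "scalK A c (kan_of t v) = kan_of (\<lambda>j z. scal F c (t j z)) (\<lambda>i. scal F c (v i))"
  by (auto simp: kan_of_def scalK_def fun_eq_iff)

lemma kan_of_cong: "(\<And>j z. t j z = t' j z) \<Longrightarrow> (\<And>i. v i = v' i) \<Longrightarrow> kan_of t v = kan_of t' v'"
  by (metis ext)

lemma kan_of_0: "kan_of (\<lambda>_ _. 0) (\<lambda>_. 0) = 0"
  by (auto simp: kan_of_def fun_eq_iff zero_prod_def)

lemma kan_of_eq_0D: assumes "kan_of t v = 0" shows "v i = 0"
  using assms by (cases i "0 :: 6" rule: cases_6) (auto simp: kan_of_def zero_prod_def)

section \<open>The inner structure algebra\<close>

lemma V_op_Instrl: "V_op A b a \<in> Instrl A"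
proof -
  interpret M: vector_space "\<lambda>c T x. scal A c (T x) :: 'a \<times> 'a" by (rule vector_space_maps)
  show ?thesis unfolding Instrl_def by (rule M.span_base) blast
qed

lemma Instrl_closed: "0 \<in> Instrl A" "T \<in> Instrl A \<Longrightarrow> U \<in> Instrl A \<Longrightarrow> (\<lambda>x. T x + U x) \<in> Instrl A"
  "T \<in> Instrl A \<Longrightarrow> U \<in> Instrl A \<Longrightarrow> (\<lambda>x. T x - U x) \<in> Instrl A" "T \<in> Instrl A \<Longrightarrow> (\<lambda>x. scal A c (T x)) \<in> Instrl A"
proof -
  interpret M: vector_space "\<lambda>c T x. scal A c (T x) :: 'a \<times> 'a" by (rule vector_space_maps)
  show "0 \<in> Instrl A" unfolding Instrl_def by (rule M.span_zero)
  show "(\<lambda>x. T x + U x) \<in> Instrl A" if "T \<in> Instrl A" "U \<in> Instrl A"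
    using M.span_add[of T _ U] that unfolding Instrl_def plus_fun_def by blast
  show "(\<lambda>x. T x - U x) \<in> Instrl A" if "T \<in> Instrl A" "U \<in> Instrl A"
    using M.span_diff[of T _ U] that unfolding Instrl_def fun_diff_def by blast
  show "(\<lambda>x. scal A c (T x)) \<in> Instrl A" if "T \<in> Instrl A"
    using M.span_scale[of T] that unfolding Instrl_def by blast
qed

lemma Instrl_induct [consumes 1, case_names V zero add scale]:
  assumes "T \<in> Instrl A" and V: "\<And>b a. P (V_op A b a)" and z: "P 0"
    and add: "\<And>T U. P T \<Longrightarrow> P U \<Longrightarrow> P (\<lambda>x. T x + U x)" and scale: "\<And>c T. P T \<Longrightarrow> P (\<lambda>x. scal A c (T x))"
  shows "P T"
proof -
  interpret M: vector_space "\<lambda>c T x. scal A c (T x) :: 'a \<times> 'a" by (rule vector_space_maps)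
  have "M.subspace {T. P T}" unfolding M.subspace_def plus_fun_def using z add scale by auto
  moreover have "{V_op A x y | x y. True} \<subseteq> {T. P T}" using V by auto
  ultimately have "Instrl A \<subseteq> {T. P T}" unfolding Instrl_def by (rule M.span_minimal[rotated])
  then show ?thesis using assms(1) by blast
qed

lemma Instrl_triality: "T \<in> Instrl A \<Longrightarrow> \<exists>t. triality t \<and> T = pair_map t"
proof (induction rule: Instrl_induct)
  case (V b a)
  obtain b1 b2 a1 a2 where "b = (b1, b2)" "a = (a1, a2)" by (cases b, cases a)
  then have "V_op A b a = pair_map (\<lambda>j z. inner_der b1 a2 j z + inner_der b2 a1 (j + 4) z)" by (simp add: V_op_pair_map)
  moreover have "triality (\<lambda>j z. inner_der b1 a2 j z + inner_der b2 a1 (j + 4) z)" by (rule triality_plus[OF triality_inner_der triality_shift(2)[OF triality_inner_der]])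
  ultimately show ?case by blast
next
  case zero
  have "(0 :: 'a \<times> 'a \<Rightarrow> 'a \<times> 'a) = pair_map (\<lambda>_ _. 0)" by (auto simp: fun_eq_iff zero_prod_def)
  then show ?case using triality_zero by blast
next
  case (add T U)
  then obtain t u where "triality t" "triality u" "T = pair_map t" "U = pair_map u" by blast
  moreover from this have "(\<lambda>x. T x + U x) = pair_map (\<lambda>j z. t j z + u j z)" by (auto simp: fun_eq_iff)
  ultimately show ?case using triality_plus by blast
next
  case (scale c T)
  then obtain t where "triality t" "T = pair_map t" by blast
  moreover from this have "(\<lambda>x. scal A c (T x)) = pair_map (\<lambda>j z. scal F c (t j z))" by (auto simp: fun_eq_iff)
  ultimately show ?case using triality_scaled by blast
qed

text \<open>The opposite roots 1 and 4 contribute products of two left multiplications by skew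
  elements, which are not visibly combinations of operators \<open>V_op\<close>. The cyclic identity
  with one factor 1 expresses them by the pairs 0, 3 and 2, 5, which are.\<close>

lemma pair_map_zero_part_Instrl: "pair_map (zero_part v w) \<in> Instrl A"
proof -
  have c: "inner_der c d (j + 2) z = - (inner_der d c j z + inner_der e1 (c \<cdot> d) (j + 4) z)" for c d j z
    using inner_der_cyclic_even[of d e1 c j z] by (simp add: eq_neg_iff_add_eq_0 algebra_simps)
  have "pair_map (zero_part v w) = (\<lambda>x. V_op A (v 0, v 2) (w 5, w 3) x - V_op A (w 0, w 2) (v 5, v 3) x
      - V_op A (w 1, e1) (v 4 \<cdot> w 1, v 4) x + V_op A (v 1, e1) (w 4 \<cdot> v 1, w 4) x)"
  proof
    fix z :: "'a \<times> 'a"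
    obtain z1 z2 where z: "z = (z1, z2)" by (cases z)
    show "pair_map (zero_part v w) z = V_op A (v 0, v 2) (w 5, w 3) z - V_op A (w 0, w 2) (v 5, v 3) z
      - V_op A (w 1, e1) (v 4 \<cdot> w 1, v 4) z + V_op A (v 1, e1) (w 4 \<cdot> v 1, w 4) z"
      unfolding z V_op_pair_map pair_map_simp zero_part_def c by simp
  qed
  then show ?thesis by (simp only:) (intro Instrl_closed V_op_Instrl)
qed

lemma pair_map_comm_Instrl: assumes t: "triality t" and "T \<in> Instrl A" shows "(\<lambda>x. pair_map t (T x) - T (pair_map t x)) \<in> Instrl A"
  using assms(2)
proof (induction rule: Instrl_induct)
  case (V b a)
  obtain b1 b2 a1 a2 where ba: "b = (b1, b2)" "a = (a1, a2)" by (cases b, cases a)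
  \<comment> \<open>Root coordinates that make \<open>V_op A b a\<close> the zero part of a bracket,
    so that the Leibniz rule \<open>triality_zero_part_comm\<close> applies to it.\<close>
  define v :: "6 \<Rightarrow> 'a" where "v = (\<lambda>i. if i = 0 then b1 else if i = 2 then b2 else 0)"
  define w :: "6 \<Rightarrow> 'a" where "w = (\<lambda>i. if i = 3 then a2 else if i = 5 then a1 else 0)"
  have "V_op A b a = pair_map (zero_part v w)" by (auto simp: ba V_op_pair_map zero_part_def v_def w_def fun_eq_iff)
  moreover have "(\<lambda>x. pair_map t (pair_map (zero_part v w) x) - pair_map (zero_part v w) (pair_map t x))
      = (\<lambda>x. pair_map (zero_part (\<lambda>i. t i (v i)) w) x + pair_map (zero_part v (\<lambda>i. t i (w i))) x)"
    using triality_zero_part_comm[OF t, of _ v w] by (auto simp: fun_eq_iff)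
  ultimately show ?case by (simp only:) (intro Instrl_closed pair_map_zero_part_Instrl)
next
  case zero
  have "(\<lambda>x. pair_map t ((0 :: 'a \<times> 'a \<Rightarrow> 'a \<times> 'a) x) - 0 (pair_map t x)) = 0" by (auto simp: fun_eq_iff zero_prod_def triality_0[OF t])
  then show ?case using Instrl_closed(1) by (simp only:)
next
  case (add T U)
  have "pair_map t (x + y) = pair_map t x + pair_map t y" for x y by (cases x; cases y) (simp add: triality_add[OF t])
  then have "(\<lambda>x. pair_map t (T x + U x) - (T (pair_map t x) + U (pair_map t x))) =
      (\<lambda>x. (pair_map t (T x) - T (pair_map t x)) + (pair_map t (U x) - U (pair_map t x)))" by (simp add: fun_eq_iff)
  then show ?case using Instrl_closed(2)[OF add.IH] by (simp only:)
next
  case (scale c T)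
  interpret V: vector_space "scal A" by (rule vector_space_A)
  have "pair_map t (scal A c x) = scal A c (pair_map t x)" for x by (cases x) (simp add: triality_scale[OF t])
  then have "(\<lambda>x. pair_map t (scal A c (T x)) - scal A c (T (pair_map t x))) = (\<lambda>x. scal A c (pair_map t (T x) - T (pair_map t x)))"
    by (simp add: fun_eq_iff V.scale_right_diff_distrib)
  then show ?case using Instrl_closed(4)[OF scale.IH] by (simp only:)
qed

lemma kan_of_K: "pair_map t \<in> Instrl A \<Longrightarrow> kan_of t v \<in> K A"
  by (simp add: kan_of_def K_def skew_def)

lemma skew_iff: "s \<in> skew A \<longleftrightarrow> (\<exists>x. s = (x, - x))"
  by (cases s) (auto simp: skew_def)

lemma K_cases: assumes "x \<in> K A" obtains t v where "triality t" "pair_map t \<in> Instrl A" "x = kan_of t v"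
proof -
  obtain s a T b r where x: "x = (s, a, T, b, r)" by (cases x)
  then have "s \<in> skew A" "r \<in> skew A" "T \<in> Instrl A" using assms by (auto simp: K_def)
  then obtain s1 r1 t where st: "s = (s1, - s1)" "r = (r1, - r1)" "T = pair_map t" "triality t"
    using skew_iff Instrl_triality by metis
  have "x = kan_of t (\<lambda>i. if i = 0 then fst b else if i = 1 then r1 else if i = 2 then snd b
      else if i = 3 then snd a else if i = 4 then s1 else fst a)"
    by (simp add: x st kan_of_def)
  then show thesis using that[OF st(4)] \<open>T \<in> Instrl A\<close> st(3) by blast
qed

section \<open>Root projections and the axioms of the grading\<close>

definition proj_root :: "6 \<Rightarrow> ('a \<times> 'a) kan \<Rightarrow> ('a \<times> 'a) kan" where
  "proj_root i = (\<lambda>(s, a, T, b, r). if i = 0 then (0, 0, 0, (fst b, 0), 0) else if i = 1 then (0, 0, 0, 0, r)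
     else if i = 2 then (0, 0, 0, (0, snd b), 0) else if i = 3 then (0, (0, snd a), 0, 0, 0)
     else if i = 4 then (s, 0, 0, 0, 0) else (0, (fst a, 0), 0, 0, 0))"

definition proj_zero :: "('a \<times> 'a) kan \<Rightarrow> ('a \<times> 'a) kan" where
  "proj_zero = (\<lambda>(s, a, T, b, r). (0, 0, T, 0, 0))"

abbreviation ze :: "6 \<Rightarrow> 'a \<Rightarrow> 'a" where "ze \<equiv> \<lambda>_ _. 0"

definition single :: "6 \<Rightarrow> 'a \<Rightarrow> 6 \<Rightarrow> 'a" where "single i x = (\<lambda>j. if j = i then x else 0)"

lemma pair_map_ze: "pair_map ze = 0" by (auto simp: fun_eq_iff zero_prod_def)

lemma proj_root_kan_of: "proj_root i (kan_of t v) = kan_of ze (single i (v i))"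
  by (cases i "0 :: 6" rule: cases_6) (simp_all add: proj_root_def kan_of_def single_def pair_map_ze zero_prod_def)

lemma proj_zero_kan_of: "proj_zero (kan_of t v) = kan_of t (\<lambda>_. 0)"
  by (simp add: proj_zero_def kan_of_def zero_prod_def)

lemma zero_part_0 [simp]: "zero_part (\<lambda>_. 0) w j z = 0" "zero_part v (\<lambda>_. 0) j z = 0" and root_part_0 [simp]: "root_part (\<lambda>_. 0) w i = 0" "root_part v (\<lambda>_. 0) i = 0"
  by (simp_all add: zero_part_def root_part_def root_mul_linear)

lemma zero_part_z0 [simp]: "zero_part v w j 0 = 0"
  by (simp add: zero_part_def)

lemma zero_part_single: "zero_part (single i x) (single l y) j z = (if l = i + 3 then zero_part (single i x) (single (i + 3) y) j z else 0)"
  by (cases i "0 :: 6" rule: cases_6; cases l "0 :: 6" rule: cases_6) (simp_all add: zero_part_def single_def)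

lemma root_part_single: "root_part (single i x) (single l y) j = (if l = i + 2 then single (i + 1) (root_mul i x y) j
    else if l = i + 4 then single (i + 5) (- root_mul l y x) j else 0)"
  by (cases j i rule: cases_6; cases l i rule: cases_6) (simp_all add: root_part_def single_def root_mul_linear)

text \<open>The inverse properties collapse all products, so the bracket of \<open>x\<close> and its
  inverse acts on each root space by the Cartan integer; this provides the
  \<open>sl_2\<close>-triples that the axiom \<open>division\<close> asks for.\<close>

lemma zero_part_inverse:
  assumes "x \<cdot> y = e1" "y \<cdot> x = e1"
  shows "zero_part (single i x) (single (i + 3) y) j z = scal F (cart (j - i)) z"
proof -
  have s2: "scal F 2 z = z + z" using scale_left_distrib[of 1 1 z] by simp
  have inv: "x \<cdot> (y \<cdot> z) = z" "y \<cdot> (x \<cdot> z) = z" "(z \<cdot> x) \<cdot> y = z" "(z \<cdot> y) \<cdot> x = z"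
    using inverse_property_left[OF assms] inverse_property_left[OF assms(2,1)]
      inverse_property_right[OF assms] inverse_property_right[OF assms(2,1)] by simp_all
  show ?thesis
    by (cases i "0 :: 6" rule: cases_6; cases j "0 :: 6" rule: cases_6)
      (simp_all add: zero_part_def single_def cart_def inv assms s2)
qed

text \<open>The axioms that involve the bracket are checked in the coordinates
  \<open>kan_of t v\<close>, where each equation splits into one for trialities and one for root
  coordinates.\<close>

lemma a2_graded_lie_algebra_kan: "a2_graded_lie_algebra (scalK A) (K A) (bracket A) proj_root proj_zero"
proof -
  interpret V: vector_space "scalK A" by (rule vector_space_kan)
  interpret VA: vector_space "scal A" by (rule vector_space_A)
  have comm: "pair_map (\<lambda>j z. t j (u j z) - u j (t j z) + zero_part v w j z) \<in> Instrl A" if "triality t" "triality u" "pair_map u \<in> Instrl A" for t u v w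
  proof -
    have "pair_map (\<lambda>j z. t j (u j z) - u j (t j z) + zero_part v w j z) = (\<lambda>x. (pair_map t (pair_map u x) - pair_map u (pair_map t x)) + pair_map (zero_part v w) x)"
      by (auto simp: fun_eq_iff)
    then show ?thesis by (simp only:) (intro Instrl_closed pair_map_zero_part_Instrl pair_map_comm_Instrl that)
  qed
  have trib: "triality (\<lambda>j z. t j (u j z) - u j (t j z) + zero_part v w j z)" if "triality t" "triality u" for t u v w
    by (rule triality_plus[OF triality_comm[OF that] triality_zero_part])
  have SK: "V.subspace (K A)"
    unfolding V.subspace_def
  proof (intro conjI ballI allI)
    show "0 \<in> K A" using Instrl_closed(1) by (simp add: K_def zero_prod_def skew_def)
    fix x assume "x \<in> K A"
    then obtain t v where x: "triality t" "pair_map t \<in> Instrl A" "x = kan_of t v" by (rule K_cases)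
    show "scalK A c x \<in> K A" for c
    proof -
      have "pair_map (\<lambda>j z. scal F c (t j z)) = (\<lambda>z. scal A c (pair_map t z))" by (auto simp: fun_eq_iff)
      then show ?thesis unfolding x(3) kan_of_scale by (intro kan_of_K) (simp only: Instrl_closed(4)[OF x(2)])
    qed
    fix y assume "y \<in> K A"
    then obtain u w where y: "triality u" "pair_map u \<in> Instrl A" "y = kan_of u w" by (rule K_cases)
    have "pair_map (\<lambda>j z. t j z + u j z) = (\<lambda>z. pair_map t z + pair_map u z)" by (auto simp: fun_eq_iff)
    then show "x + y \<in> K A" unfolding x(3) y(3) kan_of_add by (intro kan_of_K) (simp only: Instrl_closed(2)[OF x(2) y(2)])
  qed
  have zeI: "pair_map ze \<in> Instrl A" using Instrl_closed(1) by (simp only: pair_map_ze)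
  have two0: "scal F 2 z = z + z" for z using scale_left_distrib[of 1 1 z] by simp
  show ?thesis
  proof (unfold_locales, goal_cases)
    case 1 show ?case by (rule SK)
  next
    case (2 x y)
    from 2(1) obtain t v where x: "triality t" "pair_map t \<in> Instrl A" "x = kan_of t v" by (rule K_cases)
    from 2(2) obtain u w where y: "triality u" "pair_map u \<in> Instrl A" "y = kan_of u w" by (rule K_cases)
    show ?case unfolding x(3) y(3) bracket_kan_of[OF x(1) y(1)] by (rule kan_of_K[OF comm[OF x(1) y(1,2)]])
  next
    case (3 x y z)
    from 3(1) obtain t v where x: "triality t" "pair_map t \<in> Instrl A" "x = kan_of t v" by (rule K_cases)
    from 3(2) obtain u w where y: "triality u" "pair_map u \<in> Instrl A" "y = kan_of u w" by (rule K_cases)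
    from 3(3) obtain r l where z: "triality r" "pair_map r \<in> Instrl A" "z = kan_of r l" by (rule K_cases)
    show ?case
      unfolding x(3) y(3) z(3) kan_of_add bracket_kan_of[OF triality_plus[OF x(1) y(1)] z(1)] bracket_kan_of[OF x(1) z(1)] bracket_kan_of[OF y(1) z(1)]
      by (rule kan_of_cong) (simp_all add: triality_linear[OF z(1)] zero_part_linear root_part_linear algebra_simps)
  next
    case (4 x y z)
    from 4(1) obtain t v where x: "triality t" "pair_map t \<in> Instrl A" "x = kan_of t v" by (rule K_cases)
    from 4(2) obtain u w where y: "triality u" "pair_map u \<in> Instrl A" "y = kan_of u w" by (rule K_cases)
    from 4(3) obtain r l where z: "triality r" "pair_map r \<in> Instrl A" "z = kan_of r l" by (rule K_cases)
    show ?case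
      unfolding x(3) y(3) z(3) kan_of_add bracket_kan_of[OF x(1) triality_plus[OF y(1) z(1)]] bracket_kan_of[OF x(1) z(1)] bracket_kan_of[OF x(1) y(1)]
      by (rule kan_of_cong) (simp_all add: triality_linear[OF x(1)] zero_part_linear root_part_linear algebra_simps)
  next
    case (5 x y c)
    from 5(1) obtain t v where x: "triality t" "pair_map t \<in> Instrl A" "x = kan_of t v" by (rule K_cases)
    from 5(2) obtain u w where y: "triality u" "pair_map u \<in> Instrl A" "y = kan_of u w" by (rule K_cases)
    show ?case
      unfolding x(3) y(3) kan_of_scale bracket_kan_of[OF triality_scaled[OF x(1)] y(1)] bracket_kan_of[OF x(1) y(1)]
      by (rule kan_of_cong) (simp_all add: triality_linear[OF y(1)] zero_part_linear root_part_linear scale_right_distrib scale_right_diff_distrib)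
  next
    case (6 x)
    from 6(1) obtain t v where x: "triality t" "pair_map t \<in> Instrl A" "x = kan_of t v" by (rule K_cases)
    have "zero_part v v j z = 0" "root_part v v i = 0" for j z i by (simp_all add: zero_part_def root_part_def)
    then show ?case unfolding x(3) bracket_kan_of[OF x(1) x(1)] kan_of_0[symmetric] by (intro kan_of_cong) simp_all
  next
    case (7 x y z)
    from 7(1) obtain t v where x: "triality t" "pair_map t \<in> Instrl A" "x = kan_of t v" by (rule K_cases)
    from 7(2) obtain u w where y: "triality u" "pair_map u \<in> Instrl A" "y = kan_of u w" by (rule K_cases)
    from 7(3) obtain r l where z: "triality r" "pair_map r \<in> Instrl A" "z = kan_of r l" by (rule K_cases)
    note lin = triality_linear[OF x(1)] triality_linear[OF y(1)] triality_linear[OF z(1)]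
    have Zt: "t j (zero_part v w j z) = zero_part v w j (t j z) + zero_part (\<lambda>i. t i (v i)) w j z + zero_part v (\<lambda>i. t i (w i)) j z" if "triality t" for t v w j z
      using triality_zero_part_comm[OF that, of j v w z] by (simp add: algebra_simps)
    have three: "p = s - q - r" if "p + q + r = s" for p q r s :: 'a using that by auto
    have Mlv: "root_part l v = (\<lambda>i. - root_part v l i)" using root_part_anti by blast
    have neg: "zero_part w (\<lambda>i. - u i) j z = - zero_part w u j z" "root_part w (\<lambda>i. - u i) i = - root_part w u i" for w u j z i
      by (simp_all add: zero_part_def inner_der_linear root_part_def root_mul_linear)
    \<comment> \<open>\<open>ZM\<close> and \<open>MM\<close> put the cyclic identities into the
      form of the Jacobi identity: one outer double bracket expressed by the other two.\<close>
    have ZM: "zero_part v (root_part w l) j z = zero_part (root_part v w) l j z - zero_part (root_part v l) w j z" for j z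
      using three[OF zero_part_root_part_cyclic[of v w l j z]] zero_part_anti[of l "root_part v w" j z] zero_part_anti[of w "root_part v l" j z]
      by (simp add: Mlv neg)
    have MM: "root_part v (root_part w l) i = root_part (root_part v w) l i + root_part w (root_part v l) i + (zero_part w l i (v i) + zero_part l v i (w i) + zero_part v w i (l i))" for i
      using three[OF root_part_root_part_cyclic[of v w l i]] root_part_anti[of l "root_part v w" i]
      by (simp add: Mlv neg)
    have ant: "zero_part l v j z = - zero_part v l j z" for j z by (rule zero_part_anti)
    show ?case
      unfolding x(3) y(3) z(3) bracket_kan_of[OF x(1) y(1)] bracket_kan_of[OF x(1) z(1)] bracket_kan_of[OF y(1) z(1)]
        bracket_kan_of[OF x(1) trib[OF y(1) z(1)]] bracket_kan_of[OF trib[OF x(1) y(1)] z(1)] bracket_kan_of[OF y(1) trib[OF x(1) z(1)]] kan_of_add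
    proof (rule kan_of_cong, goal_cases)
      case (1 j c)
      show ?case
        using ZM[of j c] Zt[OF x(1), of j w l c] Zt[OF y(1), of j v l c] Zt[OF z(1), of j v w c]
          zero_part_anti[of w "root_part v l" j c] zero_part_anti[of w "\<lambda>i. r i (v i)" j c]
        by (simp add: lin triality_linear[OF triality_zero_part] zero_part_linear algebra_simps)
    next
      case (2 i)
      show ?case
        using MM[of i] triality_root_part[OF x(1), of i w l] triality_root_part[OF y(1), of i v l] triality_root_part[OF z(1), of i v w] ant[of i "w i"]
          root_part_anti[of w "\<lambda>i. r i (v i)" i]
        by (simp add: lin triality_linear[OF triality_zero_part] root_part_linear algebra_simps)
    qed
  next
    case (8 i x y) show ?case by (cases x; cases y) (auto simp: proj_root_def zero_prod_def)
  next
    case (9 i c x) show ?case by (cases x) (auto simp: proj_root_def scalK_def zero_prod_def fun_eq_iff)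
  next
    case (10 x y) show ?case by (cases x; cases y) (auto simp: proj_zero_def zero_prod_def)
  next
    case (11 c x) show ?case by (cases x) (auto simp: proj_zero_def scalK_def zero_prod_def fun_eq_iff)
  next
    case (12 x i)
    from 12 obtain t v where x: "triality t" "pair_map t \<in> Instrl A" "x = kan_of t v" by (rule K_cases)
    show ?case unfolding x(3) proj_root_kan_of by (rule kan_of_K[OF zeI])
  next
    case (13 x)
    from 13 obtain t v where x: "triality t" "pair_map t \<in> Instrl A" "x = kan_of t v" by (rule K_cases)
    show ?case unfolding x(3) proj_zero_kan_of by (rule kan_of_K[OF x(2)])
  next
    case (14 i j x)
    show ?case by (cases x; cases i "0 :: 6" rule: cases_6; cases j "0 :: 6" rule: cases_6) (simp_all add: proj_root_def zero_prod_def)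
  next
    case (15 i x) show ?case by (cases x) (auto simp: proj_root_def proj_zero_def zero_prod_def)
  next
    case (16 i x) show ?case by (cases x) (auto simp: proj_root_def proj_zero_def zero_prod_def)
  next
    case (17 x) show ?case by (cases x) (auto simp: proj_zero_def)
  next
    case (18 x)
    from 18 obtain t v where x: "triality t" "pair_map t \<in> Instrl A" "x = kan_of t v" by (rule K_cases)
    show ?case unfolding x(3) proj_root_kan_of proj_zero_kan_of sum_6[of _ 0] kan_of_add
    proof (rule kan_of_cong, goal_cases)
      case (2 i) show ?case by (cases i "0 :: 6" rule: cases_6) (simp_all add: single_def)
    qed simp
  next
    case (19 x y i)
    from 19(1) obtain t v where x: "triality t" "pair_map t \<in> Instrl A" "x = kan_of t v" by (rule K_cases)
    from 19(2) obtain u w where y: "triality u" "pair_map u \<in> Instrl A" "y = kan_of u w" by (rule K_cases)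
    show ?case
      unfolding x(3) y(3) bracket_kan_of[OF x(1) y(1)] proj_root_kan_of proj_zero_kan_of bracket_kan_of[OF x(1) triality_zero] bracket_kan_of[OF triality_zero y(1)]
        bracket_kan_of[OF triality_zero triality_zero] kan_of_add
    proof (rule kan_of_cong, goal_cases)
      case (1 j z) show ?case by (simp add: zero_part_single triality_0[OF x(1)] triality_0[OF y(1)])
    next
      case (2 j) show ?case
        by (cases j i rule: cases_6) (simp_all add: root_part_single, simp_all add: single_def root_part_def triality_0[OF x(1)] triality_0[OF y(1)])
    qed
  next
    case (20 x y)
    from 20(1) obtain t v where x: "triality t" "pair_map t \<in> Instrl A" "x = kan_of t v" by (rule K_cases)
    from 20(2) obtain u w where y: "triality u" "pair_map u \<in> Instrl A" "y = kan_of u w" by (rule K_cases)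
    show ?case
      unfolding x(3) y(3) bracket_kan_of[OF x(1) y(1)] proj_root_kan_of proj_zero_kan_of bracket_kan_of[OF x(1) y(1)] bracket_kan_of[OF triality_zero triality_zero] sum_6[of _ 0] kan_of_add
    proof (rule kan_of_cong, goal_cases)
      case (1 j z) show ?case by (simp add: zero_part_def single_def algebra_simps)
    next
      case (2 j) show ?case by (simp add: root_part_single triality_0[OF x(1)] triality_0[OF y(1)])
    qed
  next
    case (21 x)
    from 21(1) obtain t v where x: "triality t" "pair_map t \<in> Instrl A" "x = kan_of t v" by (rule K_cases)
    have xt: "x = kan_of t (\<lambda>_. 0)" using 21(2) unfolding x(3) proj_zero_kan_of by simp
    \<comment> \<open>\<open>t i c\<close> is read off from the bracket with the element that has
      the coordinate \<open>c\<close> at the root \<open>i\<close> only.\<close>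
    have z: "t i c = 0" for i c
    proof -
      have "bracket A x (proj_root i (kan_of ze (single i c))) = 0" by (rule 21(3)) (rule kan_of_K[OF zeI])
      then have "kan_of (\<lambda>j z. t j 0 - 0 + zero_part (\<lambda>_. 0) (single i c) j z) (\<lambda>j. t j (single i c j) - 0 + root_part (\<lambda>_. 0) (single i c) j) = 0"
        unfolding xt proj_root_kan_of bracket_kan_of[OF x(1) triality_zero] by (simp add: single_def)
      from kan_of_eq_0D[OF this, of i] show ?thesis by (simp add: single_def)
    qed
    show ?case unfolding xt kan_of_0[symmetric] by (rule kan_of_cong) (simp_all add: z)
  next
    case (22 x i)
    from 22(1) obtain t v where x: "triality t" "pair_map t \<in> Instrl A" "x = kan_of t v" by (rule K_cases)
    have xs: "x = kan_of ze (single i (v i))" using 22(2) unfolding x(3) proj_root_kan_of by simp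
    have "v i \<noteq> 0"
    proof
      assume "v i = 0"
      then have "x = 0" unfolding xs kan_of_0[symmetric] by (intro kan_of_cong) (simp_all add: single_def)
      then show False using 22(3) by simp
    qed
    then obtain y where y: "v i \<cdot> y = e1" "y \<cdot> v i = e1" using invertible by blast
    let ?y = "kan_of ze (single (i + 3) y)"
    have b: "bracket A x ?y = kan_of (zero_part (single i (v i)) (single (i + 3) y)) (\<lambda>_. 0)"
      unfolding xs bracket_kan_of[OF triality_zero triality_zero] by (rule kan_of_cong) (simp_all add: root_part_single)
    show ?case
    proof (intro bexI conjI allI ballI)
      show "?y \<in> K A" by (rule kan_of_K[OF zeI])
      show "proj_root (i + 3) ?y = ?y" unfolding proj_root_kan_of by (rule kan_of_cong) (simp_all add: single_def)
      fix j z assume "z \<in> K A"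
      then obtain u w where z: "triality u" "pair_map u \<in> Instrl A" "z = kan_of u w" by (rule K_cases)
      show "bracket A (bracket A x ?y) (proj_root j z) = scalK A (cart (j - i)) (proj_root j z)"
        unfolding b z(3) proj_root_kan_of bracket_kan_of[OF triality_zero_part triality_zero] kan_of_scale
      proof (rule kan_of_cong, goal_cases)
        case (2 l)
        have "single j c j = c" "l \<noteq> j \<Longrightarrow> single j c l = 0" for c by (simp_all add: single_def)
        then show ?case by (cases "l = j") (simp_all add: zero_part_inverse[OF y])
      qed simp
    qed
  next
    case (23 i)
    have "proj_root i (kan_of ze (single i e1)) \<noteq> 0"
    proof
      assume "proj_root i (kan_of ze (single i e1)) = 0"
      then have "kan_of ze (single i (single i e1 i)) = 0" unfolding proj_root_kan_of .
      from kan_of_eq_0D[OF this, of i] show False using unity_nonzero by (simp add: single_def)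
    qed
    then show ?case using kan_of_K[OF zeI] by blast
  next
    case (24 W x)
    from 24(3) obtain t v where x: "triality t" "pair_map t \<in> Instrl A" "x = kan_of t v" by (rule K_cases)
    have W: "bracket A (kan_of ze (single i p)) (kan_of ze (single (i + 3) q)) \<in> W" for i p q
    proof -
      have s: "single i (single i c i) = single i c" for i c by (simp add: single_def)
      have "bracket A (proj_root i (kan_of ze (single i p))) (proj_root (i + 3) (kan_of ze (single (i + 3) q))) \<in> W"
        by (rule 24(2)) (rule kan_of_K[OF zeI])+
      then show ?thesis unfolding proj_root_kan_of s .
    qed
    have gen: "kan_of u (\<lambda>_. 0) \<in> W" if "\<And>j z. u j z = zero_part (single i p) (single (i + 3) q) j z" for u i p q
    proof -
      have "bracket A (kan_of ze (single i p)) (kan_of ze (single (i + 3) q)) = kan_of u (\<lambda>_. 0)"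
        unfolding bracket_kan_of[OF triality_zero triality_zero] by (rule kan_of_cong) (simp_all add: that root_part_single)
      then show ?thesis using W by metis
    qed
    have "pair_map t \<in> Instrl A \<Longrightarrow> (0, 0, pair_map t, 0, 0) \<in> W"
    proof (induction rule: Instrl_induct)
      case (V b a)
      obtain b1 b2 a1 a2 where ba: "b = (b1, b2)" "a = (a1, a2)" by (cases b, cases a)
      \<comment> \<open>\<open>V_op A b a\<close> is the sum of two brackets of opposite root
        elements, one for the roots 0, 3 and one for 2, 5.\<close>
      have "kan_of (\<lambda>j z. inner_der b1 a2 j z) (\<lambda>_. 0) \<in> W" by (rule gen[of _ 0 b1 a2]) (simp add: zero_part_def single_def)
      moreover have "kan_of (\<lambda>j z. inner_der b2 a1 (j + 4) z) (\<lambda>_. 0) \<in> W" by (rule gen[of _ 2 b2 a1]) (simp add: zero_part_def single_def)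
      ultimately have "kan_of (\<lambda>j z. inner_der b1 a2 j z) (\<lambda>_. 0) + kan_of (\<lambda>j z. inner_der b2 a1 (j + 4) z) (\<lambda>_. 0) \<in> W"
        by (rule V.subspace_add[OF 24(1)])
      then show ?case unfolding kan_of_add by (simp add: kan_of_def ba V_op_pair_map zero_prod_def)
    next
      case zero show ?case using V.subspace_0[OF 24(1)] by (simp add: zero_prod_def zero_fun_def)
    next
      case (add T U) show ?case using V.subspace_add[OF 24(1) add.IH] by (simp add: plus_fun_def)
    next
      case (scale c T) show ?case using V.subspace_scale[OF 24(1) scale.IH, of c] by (simp add: scalK_def)
    qed
    then show ?case unfolding x(3) proj_zero_kan_of using x(2) by (simp add: kan_of_def zero_prod_def)
  qed simp_all
qed

end

section \<open>The main theorem\<close>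

context alternative_division_algebra_char begin

section \<open>Translation into the notions of the statement\<close>

interpretation L: a2_graded_lie_algebra "scalK A" "K A" "bracket A" proj_root proj_zero
  by (rule a2_graded_lie_algebra_kan)

lemma inner_ideal_eq: "inner_ideal A = L.inner"
  by (simp add: fun_eq_iff inner_ideal_def L.inner_def)

lemma ideals_eq: "min_ideals A = L.minimals" "nonmin_ideals A = L.nonminimals"
  by (simp_all add: min_ideals_def nonmin_ideals_def L.minimals_def L.nonminimals_def minimal_inner_ideal_def L.minimal_def
      nontrivial_inner_ideal_def L.nontrivial_def inner_ideal_eq)

lemma geometry_eq: "Omega A = L.ideal_graph" "Gamma A = L.ideal_geometry" "act_Omega A = L.act"
  by (simp_all add: Omega_def L.ideal_graph_def Gamma_def L.ideal_geometry_def act_Omega_def L.act_def ideals_eq fun_eq_iff)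

lemma e_minus_eq: "e_minus A a s = L.exp_neg (s, a, 0, 0, 0)"
  by (simp add: e_minus_def L.exp_neg_def L.exp_ad_def)

lemma zero_mem: "0 \<in> skew A" "0 \<in> Instrl A"
  using Instrl_closed(1) by (simp_all add: skew_def zero_prod_def)

lemma root_spaces: "L.R 5 = {(0, (f, 0), 0, 0, 0) | f. True}" "L.R 4 = {(s, 0, 0, 0, 0) | s. s \<in> skew A}"
  "L.R 3 = {(0, (0, f), 0, 0, 0) | f. True}"
  using zero_mem unfolding L.R_def unfolding K_def by (auto simp: proj_root_def zero_prod_def)

lemma negative_part: "L.neg_part 4 = {(s, a, 0, 0, 0) | s a. s \<in> skew A}"
  using zero_mem unfolding L.neg_part_def unfolding K_def by (auto simp: proj_root_def proj_zero_def zero_prod_def)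

lemma bracket_negative: "bracket A (t, b, 0, 0, 0) (s, a, 0, 0, 0) = (psi A b a, 0, 0, 0, 0)"
proof -
  have z: "mul A 0 x = 0" "mul A x 0 = 0" "invo A 0 = 0" for x
    by (cases x; simp add: zero_prod_def)+
  have "psi A 0 0 = 0" by (simp add: psi_def z)
  then show ?thesis by (simp add: eps_def delta_def V_op_def z zero_fun_def)
qed

lemma act_e_minus:
  "L.act ` {e_minus A (f, 0) 0 | f. True} = L.act ` {L.exp_root y | y. y \<in> L.R 5}"
  "L.act ` {e_minus A 0 s | s. s \<in> skew A} = L.act ` {L.exp_root y | y. y \<in> L.R 4}"
  "L.act ` {e_minus A (0, f) 0 | f. True} = L.act ` {L.exp_root y | y. y \<in> L.R 3}"
proof -
  have *: "L.act ` {L.exp_root y | y. y \<in> L.R j} = L.act ` L.exp_neg ` L.R j" for j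
  proof -
    have "L.act ` {L.exp_root y | y. y \<in> L.R j} = (\<lambda>y. L.act (L.exp_root y)) ` L.R j" by blast
    also have "\<dots> = (\<lambda>y. L.act (L.exp_neg y)) ` L.R j" by (rule image_cong[OF refl]) (simp add: L.act_exp_neg_R)
    finally show ?thesis by (simp only: image_image)
  qed
  have "{e_minus A (f, 0) 0 | f. True} = L.exp_neg ` L.R 5" "{e_minus A 0 s | s. s \<in> skew A} = L.exp_neg ` L.R 4"
    "{e_minus A (0, f) 0 | f. True} = L.exp_neg ` L.R 3"
    unfolding e_minus_eq root_spaces by blast+
  then show "L.act ` {e_minus A (f, 0) 0 | f. True} = L.act ` {L.exp_root y | y. y \<in> L.R 5}"
    "L.act ` {e_minus A 0 s | s. s \<in> skew A} = L.act ` {L.exp_root y | y. y \<in> L.R 4}"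
    "L.act ` {e_minus A (0, f) 0 | f. True} = L.act ` {L.exp_root y | y. y \<in> L.R 3}"
    unfolding * by (simp_all only:)
qed

lemma E_minus_eq: "E_minus_group A = \<lparr> carrier = L.exp_neg ` L.neg_part 4, mult = (\<lambda>f g. compose (K A) g f), one = (\<lambda>x \<in> K A. x) \<rparr>"
proof -
  have "E_minus A = L.exp_neg ` L.neg_part 4" unfolding E_minus_def e_minus_eq negative_part by blast
  then show ?thesis by (simp add: E_minus_group_def)
qed

text \<open>The cycle runs downwards and starts at \<open>X 1\<close>, so that the paths which begin
  at its positions 1, 2, 3 belong to the roots 5, 4, 3, that is to \<open>(F, 0)\<close>, the skew
  elements and \<open>(0, F)\<close> of the negative part.\<close>

abbreviation hexagon :: "('a \<times> 'a) kan set list" where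
  "hexagon \<equiv> [L.X 1, L.X 0, L.X 5, L.X 4, L.X 3, L.X 2]"

lemma cycle_root_groups:
  "cycle_root_group L.ideal_graph 3 hexagon 1 = L.act ` {L.exp_root y | y. y \<in> L.R 5}"
  "cycle_root_group L.ideal_graph 3 hexagon 2 = L.act ` {L.exp_root y | y. y \<in> L.R 4}"
  "cycle_root_group L.ideal_graph 3 hexagon 3 = L.act ` {L.exp_root y | y. y \<in> L.R 3}"
proof -
  have u: "[1..<Suc (3 + 1)] = [1, 2, 3, 4]" "[2..<Suc (3 + 2)] = [2, 3, 4, 5]" "[3..<Suc (3 + 3)] = [3, 4, 5, 6]"
    by (simp_all add: upt_rec)
  show "cycle_root_group L.ideal_graph 3 hexagon 1 = L.act ` {L.exp_root y | y. y \<in> L.R 5}"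
    using L.root_group_eq[of 5] unfolding cycle_root_group_def u by simp
  show "cycle_root_group L.ideal_graph 3 hexagon 2 = L.act ` {L.exp_root y | y. y \<in> L.R 4}"
    using L.root_group_eq[of 4] unfolding cycle_root_group_def u by simp
  show "cycle_root_group L.ideal_graph 3 hexagon 3 = L.act ` {L.exp_root y | y. y \<in> L.R 3}"
    using L.root_group_eq[of 3] unfolding cycle_root_group_def u by simp
qed

lemma hexagon_cycle: "graph_cycle L.ideal_graph hexagon"
  unfolding graph_cycle_def
proof (intro conjI allI impI)
  have X: "L.X i = L.X j \<longleftrightarrow> i = j" for i j using L.X_inj by blast
  show "distinct hexagon" by (simp add: X)
  show "set hexagon \<subseteq> gverts L.ideal_graph" using L.X_nonminimals by simp
  fix i assume "i < length hexagon"
  then have "i = 0 \<or> i = 1 \<or> i = 2 \<or> i = 3 \<or> i = 4 \<or> i = 5" by (simp, linarith)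
  then show "{hexagon ! i, hexagon ! (Suc i mod length hexagon)} \<in> gedges L.ideal_graph"
    using L.adj_X[of 0] L.adj_X[of 1] L.adj_X[of 2] L.adj_X[of 3] L.adj_X[of 4] L.adj_X[of 5]
    by (elim disjE) simp_all
qed simp

theorem moufang_triangle_of_double:
  "\<exists>\<Delta> :: (('a \<times> 'a) kan set, ('a \<times> 'a) kan set) geometry.
      graph_iso (case_sum id id) (incidence_graph \<Delta>) (Omega A)
    \<and> moufang_gon 3 \<Delta>
    \<and> (\<exists>xs. graph_cycle (Omega A) xs \<and> length xs = 6
        \<and> act_Omega A ` {e_minus A (f, 0) 0 | f. True} = cycle_root_group (Omega A) 3 xs 1
        \<and> act_Omega A ` {e_minus A 0 s | s. s \<in> skew A} = cycle_root_group (Omega A) 3 xs 2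
        \<and> act_Omega A ` {e_minus A (0, f) 0 | f. True} = cycle_root_group (Omega A) 3 xs 3
        \<and> act_Omega A \<in> iso (E_minus_group A)
            ((graph_aut_group (Omega A)) \<lparr> carrier := generate (graph_aut_group (Omega A))
                (\<Union>i \<in> {1..3}. cycle_root_group (Omega A) 3 xs i) \<rparr>)
        \<and> (\<forall>a b. \<forall>s \<in> skew A. \<forall>t \<in> skew A.
            group_commutator (graph_aut_group (Omega A))
                (act_Omega A (e_minus A a s)) (act_Omega A (e_minus A b t))
              = act_Omega A (e_minus A 0 (psi A b a))))
    \<and> generalized_gon 6 (Gamma A) \<and> thin (Gamma A)
    \<and> (\<exists>\<alpha>. geometry_iso \<alpha> (case_sum id id) (dual_double \<Delta>) (Gamma A))"
proof -
  have i: "{1..3::nat} = {1, 2, 3}" by auto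
  have Un: "(\<Union>i \<in> {1..3}. cycle_root_group L.ideal_graph 3 hexagon i) = L.act ` {L.exp_root y | y. y \<in> L.R 4}
      \<union> L.act ` {L.exp_root y | y. y \<in> L.R 5} \<union> L.act ` {L.exp_root y | y. y \<in> L.R 3}"
    unfolding i by (simp only: UN_insert UN_empty cycle_root_groups) blast
  have iso: "L.act \<in> iso (E_minus_group A) (L.G \<lparr> carrier := generate L.G (\<Union>i \<in> {1..3}. cycle_root_group L.ideal_graph 3 hexagon i) \<rparr>)"
    using L.act_iso[of 4] unfolding Un E_minus_eq by simp
  have comm: "group_commutator L.G (L.act (e_minus A a s)) (L.act (e_minus A b t)) = L.act (e_minus A 0 (psi A b a))"
    if "s \<in> skew A" "t \<in> skew A" for a b s t
  proof -
    have "(s, a, 0, 0, 0) \<in> L.neg_part 4" "(t, b, 0, 0, 0) \<in> L.neg_part 4" using that unfolding negative_part by blast+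
    from L.act_commutator[OF this] show ?thesis unfolding e_minus_eq bracket_negative .
  qed
  have cycle: "graph_cycle L.ideal_graph hexagon \<and> length hexagon = 6
        \<and> L.act ` {e_minus A (f, 0) 0 | f. True} = cycle_root_group L.ideal_graph 3 hexagon 1
        \<and> L.act ` {e_minus A 0 s | s. s \<in> skew A} = cycle_root_group L.ideal_graph 3 hexagon 2
        \<and> L.act ` {e_minus A (0, f) 0 | f. True} = cycle_root_group L.ideal_graph 3 hexagon 3
        \<and> L.act \<in> iso (E_minus_group A)
            (L.G \<lparr> carrier := generate L.G (\<Union>i \<in> {1..3}. cycle_root_group L.ideal_graph 3 hexagon i) \<rparr>)
        \<and> (\<forall>a b. \<forall>s \<in> skew A. \<forall>t \<in> skew A.
            group_commutator L.G (L.act (e_minus A a s)) (L.act (e_minus A b t)) = L.act (e_minus A 0 (psi A b a)))"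
    by (intro conjI allI ballI hexagon_cycle iso comm)
       (simp_all only: act_e_minus cycle_root_groups, simp)
  show ?thesis
    unfolding geometry_eq
    by (rule exI[of _ L.ideal_plane], intro conjI L.ideal_plane_iso L.moufang_triangle L.generalized_hexagon L.thin_hexagon
        exI[of _ hexagon] exI[of _ "\<lambda>(p, l). p \<inter> l"] L.dual_double_iso) (use cycle in blast)+
qed

end

theorem theorem6p19:
  fixes F :: "('k::field, 'a::ab_group_add) nalgebra"
    and A :: "('k, 'a \<times> 'a) ialgebra"
  assumes "alternative_division_algebra F"
    and "range (\<lambda>c. scal F c (unity F)) = centre F"
    and "\<exists>B. finite_dimensional_vector_space (scal F) B"
    and "CHAR('k) \<noteq> 2" and "CHAR('k) \<noteq> 3"
    and "A = double F"
  shows "\<exists>\<Delta> :: (('a \<times> 'a) kan set, ('a \<times> 'a) kan set) geometry.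
      graph_iso (case_sum id id) (incidence_graph \<Delta>) (Omega A)
    \<and> moufang_gon 3 \<Delta>
    \<and> (\<exists>xs. graph_cycle (Omega A) xs \<and> length xs = 6
        \<and> act_Omega A ` {e_minus A (f, 0) 0 | f. True} = cycle_root_group (Omega A) 3 xs 1
        \<and> act_Omega A ` {e_minus A 0 s | s. s \<in> skew A} = cycle_root_group (Omega A) 3 xs 2
        \<and> act_Omega A ` {e_minus A (0, f) 0 | f. True} = cycle_root_group (Omega A) 3 xs 3
        \<and> act_Omega A \<in> iso (E_minus_group A)
            ((graph_aut_group (Omega A)) \<lparr> carrier := generate (graph_aut_group (Omega A))
                (\<Union>i \<in> {1..3}. cycle_root_group (Omega A) 3 xs i) \<rparr>)
        \<and> (\<forall>a b. \<forall>s \<in> skew A. \<forall>t \<in> skew A.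
            group_commutator (graph_aut_group (Omega A))
                (act_Omega A (e_minus A a s)) (act_Omega A (e_minus A b t))
              = act_Omega A (e_minus A 0 (psi A b a))))
    \<and> generalized_gon 6 (Gamma A) \<and> thin (Gamma A)
    \<and> (\<exists>\<alpha>. geometry_iso \<alpha> (case_sum id id) (dual_double \<Delta>) (Gamma A))"
proof -
  have "(2 :: 'k) \<noteq> 0"
  proof
    assume "(2 :: 'k) = 0"
    then have "CHAR('k) dvd 2" using of_nat_eq_0_iff_char_dvd[of 2, where 'a = 'k] by simp
    then have "CHAR('k) \<le> 2" "CHAR('k) \<noteq> 0" by (auto dest: dvd_imp_le intro!: Nat.gr0I)
    then show False using CHAR_not_1[where 'a = 'k] assms(4) by linarith
  qed
  moreover have "(3 :: 'k) \<noteq> 0"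
  proof
    assume "(3 :: 'k) = 0"
    then have *: "CHAR('k) dvd 3" using of_nat_eq_0_iff_char_dvd[of 3, where 'a = 'k] by simp
    then have "CHAR('k) \<le> 3" "CHAR('k) \<noteq> 0" by (auto dest: dvd_imp_le intro!: Nat.gr0I)
    then have "CHAR('k) = 2" using CHAR_not_1[where 'a = 'k] assms(5) by linarith
    then show False using * by simp
  qed
  ultimately interpret alternative_division_algebra_char F using assms(1) by (simp add: alternative_division_algebra_char_def alternative_division_algebra_char_axioms_def)
  show ?thesis unfolding assms(6) by (rule moufang_triangle_of_double)
qed

end
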